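(* Let $K$ be an imaginary quadratic field, $f_\rho$ a positive integer, $N=f_\rho|D_K|$ and $\underline{\mathfrak c}=f_\rho\sqrt{D_K}\,\mathcal O_K$. Let $\chi$ be a character of $(\mathcal O_K/\underline{\mathfrak c})^\times$ with $\chi(u)=u$ for all $u\in\mathcal O_K^\times$. Let $\mathfrak c_f$ be an integral ideal of $\mathcal O_K$ dividing $\underline{\mathfrak c}$, and let $\varphi$ be a Hecke character of $K$ of infinity type $[-1/2;1,0]$ with conductor $\mathfrak c_f$ whose finite character $\chi'_\varphi$, pulled back to $(\mathcal O_K/\underline{\mathfrak c})^\times$, equals $\chi^{-1}$. Then $\vartheta(\tau;\varphi)\in F^{\chi^{-1}}(f_\rho)$. Moreover $\vartheta(\tau;\varphi)$ is a linear combination of the functions $f_a(\tau;\beta)$ ($a=1,\dots,h$, $\beta\in G_{\Lambda_a}$) in which all nonzero coefficients have the same absolute value.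
   Context: Embed $K\subset\mathbb C$ with $\sqrt{D_K}$ in the upper half plane $\mathcal H$; $D_K<0$ is the discriminant, $h$ the class number. Hecke character $\varphi$ of infinity type $[-1/2;1,0]$ with conductor $\mathfrak c_f$: a homomorphism from fractional ideals prime to $\mathfrak c_f$ to $\mathbb C^\times$ with $\varphi(\alpha\mathcal O_K)=\alpha\chi'_\varphi(\alpha)$ for $\alpha\in\mathcal O_K$ prime to $\mathfrak c_f$, for a character $\chi'_\varphi$ of $(\mathcal O_K/\mathfrak c_f)^\times$, $\mathfrak c_f$ minimal. Hecke theta function: $\vartheta(\tau;\varphi)=\sum_I\varphi(I)e^{2\pi i\tau\mathrm{Nm}(I)}$ over nonzero integral ideals, $\varphi(I)=0$ if $I$ not prime to $\mathfrak c_f$. Let $z_1,\dots,z_h\in\mathcal H$ represent the $\mathbb C$-isomorphism classes of elliptic curves with CM by $\mathcal O_K$, $\mathfrak b_{z_a}=\mathbb Z+z_a\mathbb Z$. For $z=z_a$ let $(a_z,b_z,c_z)$ be coprime integers, $a_z>0$, $a_zz^2+b_zz+c_z=0$. Let $\Lambda_a$ be the lattice with basis $e_2,e_1$ and Gram matrix $f_\rho\begin{pmatrix}2a_z&b_z\\ b_z&2c_z\end{pmatrix}$, $G_{\Lambda_a}=\Lambda_a^\vee/\Lambda_a$, $\Omega'_a$ the $\mathbb Q$-linear map to $\mathbb C$ with $\Omega'_a(e_2)=\sqrt{2a_zf_\rho}$, $\Omega'_a(e_1)=-\sqrt{2a_zf_\rho}z$, and $\Omega_a=i\sqrt{|G_{\Lambda_a}|}(2a_zf_\rho)^{-1/2}\Omega'_a$;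 then $\Omega_a(\Lambda_a^\vee)=\mathfrak b_{z_a}$ and $\Omega_a(\Lambda_a)=\underline{\mathfrak c}\,\mathfrak b_{z_a}$, so $G_{\Lambda_a}\cong\mathfrak b_{z_a}/\underline{\mathfrak c}\mathfrak b_{z_a}$, on which the group $(\mathcal O_K/\underline{\mathfrak c})^\times$ (the CM group) acts by multiplication; write $g\cdot\beta$. Put $f_a(\tau;\beta)=\sum_{y\in\Lambda_a^\vee,\,y+\Lambda_a=\beta}\Omega'_a(y)e^{\pi iN\tau(y,y)}$. For a character $\chi$ of the CM group let $F_a^{\chi^{-1}}$ be the span over $\beta_0\in G_{\Lambda_a}$ of $\sum_{g\in(\mathcal O_K/\underline{\mathfrak c})^\times}\chi(g)f_a(\tau;g^{-1}\cdot\beta_0)$, and $F^{\chi^{-1}}(f_\rho)=\sum_{a=1}^hF_a^{\chi^{-1}}$. *)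

theory Defs
  imports "HOL-Analysis.Analysis" "HOL-Computational_Algebra.Squarefree"
begin

definition fundamental_disc :: "int \<Rightarrow> bool" where
  "fundamental_disc D \<longleftrightarrow> D \<noteq> 1 \<and>
     ((D mod 4 = 1 \<and> squarefree D) \<or>
      (D mod 4 = 0 \<and> (D div 4) mod 4 \<in> {2, 3} \<and> squarefree (D div 4)))"

definition sqrtD :: "int \<Rightarrow> complex" where
  "sqrtD D = \<i> * complex_of_real (sqrt (real_of_int (- D)))"

definition omegaK :: "int \<Rightarrow> complex" where
  "omegaK D = (of_int D + sqrtD D) / 2"

definition OK :: "int \<Rightarrow> complex set" where
  "OK D = {of_int x + of_int y * omegaK D | x y. True}"

definition units_OK :: "int \<Rightarrow> complex set" where
  "units_OK D = {u \<in> OK D. \<exists>v \<in> OK D. u * v = 1}"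

definition is_ideal :: "int \<Rightarrow> complex set \<Rightarrow> bool" where
  "is_ideal D I \<longleftrightarrow> I \<subseteq> OK D \<and> 0 \<in> I \<and> (\<forall>x\<in>I. \<forall>y\<in>I. x + y \<in> I)
      \<and> (\<forall>r\<in>OK D. \<forall>x\<in>I. r * x \<in> I)"

definition int_ideal :: "int \<Rightarrow> complex set \<Rightarrow> bool" where
  "int_ideal D I \<longleftrightarrow> is_ideal D I \<and> I \<noteq> {0}"

definition idl_mult :: "complex set \<Rightarrow> complex set \<Rightarrow> complex set" where
  "idl_mult I J = {(\<Sum>k<n. x k * y k) | (n::nat) x y. \<forall>k<n. x k \<in> I \<and> y k \<in> J}"

definition princ :: "int \<Rightarrow> complex \<Rightarrow> complex set" where
  "princ D \<alpha> = (\<lambda>r. \<alpha> * r) ` OK D"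

definition ideal_dvd :: "int \<Rightarrow> complex set \<Rightarrow> complex set \<Rightarrow> bool" where
  "ideal_dvd D I J \<longleftrightarrow> (\<exists>L. int_ideal D L \<and> J = idl_mult I L)"

definition coprime_ideals :: "complex set \<Rightarrow> complex set \<Rightarrow> bool" where
  "coprime_ideals I J \<longleftrightarrow> (\<exists>x\<in>I. \<exists>y\<in>J. x + y = 1)"

definition coprime_elt :: "int \<Rightarrow> complex \<Rightarrow> complex set \<Rightarrow> bool" where
  "coprime_elt D \<alpha> I \<longleftrightarrow> coprime_ideals (princ D \<alpha>) I"

definition ideal_norm :: "int \<Rightarrow> complex set \<Rightarrow> nat" where
  "ideal_norm D I = card ((\<lambda>x. {y \<in> OK D. x - y \<in> I}) ` OK D)"

definition cideal :: "int \<Rightarrow> nat \<Rightarrow> complex set" where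
  "cideal D f = princ D (of_nat f * sqrtD D)"

text \<open>A character of (O_K/m)^x, given as a function on representatives in O_K prime to m.\<close>
definition char_mod :: "int \<Rightarrow> complex set \<Rightarrow> (complex \<Rightarrow> complex) \<Rightarrow> bool" where
  "char_mod D m ch \<longleftrightarrow>
     (\<forall>\<alpha>\<in>OK D. \<forall>\<beta>\<in>OK D. coprime_elt D \<alpha> m \<longrightarrow> coprime_elt D \<beta> m \<longrightarrow>
        (\<alpha> - \<beta> \<in> m \<longrightarrow> ch \<alpha> = ch \<beta>) \<and> ch (\<alpha> * \<beta>) = ch \<alpha> * ch \<beta>)
     \<and> (\<forall>\<alpha>\<in>OK D. coprime_elt D \<alpha> m \<longrightarrow> ch \<alpha> \<noteq> 0)"

definition cm_group :: "int \<Rightarrow> complex set \<Rightarrow> complex set set" where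
  "cm_group D c = (\<lambda>\<alpha>. {\<beta> \<in> OK D. \<beta> - \<alpha> \<in> c}) ` {\<alpha> \<in> OK D. coprime_elt D \<alpha> c}"

definition char_cls :: "(complex \<Rightarrow> complex) \<Rightarrow> complex set \<Rightarrow> complex" where
  "char_cls ch g = ch (SOME \<alpha>. \<alpha> \<in> g)"

definition hecke_theta :: "int \<Rightarrow> (complex set \<Rightarrow> complex) \<Rightarrow> complex set \<Rightarrow> complex \<Rightarrow> complex" where
  "hecke_theta D \<phi> cf \<tau> =
     infsum (\<lambda>I. (if coprime_ideals I cf then \<phi> I else 0)
                   * exp (2 * pi * \<i> * \<tau> * of_nat (ideal_norm D I)))
            {I. int_ideal D I}"

definition latt :: "complex \<Rightarrow> complex set" where
  "latt z = {of_int m + of_int n * z | m n. True}"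

definition mult_ring :: "complex set \<Rightarrow> complex set" where
  "mult_ring L = {\<alpha>. (\<lambda>x. \<alpha> * x) ` L \<subseteq> L}"

definition has_CM_OK :: "int \<Rightarrow> complex set \<Rightarrow> bool" where
  "has_CM_OK D L \<longleftrightarrow> mult_ring L = OK D"

definition homothetic :: "complex set \<Rightarrow> complex set \<Rightarrow> bool" where
  "homothetic L L' \<longleftrightarrow> (\<exists>t. t \<noteq> 0 \<and> L' = (\<lambda>x. t * x) ` L)"

section \<open>The lattice Lambda_a (coordinates (y2, y1) w.r.t. the basis e2, e1)\<close>

definition bil :: "nat \<Rightarrow> int \<Rightarrow> int \<Rightarrow> int \<Rightarrow> rat \<times> rat \<Rightarrow> rat \<times> rat \<Rightarrow> rat" where
  "bil f A B C y w = of_nat f * (2 * of_int A * fst y * fst w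
       + of_int B * (fst y * snd w + snd y * fst w) + 2 * of_int C * snd y * snd w)"

definition std_lat :: "(rat \<times> rat) set" where
  "std_lat = {y. fst y \<in> \<int> \<and> snd y \<in> \<int>}"

definition dual_lat :: "nat \<Rightarrow> int \<Rightarrow> int \<Rightarrow> int \<Rightarrow> (rat \<times> rat) set" where
  "dual_lat f A B C = {y. \<forall>x\<in>std_lat. bil f A B C x y \<in> \<int>}"

definition coset :: "rat \<times> rat \<Rightarrow> (rat \<times> rat) set" where
  "coset y = {(fst y + fst x, snd y + snd x) | x. x \<in> std_lat}"

definition disc_grp :: "nat \<Rightarrow> int \<Rightarrow> int \<Rightarrow> int \<Rightarrow> (rat \<times> rat) set set" where
  "disc_grp f A B C = coset ` dual_lat f A B C"

definition Omega' :: "nat \<Rightarrow> int \<Rightarrow> complex \<Rightarrow> rat \<times> rat \<Rightarrow> complex" where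
  "Omega' f A z y = complex_of_real (sqrt (2 * of_int A * of_nat f))
        * (of_rat (fst y) - of_rat (snd y) * z)"

definition Omega :: "nat \<Rightarrow> int \<Rightarrow> int \<Rightarrow> int \<Rightarrow> complex \<Rightarrow> rat \<times> rat \<Rightarrow> complex" where
  "Omega f A B C z y = \<i> * complex_of_real (sqrt (real (card (disc_grp f A B C))))
        * complex_of_real (inverse (sqrt (2 * of_int A * of_nat f))) * Omega' f A z y"

definition theta_fa :: "int \<Rightarrow> nat \<Rightarrow> int \<Rightarrow> int \<Rightarrow> int \<Rightarrow> complex \<Rightarrow> complex \<Rightarrow> (rat \<times> rat) set \<Rightarrow> complex" where
  "theta_fa D f A B C z \<tau> \<beta> =
     infsum (\<lambda>y. Omega' f A z y
                 * exp (pi * \<i> * of_nat (f * nat \<bar>D\<bar>) * \<tau> * of_rat (bil f A B C y y))) \<beta>"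

text \<open>Action g . beta of the CM group on G_Lambda, via Omega: G_Lambda = b / c b.\<close>
definition cm_act :: "nat \<Rightarrow> int \<Rightarrow> int \<Rightarrow> int \<Rightarrow> complex \<Rightarrow> complex set \<Rightarrow> (rat \<times> rat) set \<Rightarrow> (rat \<times> rat) set" where
  "cm_act f A B C z g \<beta> = {y \<in> dual_lat f A B C. \<exists>x\<in>\<beta>. \<exists>\<alpha>\<in>g.
       Omega f A B C z y - \<alpha> * Omega f A B C z x \<in> Omega f A B C z ` std_lat}"

definition cm_act_inv :: "nat \<Rightarrow> int \<Rightarrow> int \<Rightarrow> int \<Rightarrow> complex \<Rightarrow> complex set \<Rightarrow> (rat \<times> rat) set \<Rightarrow> (rat \<times> rat) set" where
  "cm_act_inv f A B C z g \<beta>0 = {y \<in> dual_lat f A B C. cm_act f A B C z g (coset y) = \<beta>0}"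

text \<open>The generator sum_g chi(g) f_a(tau; g^{-1} . beta0) of F_a^{chi^{-1}}.\<close>
definition twisted :: "int \<Rightarrow> nat \<Rightarrow> int \<Rightarrow> int \<Rightarrow> int \<Rightarrow> complex \<Rightarrow> (complex \<Rightarrow> complex) \<Rightarrow> complex \<Rightarrow> (rat \<times> rat) set \<Rightarrow> complex" where
  "twisted D f A B C z ch \<tau> \<beta>0 =
     (\<Sum>g\<in>cm_group D (cideal D f). char_cls ch g * theta_fa D f A B C z \<tau> (cm_act_inv f A B C z g \<beta>0))"

end

theory Submission
  imports Defs
begin

text \<open>
  Write \<open>b = latt z\<close> for one of the given lattices, with form \<open>(A, B, C)\<close>. Its inverse is \<open>A \<cdot> cnj b\<close>, so
  every nonzero ideal is \<open>x b\<^sup>-\<^sup>1\<close> for exactly one of the lattices \<open>b\<close> and some nonzero \<open>x \<in> b\<close>, unique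
  up to units, and its norm is \<open>A |x|\<^sup>2\<close>. A primitive form represents integers prime to any modulus, so there is
  \<open>y\<close> with \<open>y b\<close> integral and prime to the conductor; multiplying \<open>x b\<^sup>-\<^sup>1\<close> by \<open>y b\<close> gives the principal ideal
  \<open>(x y)\<close>, hence \<open>\<phi> (x b\<^sup>-\<^sup>1) = x \<cdot> (y / \<phi> (y b)) \<cdot> ch' (x y)\<close>, where \<open>ch' (x y)\<close> depends only on \<open>x\<close> modulo
  \<open>c b\<close>. Splitting the theta series by ideal class and then by residue class modulo \<open>c b\<close> expresses it
  through the \<open>theta_fa\<close>. The coefficients are eigenvectors of the CM group, so averaging over the group
  yields the twisted sums. They have constant modulus because \<open>|\<phi> I|\<^sup>2 = Nm I\<close>: the quotient of the two
  sides is multiplicative in \<open>I\<close> and takes at most one value per ideal class, and a positive real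
  number whose powers lie in a finite set is \<open>1\<close>.
\<close>

section \<open>Planar lattices and their indices\<close>


text \<open>Values of \<open>\<phi>\<close> are known on integral ideals only, so fractional ideals
  are avoided: \<open>b^-1\<close> occurs in the integral ideals \<open>x b^-1\<close>, and
  \<open>b\<close> itself through a fixed integral multiple \<open>y b\<close>. That
  \<open>A * cnj b\<close> is inverse to \<open>b\<close> is primitivity of the form: the pairings
  \<open>A * cnj s * t\<close> with \<open>s\<close>, \<open>t\<close> in \<open>b\<close> produce
  \<open>A\<close>, \<open>B\<close> and \<open>C\<close>, hence 1 by Bezout. That the given
  lattices exhaust all ideal classes is where fundamentality of \<open>D\<close> enters, since it
  keeps the multiplier ring of an ideal from exceeding \<open>OK D\<close>. The bridge to the
  rational lattice is the identity \<open>sqrtD D = 2 A z + B\<close>: \<open>Omega\<close> is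
  multiplication by \<open>f * sqrtD D\<close> on vectors of the plane, and the coordinates of the
  result in the basis 1, \<open>z\<close> are the pairings with the basis vectors, so the dual
  lattice becomes \<open>b\<close>. One absolute value for all lattices needs a cancellation: the
  constant \<open>y / \<phi> (y b)\<close> has modulus \<open>sqrt A\<close>, and so has, up to a
  factor common to all lattices, the ratio of \<open>Omega'\<close> to \<open>Omega\<close>. What
  remains is \<open>sqrt (f * |D| / 2)\<close> divided by the number of units.\<close>

definition int_lat :: "int \<Rightarrow> int \<Rightarrow> int \<Rightarrow> int \<Rightarrow> (int \<times> int) set" where
  "int_lat a b c d = {(s * a + t * c, s * b + t * d) | s t. True}"

text \<open>One division step of Euclid's algorithm on the two generating rows; swapping them flips
  the sign of the determinant.\<close>

lemma int_lat_step: "int_lat a b c d = int_lat c d (a - k * c) (b - k * d)"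
proof (intro equalityI subsetI)
  fix p assume "p \<in> int_lat a b c d"
  then obtain s t where p: "p = (s * a + t * c, s * b + t * d)" by (auto simp: int_lat_def)
  have "p = ((t + s * k) * c + s * (a - k * c), (t + s * k) * d + s * (b - k * d))"
    by (simp add: p algebra_simps)
  then show "p \<in> int_lat c d (a - k * c) (b - k * d)" unfolding int_lat_def by blast
next
  fix p assume "p \<in> int_lat c d (a - k * c) (b - k * d)"
  then obtain s t where p: "p = (s * c + t * (a - k * c), s * d + t * (b - k * d))"
    by (auto simp: int_lat_def)
  have "p = (t * a + (s - t * k) * c, t * b + (s - t * k) * d)"
    by (simp add: p algebra_simps)
  then show "p \<in> int_lat a b c d" unfolding int_lat_def by blast
qed

text \<open>Euclid's algorithm on the first coordinates of the two rows: each step preserves the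
  lattice and the determinant up to sign, and it stops when one first coordinate is 0.\<close>

lemma int_lat_triangular:
  "\<exists>a' b' d'. int_lat a b c d = int_lat a' b' 0 d' \<and> \<bar>a' * d'\<bar> = \<bar>a * d - b * c\<bar>"
proof (induction "nat \<bar>c\<bar>" arbitrary: a b c d rule: less_induct)
  case less
  show ?case
  proof (cases "c = 0")
    case True
    then show ?thesis by auto
  next
    case False
    let ?k = "a div c"
    have m: "a - ?k * c = a mod c" by (simp add: minus_div_mult_eq_mod)
    have "nat \<bar>a - ?k * c\<bar> < nat \<bar>c\<bar>"
      using False abs_mod_less[of c a] by (simp add: m)
    from less[OF this, of c d "b - ?k * d"] obtain a' b' d' where
      1: "int_lat c d (a - ?k * c) (b - ?k * d) = int_lat a' b' 0 d'"
      and 2: "\<bar>a' * d'\<bar> = \<bar>c * (b - ?k * d) - d * (a - ?k * c)\<bar>" by blast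
    have "c * (b - ?k * d) - d * (a - ?k * c) = - (a * d - b * c)" by (simp add: algebra_simps)
    then show ?thesis using 1 2 int_lat_step[of a b c d ?k] by (metis abs_minus_cancel)
  qed
qed

lemma int_lat_class_eq_iff:
  "{q. p - q \<in> int_lat a b c d} = {q. p' - q \<in> int_lat a b c d} \<longleftrightarrow> p - p' \<in> int_lat a b c d"
proof -
  have 0: "0 \<in> int_lat a b c d"
    unfolding int_lat_def by (auto simp: zero_prod_def intro!: exI[of _ 0])
  have add: "x + y \<in> int_lat a b c d" if xy: "x \<in> int_lat a b c d" "y \<in> int_lat a b c d" for x y
  proof -
    obtain s t s' t' where "x = (s * a + t * c, s * b + t * d)" "y = (s' * a + t' * c, s' * b + t' * d)"
      using xy by (auto simp: int_lat_def)
    then have "x + y = ((s + s') * a + (t + t') * c, (s + s') * b + (t + t') * d)"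
      by (simp add: algebra_simps)
    then show ?thesis unfolding int_lat_def by blast
  qed
  have neg: "- x \<in> int_lat a b c d" if xy: "x \<in> int_lat a b c d" for x
  proof -
    obtain s t where "x = (s * a + t * c, s * b + t * d)"
      using xy by (auto simp: int_lat_def)
    then have "- x = ((- s) * a + (- t) * c, (- s) * b + (- t) * d)"
      by simp
    then show ?thesis unfolding int_lat_def by blast
  qed
  show ?thesis
  proof
    assume "{q. p - q \<in> int_lat a b c d} = {q. p' - q \<in> int_lat a b c d}"
    moreover have "p' \<in> {q. p' - q \<in> int_lat a b c d}" using 0 by simp
    ultimately show "p - p' \<in> int_lat a b c d" by blast
  next
    assume pp: "p - p' \<in> int_lat a b c d"
    have "p - q \<in> int_lat a b c d \<longleftrightarrow> p' - q \<in> int_lat a b c d" for q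
      using add[OF pp, of "p' - q"] add[OF neg[OF pp], of "p - q"] by auto
    then show "{q. p - q \<in> int_lat a b c d} = {q. p' - q \<in> int_lat a b c d}" by blast
  qed
qed

text \<open>For a triangular basis the box of size \<open>|a'|\<close> by \<open>|d'|\<close> is a
  system of representatives: the first row reduces the first coordinate, after which
  \<open>(0, d')\<close> reduces the second without disturbing the first.\<close>

lemma int_lat_index:
  assumes "a * d - b * c \<noteq> 0"
  shows "card (range (\<lambda>p. {q. p - q \<in> int_lat a b c d})) = nat \<bar>a * d - b * c\<bar>"
proof -
  obtain a' b' d' where L: "int_lat a b c d = int_lat a' b' 0 d'"
    and det: "\<bar>a' * d'\<bar> = \<bar>a * d - b * c\<bar>" using int_lat_triangular by blast
  have nz: "a' \<noteq> 0" "d' \<noteq> 0" using det assms by auto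
  define cls where "cls = (\<lambda>p. {q. p - q \<in> int_lat a' b' 0 d'})"
  let ?R = "{0..<\<bar>a'\<bar>} \<times> {0..<\<bar>d'\<bar>}"
  have "inj_on cls ?R"
  proof (rule inj_onI)
    fix p q assume pq: "p \<in> ?R" "q \<in> ?R" "cls p = cls q"
    then have "p - q \<in> int_lat a' b' 0 d'" by (simp add: cls_def int_lat_class_eq_iff)
    then obtain s t where st: "p - q = (s * a', s * b' + t * d')" by (auto simp: int_lat_def)
    have "\<bar>fst p - fst q\<bar> < \<bar>a'\<bar>" using pq by auto
    moreover have "fst p - fst q = s * a'" using st by (metis fst_conv fst_diff)
    ultimately have "\<bar>s\<bar> * \<bar>a'\<bar> < 1 * \<bar>a'\<bar>" by (simp add: abs_mult)
    then have "\<bar>s\<bar> < 1" by (rule mult_right_less_imp_less) simp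
    then have s: "s = 0" by simp
    have "\<bar>snd p - snd q\<bar> < \<bar>d'\<bar>" using pq by auto
    moreover have "snd p - snd q = t * d'" using st s by (metis snd_conv snd_diff mult_zero_left add_0)
    ultimately have "\<bar>t\<bar> * \<bar>d'\<bar> < 1 * \<bar>d'\<bar>" by (simp add: abs_mult)
    then have "\<bar>t\<bar> < 1" by (rule mult_right_less_imp_less) simp
    then have "t = 0" by simp
    then show "p = q" using s st by (simp add: zero_prod_def[symmetric])
  qed
  moreover have "range cls = cls ` ?R"
  proof (intro equalityI subsetI)
    fix X assume "X \<in> range cls"
    then obtain x y where X: "X = cls (x, y)" by auto
    \<comment> \<open>Division is by \<open>|a'|\<close> but the row to subtract is a multiple of
      \<open>a'\<close>; the factor \<open>sgn a'\<close> makes up for the difference.\<close>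
    define s where "s = x div \<bar>a'\<bar> * sgn a'"
    define t where "t = (y - s * b') div \<bar>d'\<bar> * sgn d'"
    have x: "x - s * a' = x mod \<bar>a'\<bar>"
      unfolding s_def by (simp add: minus_div_mult_eq_mod[symmetric] mult.assoc mult.commute[of "sgn a'"] mult_sgn_abs abs_sgn)
    have y: "y - s * b' - t * d' = (y - s * b') mod \<bar>d'\<bar>"
      unfolding t_def by (simp add: minus_div_mult_eq_mod[symmetric] mult.assoc mult.commute[of "sgn d'"] mult_sgn_abs abs_sgn)
    let ?r = "(x - s * a', y - s * b' - t * d')"
    have "(x, y) - ?r = (s * a' + t * 0, s * b' + t * d')" by simp
    then have "(x, y) - ?r \<in> int_lat a' b' 0 d'" unfolding int_lat_def by blast
    then have "X = cls ?r" unfolding X cls_def int_lat_class_eq_iff .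
    moreover have "?r \<in> ?R" unfolding x y using nz by simp
    ultimately show "X \<in> cls ` ?R" by blast
  qed auto
  ultimately have "card (range cls) = card ?R" by (simp add: card_image)
  also have "\<dots> = nat \<bar>a' * d'\<bar>" by (simp add: card_cartesian_product abs_mult nat_mult_distrib)
  finally show ?thesis by (simp add: cls_def L det)
qed

text \<open>Two maps with the same fibres have equally large images. This moves a count of classes
  from one model of a quotient to another, where only the equivalence relations have to be
  compared.\<close>

lemma card_image_cong_iff:
  assumes "\<And>x y. x \<in> X \<Longrightarrow> y \<in> X \<Longrightarrow> F x = F y \<longleftrightarrow> G x = G y"
  shows "card (F ` X) = card (G ` X)"
proof -
  let ?h = "\<lambda>s. G (inv_into X F s)"
  have h: "?h (F x) = G x" if "x \<in> X" for x
    using assms[of "inv_into X F (F x)" x] that by (simp add: f_inv_into_f inv_into_into)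
  have "inj_on ?h (F ` X)"
    by (rule inj_onI) (use h assms in auto)
  moreover have "?h ` F ` X = G ` X" using h by (force simp: image_image)
  ultimately show ?thesis by (metis card_image)
qed

text \<open>Independence of the generators is not built in. Where it matters, it is the hypothesis
  that \<open>Im (cnj u * v)\<close>, the signed area of the parallelogram on \<open>u\<close> and
  \<open>v\<close>, is nonzero.\<close>

definition lat2 :: "complex \<Rightarrow> complex \<Rightarrow> complex set" where
  "lat2 u v = {of_int m * u + of_int n * v | m n. True}"

lemma lat2I: "of_int m * u + of_int n * v \<in> lat2 u v"
  unfolding lat2_def by blast

lemma lat2E:
  assumes "x \<in> lat2 u v"
  obtains m n where "x = of_int m * u + of_int n * v"
  using assms unfolding lat2_def by blast

lemma latt_lat2: "latt z = lat2 1 z"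
  by (simp add: latt_def lat2_def)

lemma OK_lat2: "OK D = lat2 1 (omegaK D)"
  by (simp add: OK_def lat2_def)

lemma lat2_0 [simp]: "0 \<in> lat2 u v"
  using lat2I[of 0 u 0 v] by simp

lemma lat2_add: 
  assumes "x \<in> lat2 u v" "y \<in> lat2 u v" shows "x + y \<in> lat2 u v"
proof -
  obtain m n where x: "x = of_int m * u + of_int n * v" using assms(1) by (rule lat2E)
  obtain k l where y: "y = of_int k * u + of_int l * v" using assms(2) by (rule lat2E)
  show ?thesis using lat2I[of "m + k" u "n + l" v] by (simp add: x y algebra_simps)
qed

lemma lat2_of_int_mult: 
  assumes "x \<in> lat2 u v" shows "of_int k * x \<in> lat2 u v"
proof -
  obtain m n where x: "x = of_int m * u + of_int n * v" using assms by (rule lat2E)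
  show ?thesis using lat2I[of "k * m" u "k * n" v] by (simp add: x algebra_simps)
qed

lemma lat2_uminus: "x \<in> lat2 u v \<Longrightarrow> - x \<in> lat2 u v"
  using lat2_of_int_mult[of x u v "-1"] by simp

lemma lat2_diff: "x \<in> lat2 u v \<Longrightarrow> y \<in> lat2 u v \<Longrightarrow> x - y \<in> lat2 u v"
  using lat2_add[of x u v "- y"] lat2_uminus[of y] by simp

lemma lat2_basis [simp]: "u \<in> lat2 u v" "v \<in> lat2 u v"
  using lat2I[of 1 u 0 v] lat2I[of 0 u 1 v] by auto

lemma lat2_subset_iff: "lat2 u' v' \<subseteq> lat2 u v \<longleftrightarrow> u' \<in> lat2 u v \<and> v' \<in> lat2 u v"
proof
  assume "u' \<in> lat2 u v \<and> v' \<in> lat2 u v"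
  then show "lat2 u' v' \<subseteq> lat2 u v"
    by (auto elim!: lat2E[of _ u' v'] intro!: lat2_add lat2_of_int_mult)
qed (use lat2_basis in blast)

lemma lat2_range: "lat2 u v = range (\<lambda>p::int\<times>int. of_int (fst p) * u + of_int (snd p) * v)"
  unfolding lat2_def by (auto simp: image_iff) blast

lemma lat2_scale: "(\<lambda>x. t * x) ` lat2 u v = lat2 (t * u) (t * v)"
  unfolding lat2_range image_image by (simp add: algebra_simps)

lemma lat2_cnj: "cnj ` lat2 u v = lat2 (cnj u) (cnj v)"
  unfolding lat2_range image_image by simp

text \<open>Multiplying a relation by \<open>cnj u\<close> and taking imaginary parts removes the
  \<open>u\<close> term, since \<open>cnj u * u\<close> is real.\<close>

lemma lat2_coords_unique:
  assumes "Im (cnj u * v) \<noteq> 0" and "of_real a * u + of_real b * v = of_real c * u + of_real d * v"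
  shows "a = c \<and> b = d"
proof -
  have 1: "of_real (a - c) * u = of_real (d - b) * v" using assms(2) by (simp add: algebra_simps)
  have "Im (cnj u * (of_real (a - c) * u)) = 0"
    by (simp add: algebra_simps)
  then have "(d - b) * Im (cnj u * v) = 0" unfolding 1 by (simp add: algebra_simps)
  then have bd: "b = d" using assms(1) by simp
  have "u \<noteq> 0" using assms(1) by auto
  then show ?thesis using 1 bd by simp
qed

lemma lat2_coords_unique_int:
  assumes "Im (cnj u * v) \<noteq> 0" and "of_int a * u + of_int b * v = of_int c * u + of_int d * v"
  shows "a = c \<and> b = d"
  using lat2_coords_unique[of u v "of_int a" "of_int b" "of_int c" "of_int d"] assms by simp

lemma lat2_class_eq_iff:
  assumes "x \<in> lat2 u v" "y \<in> lat2 u v"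
  shows "{w \<in> lat2 u v. x - w \<in> lat2 u' v'} = {w \<in> lat2 u v. y - w \<in> lat2 u' v'} \<longleftrightarrow> x - y \<in> lat2 u' v'"
proof
  assume "{w \<in> lat2 u v. x - w \<in> lat2 u' v'} = {w \<in> lat2 u v. y - w \<in> lat2 u' v'}"
  moreover have "y \<in> {w \<in> lat2 u v. y - w \<in> lat2 u' v'}" using assms by simp
  ultimately show "x - y \<in> lat2 u' v'" by blast
next
  assume xy: "x - y \<in> lat2 u' v'"
  have "x - w \<in> lat2 u' v' \<longleftrightarrow> y - w \<in> lat2 u' v'" for w
    using lat2_add[OF xy, of "y - w"] lat2_diff[of "x - w" u' v' "x - y"] xy by auto
  then show "{w \<in> lat2 u v. x - w \<in> lat2 u' v'} = {w \<in> lat2 u v. y - w \<in> lat2 u' v'}" by blast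
qed

text \<open>The sublattice is given by an integer matrix in the basis \<open>u\<close>,
  \<open>v\<close>. Its determinant is both the index and the ratio of the signed areas.\<close>

lemma lat2_index:
  assumes ind: "Im (cnj u * v) \<noteq> 0" and ind': "Im (cnj u' * v') \<noteq> 0"
    and sub: "u' \<in> lat2 u v" "v' \<in> lat2 u v"
  shows "real (card ((\<lambda>x. {w \<in> lat2 u v. x - w \<in> lat2 u' v'}) ` lat2 u v))
       = \<bar>Im (cnj u' * v')\<bar> / \<bar>Im (cnj u * v)\<bar>"
proof -
  obtain a b where u': "u' = of_int a * u + of_int b * v" using sub(1) by (rule lat2E)
  obtain c d where v': "v' = of_int c * u + of_int d * v" using sub(2) by (rule lat2E)
  have det: "Im (cnj u' * v') = of_int (a * d - b * c) * Im (cnj u * v)"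
    unfolding u' v' by (simp add: algebra_simps)
  then have nz: "a * d - b * c \<noteq> 0" using ind' by (metis mult_zero_left of_int_0)
  define e where "e = (\<lambda>p::int\<times>int. of_int (fst p) * u + of_int (snd p) * v)"
  have L: "lat2 u v = range e" unfolding e_def lat2_range ..
  have diff: "e p - e q = e (p - q)" for p q by (simp add: e_def algebra_simps)
  have mem: "e p \<in> lat2 u' v' \<longleftrightarrow> p \<in> int_lat a b c d" for p
  proof
    assume "e p \<in> lat2 u' v'"
    then obtain s t where "e p = of_int s * u' + of_int t * v'" by (rule lat2E)
    then have "of_int (fst p) * u + of_int (snd p) * v
        = of_int (s * a + t * c) * u + of_int (s * b + t * d) * v"
      by (simp add: e_def u' v' algebra_simps)
    then have "fst p = s * a + t * c \<and> snd p = s * b + t * d"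
      by (rule lat2_coords_unique_int[OF ind])
    then show "p \<in> int_lat a b c d" unfolding int_lat_def by (auto simp: prod_eq_iff)
  next
    assume "p \<in> int_lat a b c d"
    then obtain s t where "p = (s * a + t * c, s * b + t * d)" by (auto simp: int_lat_def)
    then have "e p = of_int s * u' + of_int t * v'" by (simp add: e_def u' v' algebra_simps)
    then show "e p \<in> lat2 u' v'" by (simp add: lat2I)
  qed
  have "card ((\<lambda>x. {w \<in> lat2 u v. x - w \<in> lat2 u' v'}) ` lat2 u v)
      = card (range (\<lambda>p. {w \<in> lat2 u v. e p - w \<in> lat2 u' v'}))"
    unfolding L by (simp add: image_image)
  also have "\<dots> = card (range (\<lambda>p. {q. p - q \<in> int_lat a b c d}))"
  proof (rule card_image_cong_iff)
    fix p q
    have "e p \<in> lat2 u v" "e q \<in> lat2 u v" by (auto simp: L)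
    then show "({w \<in> lat2 u v. e p - w \<in> lat2 u' v'} = {w \<in> lat2 u v. e q - w \<in> lat2 u' v'})
        = ({r. p - r \<in> int_lat a b c d} = {r. q - r \<in> int_lat a b c d})"
      unfolding int_lat_class_eq_iff lat2_class_eq_iff by (simp only: lat2_class_eq_iff diff mem)
  qed
  also have "\<dots> = nat \<bar>a * d - b * c\<bar>" by (rule int_lat_index[OF nz])
  finally have *: "card ((\<lambda>x. {w \<in> lat2 u v. x - w \<in> lat2 u' v'}) ` lat2 u v) = nat \<bar>a * d - b * c\<bar>" .
  have "\<bar>Im (cnj u' * v')\<bar> / \<bar>Im (cnj u * v)\<bar> = \<bar>real_of_int (a * d - b * c)\<bar>"
    unfolding det abs_mult using ind by (metis abs_eq_0 nonzero_mult_div_cancel_right)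
  then show ?thesis unfolding * by simp
qed


section \<open>The ring of integers and its ideals\<close>

lemma sqrtD_square: "D < 0 \<Longrightarrow> sqrtD D * sqrtD D = of_int D"
  by (simp add: sqrtD_def complex_eq_iff)

lemma Re_sqrtD [simp]: "Re (sqrtD D) = 0" and Im_sqrtD [simp]: "Im (sqrtD D) = sqrt (of_int (- D))"
  by (simp_all add: sqrtD_def)

lemma cnj_sqrtD [simp]: "cnj (sqrtD D) = - sqrtD D"
  by (simp add: sqrtD_def)

lemma Im_omegaK: "Im (omegaK D) = sqrt (of_int (- D)) / 2"
  by (simp add: omegaK_def)

text \<open>The order of an arbitrary negative discriminant; maximality enters through
  \<open>ideal_CM\<close>.\<close>

locale quad_order =
  fixes D :: int
  assumes D_neg: "D < 0" and D_mod4: "D mod 4 = 0 \<or> D mod 4 = 1"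
begin

lemma sqrt_D_pos: "sqrt (of_int (- D)) > 0"
  using D_neg by simp

lemma omegaK_ind: "Im (cnj 1 * omegaK D) \<noteq> 0"
  using sqrt_D_pos by (simp add: Im_omegaK)

text \<open>The minimal polynomial of \<open>omegaK D\<close>. The congruence of \<open>D\<close>
  modulo 4 makes its constant term an integer.\<close>

lemma omegaK_square: "omegaK D * omegaK D = of_int D * omegaK D - of_int ((D * D - D) div 4)"
proof -
  have "4 dvd D * D - D"
  proof -
    have "4 dvd D \<or> 4 dvd D - 1" using D_mod4 by presburger
    then have "4 dvd D * (D - 1)" by auto
    then show ?thesis by (simp add: algebra_simps)
  qed
  then have "4 * ((D * D - D) div 4) = D * D - D" by simp
  then have "(of_int (4 * ((D * D - D) div 4)) :: complex) = of_int (D * D - D)" by (simp only:)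
  then have E: "of_int ((D * D - D) div 4) = (of_int D * of_int D - of_int D) / (4 :: complex)"
    by (simp add: eq_divide_eq mult.commute)
  have "4 * (omegaK D * omegaK D) = of_int D * of_int D + 2 * of_int D * sqrtD D + of_int D"
    using sqrtD_square[OF D_neg] by (simp add: omegaK_def field_simps)
  also have "\<dots> = 4 * (of_int D * omegaK D - of_int ((D * D - D) div 4))"
    unfolding E by (simp add: omegaK_def field_simps)
  finally show ?thesis by (metis mult_cancel_left zero_neq_numeral)
qed

lemma OK_I: "of_int x + of_int y * omegaK D \<in> OK D"
  by (auto simp: OK_def)

lemma OK_add: "x \<in> OK D \<Longrightarrow> y \<in> OK D \<Longrightarrow> x + y \<in> OK D"
  and OK_diff: "x \<in> OK D \<Longrightarrow> y \<in> OK D \<Longrightarrow> x - y \<in> OK D"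
  and OK_uminus: "x \<in> OK D \<Longrightarrow> - x \<in> OK D"
  and OK_0 [simp]: "0 \<in> OK D" and OK_1 [simp]: "1 \<in> OK D"
  and OK_of_int [simp]: "of_int k \<in> OK D"
  using OK_I[of k 0] by (simp_all add: OK_lat2 lat2_add lat2_diff lat2_uminus)

lemma OK_omegaK [simp]: "omegaK D \<in> OK D"
  by (simp add: OK_lat2)

lemma OK_of_nat [simp]: "of_nat k \<in> OK D"
  using OK_of_int[of "int k"] by simp

lemma OK_mult: 
  assumes "x \<in> OK D" "y \<in> OK D" shows "x * y \<in> OK D"
proof -
  obtain m n where x: "x = of_int m + of_int n * omegaK D" using assms(1) by (auto simp: OK_def)
  obtain k l where y: "y = of_int k + of_int l * omegaK D" using assms(2) by (auto simp: OK_def)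
  have "x * y = of_int m * of_int k + (of_int m * of_int l + of_int n * of_int k) * omegaK D
      + of_int n * of_int l * (omegaK D * omegaK D)"
    by (simp add: x y algebra_simps)
  also have "\<dots> = of_int (m * k - n * l * ((D * D - D) div 4)) + of_int (m * l + n * k + n * l * D) * omegaK D"
    unfolding omegaK_square by (simp add: algebra_simps)
  finally show ?thesis by (simp add: OK_I del: of_int_add of_int_diff of_int_mult)
qed

lemma OK_sum: "(\<And>k. k < n \<Longrightarrow> x k \<in> OK D) \<Longrightarrow> (\<Sum>k<n. x k) \<in> OK D" for n :: nat
  by (induction n) (auto intro: OK_add)

lemma cnj_omegaK: "cnj (omegaK D) = of_int D - omegaK D"
  by (simp add: omegaK_def field_simps)

lemma OK_cnj: 
  assumes "x \<in> OK D" shows "cnj x \<in> OK D"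
proof -
  obtain m n where x: "x = of_int m + of_int n * omegaK D" using assms by (auto simp: OK_def)
  have "cnj x = of_int (m + n * D) + of_int (- n) * omegaK D"
    by (simp add: x cnj_omegaK algebra_simps)
  then show ?thesis using OK_I by metis
qed

lemma sqrtD_OK: "sqrtD D \<in> OK D"
proof -
  have "sqrtD D = of_int (- D) + of_int 2 * omegaK D" by (simp add: omegaK_def field_simps)
  then show ?thesis using OK_I by metis
qed

lemma OK_real_int:
  assumes "x \<in> OK D" "Im x = 0" shows "\<exists>k. x = of_int k"
proof -
  obtain m n where x: "x = of_int m + of_int n * omegaK D" using assms(1) by (auto simp: OK_def)
  then have "n = 0" using assms(2) sqrt_D_pos by (simp add: Im_omegaK)
  then show ?thesis using x by auto
qed

lemma OK_norm_int:
  assumes "x \<in> OK D" shows "\<exists>k::int. (cmod x)\<^sup>2 = of_int k"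
proof -
  have "x * cnj x \<in> OK D" using assms OK_cnj OK_mult by blast
  then obtain k where "x * cnj x = of_int k" using OK_real_int[of "x * cnj x"] by auto
  then have "of_real ((cmod x)\<^sup>2) = (of_real (of_int k) :: complex)"
    by (simp only: complex_norm_square of_real_of_int_eq)
  then show ?thesis by (metis of_real_eq_iff)
qed

text \<open>The squared moduli of a unit and of its inverse are nonnegative integers with product
  1.\<close>

lemma unit_cmod:
  assumes "u \<in> units_OK D" shows "cmod u = 1"
proof -
  obtain v where v: "u \<in> OK D" "v \<in> OK D" "u * v = 1" using assms by (auto simp: units_OK_def)
  obtain k l :: int where kl: "(cmod u)\<^sup>2 = of_int k" "(cmod v)\<^sup>2 = of_int l"
    using OK_norm_int v by blast
  have "(cmod u)\<^sup>2 * (cmod v)\<^sup>2 = 1"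
    using v(3) by (metis norm_mult norm_one power_mult_distrib power_one)
  then have "k * l = 1" unfolding kl by (metis of_int_1 of_int_eq_iff of_int_mult)
  moreover have "0 \<le> k" using kl(1) by (metis of_int_0_le_iff zero_le_power2)
  ultimately have "k = 1" by (metis zmult_eq_1_iff abs_1 abs_of_nonneg abs_minus_cancel)
  then show ?thesis using kl by (metis norm_ge_zero of_int_1 one_power2 power2_eq_iff_nonneg zero_le_one)
qed

text \<open>Units lie on the unit circle: the imaginary part bounds the coefficient of
  \<open>omegaK D\<close>, and then the other coefficient is bounded too.\<close>

lemma finite_units: "finite (units_OK D)"
proof -
  let ?F = "(\<lambda>(a, b). of_int a + of_int b * omegaK D) ` ({k. \<bar>k\<bar> \<le> \<lceil>1 + 2 / sqrt (of_int (- D)) * cmod (omegaK D)\<rceil>} \<times> {k. \<bar>k\<bar> \<le> \<lceil>2 / sqrt (of_int (- D))\<rceil>})"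
  have "units_OK D \<subseteq> ?F"
  proof
    fix u assume u: "u \<in> units_OK D"
    then have "cmod u = 1" by (rule unit_cmod)
    obtain m n where x: "u = of_int m + of_int n * omegaK D" using u by (auto simp: units_OK_def OK_def)
    have "\<bar>Im u\<bar> \<le> 1" using \<open>cmod u = 1\<close> abs_Im_le_cmod[of u] by simp
    then have "\<bar>of_int n\<bar> * (sqrt (of_int (- D)) / 2) \<le> 1"
      using sqrt_D_pos by (simp add: x Im_omegaK abs_mult)
    then have n: "\<bar>of_int n\<bar> \<le> 2 / sqrt (of_int (- D))"
      using sqrt_D_pos by (simp add: field_simps)
    have "cmod (of_int m) = cmod (u - of_int n * omegaK D)" by (simp add: x)
    also have "\<dots> \<le> 1 + \<bar>of_int n\<bar> * cmod (omegaK D)"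
      using norm_triangle_ineq4[of u "of_int n * omegaK D"] \<open>cmod u = 1\<close> by (simp add: norm_mult)
    also have "\<dots> \<le> 1 + 2 / sqrt (of_int (- D)) * cmod (omegaK D)"
      using n by (intro add_left_mono mult_right_mono) auto
    finally have m: "\<bar>of_int m\<bar> \<le> 1 + 2 / sqrt (of_int (- D)) * cmod (omegaK D)" by simp
    have "\<bar>m\<bar> \<le> \<lceil>1 + 2 / sqrt (of_int (- D)) * cmod (omegaK D)\<rceil>" "\<bar>n\<bar> \<le> \<lceil>2 / sqrt (of_int (- D))\<rceil>"
      using m n by linarith+
    then show "u \<in> ?F" using x by auto
  qed
  moreover have "finite {k::int. \<bar>k\<bar> \<le> b}" for b
    by (rule finite_subset[of _ "{-b..b}"]) auto
  ultimately show ?thesis by (meson finite_SigmaI finite_imageI finite_subset)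
qed

lemma one_unit: "1 \<in> units_OK D"
  by (auto simp: units_OK_def intro: bexI[of _ 1])

lemma card_units_pos: "card (units_OK D) > 0"
  using finite_units one_unit card_gt_0_iff by blast

end


section \<open>Products of ideals and coprimality\<close>

lemma idl_mult_0 [simp]: "0 \<in> idl_mult I J"
  unfolding idl_mult_def by (auto intro!: exI[of _ "0::nat"])

text \<open>The two finite sums are concatenated, the second one shifted by
  \<open>n\<close>.\<close>

lemma idl_mult_add:
  assumes "x \<in> idl_mult I J" "y \<in> idl_mult I J"
  shows "x + y \<in> idl_mult I J"
proof -
  obtain n :: nat and p q where x: "x = (\<Sum>k<n. p k * q k)" "\<forall>k<n. p k \<in> I \<and> q k \<in> J"
    using assms(1) unfolding idl_mult_def by blast
  obtain m :: nat and r s where y: "y = (\<Sum>k<m. r k * s k)" "\<forall>k<m. r k \<in> I \<and> s k \<in> J"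
    using assms(2) unfolding idl_mult_def by blast
  let ?p = "\<lambda>k. if k < n then p k else r (k - n)" and ?q = "\<lambda>k. if k < n then q k else s (k - n)"
  have "(\<Sum>k<n + m. ?p k * ?q k) = (\<Sum>k<n. ?p k * ?q k) + (\<Sum>k<m. ?p (n + k) * ?q (n + k))"
    by (simp add: lessThan_atLeast0 sum.atLeastLessThan_concat[of 0 n "n + m", symmetric]
        sum.atLeastLessThan_shift_0[of _ n])
  then have "x + y = (\<Sum>k<n + m. ?p k * ?q k)" by (simp add: x y)
  moreover have "\<forall>k<n + m. ?p k \<in> I \<and> ?q k \<in> J" using x y by auto
  ultimately show ?thesis unfolding idl_mult_def
    by (intro CollectI exI[of _ "n + m"] exI[of _ ?p] exI[of _ ?q] conjI)
qed

lemma idl_mult_prod: "x \<in> I \<Longrightarrow> y \<in> J \<Longrightarrow> x * y \<in> idl_mult I J"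
  unfolding idl_mult_def
  by (rule CollectI, rule exI[of _ "1::nat"], rule exI[of _ "\<lambda>_. x"], rule exI[of _ "\<lambda>_. y"]) simp

text \<open>Minimality of the product among additively closed sets containing 0. With a suitable
  \<open>S\<close> it replaces induction over finite sums in the inclusions proved for
  products.\<close>

lemma idl_mult_least:
  assumes "0 \<in> S" "\<And>x y. x \<in> S \<Longrightarrow> y \<in> S \<Longrightarrow> x + y \<in> S"
    "\<And>x y. x \<in> I \<Longrightarrow> y \<in> J \<Longrightarrow> x * y \<in> S"
  shows "idl_mult I J \<subseteq> S"
proof
  fix w assume "w \<in> idl_mult I J"
  then obtain n :: nat and p q where x: "w = (\<Sum>k<n. p k * q k)" "\<forall>k<n. p k \<in> I \<and> q k \<in> J"
    unfolding idl_mult_def by blast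
  have "(\<Sum>k<m. p k * q k) \<in> S" if "m \<le> n" for m
    using that by (induction m) (use assms x in auto)
  then show "w \<in> S" using x by blast
qed

lemma idl_mult_commute: "idl_mult I J = idl_mult J I"
proof -
  have "idl_mult I J \<subseteq> idl_mult J I" for I J
    by (rule idl_mult_least) (auto intro: idl_mult_add, metis idl_mult_prod mult.commute)
  then show ?thesis by blast
qed

lemma idl_mult_assoc: "idl_mult (idl_mult I J) L = idl_mult I (idl_mult J L)"
proof -
  have *: "idl_mult (idl_mult I J) L \<subseteq> idl_mult I (idl_mult J L)" for I J L
  proof (rule idl_mult_least)
    fix x y assume "x \<in> idl_mult I J" and y: "y \<in> L"
    moreover have "idl_mult I J \<subseteq> {x. x * y \<in> idl_mult I (idl_mult J L)}"
      by (rule idl_mult_least)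
        (auto simp: algebra_simps intro: idl_mult_add idl_mult_prod y)
    ultimately show "x * y \<in> idl_mult I (idl_mult J L)" by blast
  qed (auto intro: idl_mult_add)
  have "idl_mult I (idl_mult J L) \<subseteq> idl_mult (idl_mult I J) L"
    using *[of L J I] by (simp only: idl_mult_commute[of L] idl_mult_commute[of J I] idl_mult_commute[of _ I])
  then show ?thesis using *[of I J L] by blast
qed

lemma cnj_idl_mult: "cnj ` idl_mult I J = idl_mult (cnj ` I) (cnj ` J)"
proof -
  have *: "cnj ` idl_mult I J \<subseteq> idl_mult (cnj ` I) (cnj ` J)" for I J
  proof -
    have "idl_mult I J \<subseteq> {x. cnj x \<in> idl_mult (cnj ` I) (cnj ` J)}"
      by (rule idl_mult_least) (auto intro: idl_mult_add idl_mult_prod)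
    then show ?thesis by auto
  qed
  have "cnj ` idl_mult (cnj ` I) (cnj ` J) \<subseteq> idl_mult I J"
    using *[of "cnj ` I" "cnj ` J"] by (simp add: image_image)
  then have "cnj ` cnj ` idl_mult (cnj ` I) (cnj ` J) \<subseteq> cnj ` idl_mult I J" by (rule image_mono)
  then have "idl_mult (cnj ` I) (cnj ` J) \<subseteq> cnj ` idl_mult I J" by (simp add: image_image)
  then show ?thesis using * by (intro equalityI)
qed

context quad_order begin

lemma is_ideal_add: "is_ideal D I \<Longrightarrow> x \<in> I \<Longrightarrow> y \<in> I \<Longrightarrow> x + y \<in> I"
  and is_ideal_mult: "is_ideal D I \<Longrightarrow> r \<in> OK D \<Longrightarrow> x \<in> I \<Longrightarrow> r * x \<in> I"
  and is_ideal_0: "is_ideal D I \<Longrightarrow> 0 \<in> I"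
  and is_ideal_OK: "is_ideal D I \<Longrightarrow> x \<in> I \<Longrightarrow> x \<in> OK D"
  by (auto simp: is_ideal_def)

lemma is_ideal_idl_mult:
  assumes "is_ideal D I" "is_ideal D J" shows "is_ideal D (idl_mult I J)"
proof -
  have "idl_mult I J \<subseteq> OK D"
    by (rule idl_mult_least) (use assms in \<open>auto simp: is_ideal_def intro: OK_add OK_mult\<close>)
  moreover have "idl_mult I J \<subseteq> {x. \<forall>r\<in>OK D. r * x \<in> idl_mult I J}"
  proof (rule idl_mult_least)
    fix x y assume xy: "x \<in> I" "y \<in> J"
    show "x * y \<in> {x. \<forall>r\<in>OK D. r * x \<in> idl_mult I J}"
      using xy assms(1) idl_mult_prod[of "_ * x" I y J] by (auto simp: is_ideal_def mult.assoc)
  qed (auto simp: distrib_left intro: idl_mult_add)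
  ultimately show ?thesis by (auto simp: is_ideal_def intro: idl_mult_add)
qed

lemma int_ideal_idl_mult:
  assumes "int_ideal D I" "int_ideal D J" shows "int_ideal D (idl_mult I J)"
proof -
  obtain x y where "x \<in> I" "x \<noteq> 0" "y \<in> J" "y \<noteq> 0"
    using assms by (auto simp: int_ideal_def is_ideal_def)
  then have "x * y \<in> idl_mult I J" "x * y \<noteq> 0" by (auto intro: idl_mult_prod)
  then show ?thesis using assms is_ideal_idl_mult by (auto simp: int_ideal_def)
qed

lemma idl_mult_subset:
  assumes "is_ideal D I" "is_ideal D J" shows "idl_mult I J \<subseteq> I"
proof (rule idl_mult_least)
  fix x y assume "x \<in> I" "y \<in> J"
  then have "y * x \<in> I" using assms by (intro is_ideal_mult) (auto intro: is_ideal_OK)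
  then show "x * y \<in> I" by (simp add: mult.commute)
qed (use assms in \<open>auto intro: is_ideal_0 is_ideal_add\<close>)

lemma coprime_idl_mult:
  assumes "is_ideal D I" "is_ideal D m" "J \<subseteq> OK D" "coprime_ideals I m" "coprime_ideals J m"
  shows "coprime_ideals (idl_mult I J) m"
proof -
  obtain x c where 1: "x \<in> I" "c \<in> m" "x + c = 1" using assms by (auto simp: coprime_ideals_def)
  obtain y d where 2: "y \<in> J" "d \<in> m" "y + d = 1" using assms by (auto simp: coprime_ideals_def)
  have "1 = x * y + (d * x + c)"
    using 1(3) 2(3) by (metis (no_types, lifting) add.assoc distrib_left mult.commute mult.right_neutral)
  moreover have "d * x + c \<in> m"
    using is_ideal_add[OF assms(2) is_ideal_mult[OF assms(2) is_ideal_OK[OF assms(1) 1(1)] 2(2)] 1(2)]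
    by (simp add: mult.commute)
  ultimately show ?thesis unfolding coprime_ideals_def using idl_mult_prod[OF 1(1) 2(1)] by metis
qed

lemma is_ideal_uminus: "is_ideal D I \<Longrightarrow> x \<in> I \<Longrightarrow> - x \<in> I"
  using OK_of_int[of "-1"] by (metis is_ideal_def mult_minus1 of_int_1 of_int_minus)

lemma is_ideal_diff: "is_ideal D I \<Longrightarrow> x \<in> I \<Longrightarrow> y \<in> I \<Longrightarrow> x - y \<in> I"
  using is_ideal_uminus[of I y] by (metis is_ideal_def add_uminus_conv_diff)

lemma princ_ideal:
  assumes "a \<in> OK D" shows "is_ideal D (princ D a)"
proof -
  have mem: "x \<in> princ D a \<longleftrightarrow> (\<exists>r\<in>OK D. x = a * r)" for x by (auto simp: princ_def)
  have "x + y \<in> princ D a" if "x \<in> princ D a" "y \<in> princ D a" for x y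
    using that OK_add unfolding mem by (metis distrib_left)
  moreover have "r * x \<in> princ D a" if "r \<in> OK D" "x \<in> princ D a" for r x
    using that OK_mult unfolding mem by (metis mult.left_commute)
  moreover have "0 \<in> princ D a" unfolding mem by (intro bexI[of _ 0]) auto
  moreover have "princ D a \<subseteq> OK D" using assms OK_mult by (auto simp: mem)
  ultimately show ?thesis by (auto simp: is_ideal_def)
qed

lemma coprime_elt_iff: "coprime_elt D a m \<longleftrightarrow> (\<exists>r\<in>OK D. \<exists>c\<in>m. a * r + c = 1)"
  by (auto simp: coprime_elt_def coprime_ideals_def princ_def)

lemma coprime_elt_cong:
  assumes "is_ideal D m" "a \<in> OK D" "b \<in> OK D" "a - b \<in> m"
  shows "coprime_elt D a m \<longleftrightarrow> coprime_elt D b m"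
proof -
  have *: "coprime_elt D b m" if cop: "coprime_elt D a m" and ab: "a - b \<in> m" for a b
  proof -
    obtain r c where 1: "r \<in> OK D" "c \<in> m" "a * r + c = 1"
      using cop unfolding coprime_elt_iff by blast
    have "b * r + (r * (a - b) + c) = 1" using 1 by (simp add: algebra_simps)
    moreover have "r * (a - b) + c \<in> m" 
      using 1 assms(1) ab by (intro is_ideal_add is_ideal_mult)
    ultimately show ?thesis
      unfolding coprime_elt_iff using 1 by blast
  qed
  have "b - a \<in> m" using is_ideal_uminus[OF assms(1,4)] by simp
  then show ?thesis using * assms(4) by blast
qed

lemma coprime_elt_mult_iff:
  assumes "is_ideal D m" "a \<in> OK D" "b \<in> OK D"
  shows "coprime_elt D (a * b) m \<longleftrightarrow> coprime_elt D a m \<and> coprime_elt D b m"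
proof
  assume "coprime_elt D (a * b) m"
  then obtain r c where 1: "r \<in> OK D" "c \<in> m" "a * b * r + c = 1"
    unfolding coprime_elt_iff by blast
  then have "a * (b * r) + c = 1" "b * (a * r) + c = 1" by (simp_all add: algebra_simps)
  then show "coprime_elt D a m \<and> coprime_elt D b m"
    unfolding coprime_elt_iff using 1 assms OK_mult by blast
next
  assume "coprime_elt D a m \<and> coprime_elt D b m"
  then obtain r c s d where 1: "r \<in> OK D" "c \<in> m" "a * r + c = 1" "s \<in> OK D" "d \<in> m" "b * s + d = 1"
    unfolding coprime_elt_iff by blast
  have "(a * r + c) * (b * s + d) = 1" using 1 by simp
  then have "(a * b) * (r * s) + ((a * r) * d + (b * s + d) * c) = 1" by (simp add: algebra_simps)
  moreover have "(a * r) * d + (b * s + d) * c \<in> m"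
    using assms 1 by (intro is_ideal_add is_ideal_mult OK_mult OK_add) (auto intro: is_ideal_OK)
  ultimately show "coprime_elt D (a * b) m"
    unfolding coprime_elt_iff using 1 OK_mult by blast
qed

lemma coprime_elt_1: "is_ideal D m \<Longrightarrow> coprime_elt D 1 m"
  unfolding coprime_elt_iff by (intro bexI[of _ 1] bexI[of _ 0]) (auto intro: is_ideal_0)

end

text \<open>The sign of \<open>B\<close> is that of the norm form \<open>A * |m + n z|^2\<close>,
  because \<open>z + cnj z = - B / A\<close>. A value prime to the conductor later supplies an ideal
  of each class prime to it.\<close>

lemma primitive_form_coprime_value:
  fixes A B C M :: int
  assumes "gcd (gcd A B) C = 1" "M \<noteq> 0"
  shows "\<exists>m n. coprime (A * m * m - B * m * n + C * n * n) M"
proof -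
  let ?S = "prime_factors M"
  let ?S1 = "{p \<in> ?S. \<not> p dvd A}" and ?S2 = "{p \<in> ?S. p dvd A \<and> \<not> p dvd C}"
  \<comment> \<open>Modulo each prime dividing \<open>M\<close> exactly one of the three terms of the form survives.\<close>
  define m where "m = \<Prod>?S2"
  define n where "n = \<Prod>?S1"
  have fin: "finite ?S1" "finite ?S2" by auto
  have pm: "p dvd m \<longleftrightarrow> p \<in> ?S2" and pn: "p dvd n \<longleftrightarrow> p \<in> ?S1" if p: "prime p" for p
  proof -
    have "p dvd q \<longleftrightarrow> p = q" if "q \<in> ?S" for q
      using p that by (auto dest: primes_dvd_imp_eq)
    then show "p dvd m \<longleftrightarrow> p \<in> ?S2" "p dvd n \<longleftrightarrow> p \<in> ?S1"
      unfolding m_def n_def prime_dvd_prod_iff[OF fin(1) p] prime_dvd_prod_iff[OF fin(2) p] by auto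
  qed
  have "\<not> p dvd A * m * m - B * m * n + C * n * n" if p: "prime p" "p dvd M" for p
  proof
    assume d: "p dvd A * m * m - B * m * n + C * n * n"
    have S: "p \<in> ?S" using p assms by (simp add: prime_factors_dvd)
    consider "\<not> p dvd A" | "p dvd A" "\<not> p dvd C" | "p dvd A" "p dvd C" by blast
    then show False
    proof cases
      case 1
      then have "p dvd n" "\<not> p dvd m" using S pm pn p by auto
      then have "p dvd A * m * m - B * m * n + C * n * n - (- B * m * n + C * n * n)"
        using d by (intro dvd_diff) (auto intro: dvd_mult)
      then have "p dvd A * m * m" by simp
      then show False using 1 \<open>\<not> p dvd m\<close> p by (auto simp: prime_dvd_mult_iff)
    next
      case 2
      then have "p dvd m" "\<not> p dvd n" using S pm pn p by auto
      then have "p dvd A * m * m - B * m * n + C * n * n - (A * m * m - B * m * n)"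
        using d by (intro dvd_diff) auto
      then have "p dvd C * n * n" by simp
      then show False using 2 \<open>\<not> p dvd n\<close> p by (auto simp: prime_dvd_mult_iff)
    next
      case 3
      then have nd: "\<not> p dvd m" "\<not> p dvd n" using S pm pn p by auto
      have "\<not> p dvd B"
      proof
        assume "p dvd B"
        then have "p dvd gcd (gcd A B) C" using 3 by simp
        then show False using assms p not_prime_unit by metis
      qed
      have "p dvd A * m * m + C * n * n - (A * m * m - B * m * n + C * n * n)"
        using d 3 by (intro dvd_diff) auto
      then have "p dvd B * m * n" by simp
      then show False using \<open>\<not> p dvd B\<close> nd p by (auto simp: prime_dvd_mult_iff)
    qed
  qed
  then have "coprime (A * m * m - B * m * n + C * n * n) M"
    by (intro coprimeI) (metis assms(2) dvd_0_left dvd_trans prime_divisor_exists)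
  then show ?thesis by blast
qed


section \<open>Lattices with complex multiplication\<close>

lemma gcd3_bezout:
  fixes A B C :: int
  assumes "gcd (gcd A B) C = 1"
  shows "\<exists>r s t. r * A + s * B + t * C = 1"
proof -
  obtain u v where 1: "u * gcd A B + v * C = 1" using bezout_int[of "gcd A B" C] assms by auto
  obtain r s where 2: "r * A + s * B = gcd A B" using bezout_int[of A B] by auto
  have "(u * r) * A + (u * s) * B + v * C = u * (r * A + s * B) + v * C" by (simp add: algebra_simps)
  then show ?thesis using 1 2 by metis
qed

lemma square_mod4: "(b::int) * b mod 4 = 0 \<or> b * b mod 4 = 1"
proof (cases "even b")
  case True
  then obtain k where "b = 2 * k" by blast
  then show ?thesis by simp
next
  case False
  then obtain k where "b = 2 * k + 1" by (blast elim: oddE)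
  then have "b * b = 4 * (k * k + k) + 1" by (simp add: algebra_simps)
  then show ?thesis by presburger
qed

lemma disc_mod4: "((b::int) * b - 4 * a * c) mod 4 = 0 \<or> (b * b - 4 * a * c) mod 4 = 1"
proof -
  have "(b * b - 4 * a * c) mod 4 = (b * b - 4 * (a * c)) mod 4" by (simp add: algebra_simps)
  then show ?thesis using square_mod4[of b] by presburger
qed

text \<open>For a proper lattice \<open>b = latt z\<close> one has \<open>b\<^sup>-\<^sup>1 = A \<cdot> cnj b\<close>, so this is the ideal \<open>x b\<^sup>-\<^sup>1\<close>.\<close>
definition inv_ideal :: "int \<Rightarrow> complex \<Rightarrow> complex \<Rightarrow> complex set" where
  "inv_ideal A z x = (\<lambda>s. x * of_int A * cnj s) ` latt z"

text \<open>Complex multiplication is recorded by the discriminant of the form being exactly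
  \<open>D\<close>, which turns all later facts into algebra with \<open>z\<close>. The condition on
  the multiplier ring is converted to this in \<open>cm_form_of_CM\<close>.\<close>

locale cm_form =
  fixes D A B C :: int and z :: complex
  assumes D_neg': "D < 0" and A_pos: "A > 0" and primitive: "gcd (gcd A B) C = 1"
    and z_root: "of_int A * z\<^sup>2 + of_int B * z + of_int C = 0"
    and Im_z: "Im z > 0" and disc: "B * B - 4 * A * C = D"
begin

sublocale quad_order D
  by unfold_locales (use D_neg' disc_mod4[of B A C] disc in auto)

text \<open>Completing the square gives both signs of the root; \<open>Im z > 0\<close> selects this
  one.\<close>

lemma two_A_z: "2 * of_int A * z = - of_int B + sqrtD D"
proof -
  have "(2 * of_int A * z + of_int B)\<^sup>2
      = 4 * of_int A * (of_int A * z\<^sup>2 + of_int B * z + of_int C) + of_int (B * B - 4 * A * C)"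
    by (simp add: power2_eq_square algebra_simps)
  also have "\<dots> = (sqrtD D)\<^sup>2" unfolding z_root disc by (simp add: power2_eq_square sqrtD_square D_neg)
  finally have "2 * of_int A * z + of_int B = sqrtD D \<or> 2 * of_int A * z + of_int B = - sqrtD D"
    by (simp add: power2_eq_iff)
  moreover have "2 * of_int A * z + of_int B \<noteq> - sqrtD D"
  proof
    assume "2 * of_int A * z + of_int B = - sqrtD D"
    then have "Im (2 * of_int A * z + of_int B) = Im (- sqrtD D)" by simp
    then have "2 * of_int A * Im z = - sqrt (of_int (- D))" by simp
    moreover have "2 * of_int A * Im z > 0" using A_pos Im_z by simp
    ultimately show False using sqrt_D_pos by linarith
  qed
  ultimately show ?thesis by (simp add: algebra_simps)
qed

text \<open>\<open>B\<close> and \<open>D = B^2 - 4AC\<close> have the same parity. Hence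
  \<open>A z\<close> and \<open>omegaK D\<close> differ by an integer and generate the same
  order.\<close>

lemma A_z: "of_int A * z = omegaK D - of_int ((B + D) div 2)"
proof -
  have "B * B - D = 2 * (2 * A * C)" using disc by simp
  then have "even (B * B - D)" by (metis dvd_triv_left)
  then have "even (B + D)" by simp
  then have "2 * ((B + D) div 2) = B + D" by simp
  then have "(of_int (2 * ((B + D) div 2)) :: complex) = of_int (B + D)" by (simp only:)
  then have E: "of_int ((B + D) div 2) = (of_int B + of_int D) / (2 :: complex)"
    by (simp add: eq_divide_eq mult.commute)
  have s: "sqrtD D = 2 * of_int A * z + of_int B" using two_A_z by simp
  have "2 * (of_int A * z) = 2 * (omegaK D - of_int ((B + D) div 2))"
    unfolding E omegaK_def s by (simp add: field_simps)
  then show ?thesis by (metis mult_cancel_left zero_neq_numeral)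
qed

lemma A_cnj_z: "of_int A * cnj z = - of_int B - of_int A * z"
proof -
  have s: "sqrtD D = 2 * of_int A * z + of_int B" using two_A_z by simp
  have "cnj (2 * of_int A * z) = - of_int B - sqrtD D" unfolding two_A_z by simp
  then have "2 * (of_int A * cnj z) = 2 * (- of_int B - of_int A * z)" by (simp add: algebra_simps s)
  then show ?thesis by (metis mult_cancel_left zero_neq_numeral)
qed

lemma A_z_z: "of_int A * z * z = - of_int B * z - of_int C"
proof -
  have "of_int A * z * z - (- of_int B * z - of_int C) = 0"
    using z_root by (simp add: power2_eq_square algebra_simps)
  then show ?thesis by (simp only: right_minus_eq)
qed

lemma A_cnj_z_z: "of_int A * cnj z * z = of_int C"
  unfolding A_cnj_z using A_z_z by (simp add: algebra_simps)

lemma Im_z_eq: "Im z = sqrt (of_int (- D)) / (2 * of_int A)"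
proof -
  have "Im (2 * of_int A * z) = Im (- of_int B + sqrtD D)" unfolding two_A_z ..
  then show ?thesis using A_pos by (simp add: field_simps)
qed

lemma A_z_OK: "of_int A * z \<in> OK D"
  unfolding A_z by (intro OK_diff) auto

lemma latt_I: "of_int m + of_int n * z \<in> latt z"
  by (auto simp: latt_def)

lemma latt_add: "x \<in> latt z \<Longrightarrow> y \<in> latt z \<Longrightarrow> x + y \<in> latt z"
  and latt_uminus: "x \<in> latt z \<Longrightarrow> - x \<in> latt z"
  and latt_of_int_mult: "x \<in> latt z \<Longrightarrow> of_int k * x \<in> latt z"
  and latt_0 [simp]: "0 \<in> latt z" and latt_1 [simp]: "1 \<in> latt z" and latt_z [simp]: "z \<in> latt z"
  by (simp_all add: latt_lat2 lat2_add lat2_diff lat2_uminus lat2_of_int_mult)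

lemma latt_ind: "Im (cnj 1 * z) \<noteq> 0"
  using Im_z by simp

lemma latt_OK_mult:
  assumes "r \<in> OK D" "x \<in> latt z" shows "r * x \<in> latt z"
proof -
  obtain a b where r: "r = of_int a + of_int b * omegaK D" using assms(1) by (auto simp: OK_def)
  obtain m n where x: "x = of_int m + of_int n * z" using assms(2) by (auto simp: latt_def)
  define p where "p = (B + D) div 2"
  have w: "omegaK D = of_int A * z + of_int p" using A_z by (simp add: p_def)
  have "omegaK D * x = of_int m * of_int A * z + of_int n * (of_int A * z * z) + of_int p * x"
    unfolding w x by (simp add: algebra_simps)
  also have "\<dots> = of_int (- n * C) + of_int (m * A - n * B) * z + of_int p * x"
    unfolding A_z_z by (simp add: algebra_simps)
  finally have "omegaK D * x \<in> latt z"
    using assms(2) by (metis latt_add latt_of_int_mult latt_I)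
  then have "of_int a * x + of_int b * (omegaK D * x) \<in> latt z"
    using assms(2) by (intro latt_add latt_of_int_mult)
  then show ?thesis by (simp add: r algebra_simps)
qed

text \<open>The inclusion of \<open>A * cnj b * b\<close> in the ring: on basis vectors the pairing
  takes the values \<open>A\<close>, \<open>A z\<close>, \<open>A * cnj z\<close> and
  \<open>C\<close>.\<close>

lemma pair_OK:
  assumes "s \<in> latt z" "t \<in> latt z" shows "of_int A * cnj s * t \<in> OK D"
proof -
  obtain m n where s: "s = of_int m + of_int n * z" using assms(1) by (auto simp: latt_def)
  obtain k l where t: "t = of_int k + of_int l * z" using assms(2) by (auto simp: latt_def)
  have "of_int A * cnj s * t = of_int (m * k * A) + of_int (m * l) * (of_int A * z)
     + of_int (n * k) * (of_int A * cnj z) + of_int (n * l) * (of_int A * cnj z * z)"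
    by (simp add: s t algebra_simps)
  also have "\<dots> \<in> OK D" unfolding A_cnj_z_z unfolding A_cnj_z
    by (intro OK_add OK_diff OK_mult[OF OK_of_int] OK_uminus A_z_OK OK_of_int)
  finally show ?thesis .
qed

text \<open>The other half of invertibility. The pairings contain \<open>A\<close>, \<open>C\<close>
  and \<open>A z + A * cnj z = - B\<close>, and these are combined to 1 by Bezout; four summands
  arise because \<open>B\<close> takes two.\<close>

lemma one_decomp:
  obtains s t :: "nat \<Rightarrow> complex" where "\<And>k. k < 4 \<Longrightarrow> s k \<in> latt z \<and> t k \<in> latt z"
    "(\<Sum>k<4. of_int A * cnj (s k) * t k) = 1"
proof -
  obtain r b c where rbc: "r * A + b * B + c * C = 1" using gcd3_bezout[OF primitive] by blast
  let ?s = "\<lambda>k::nat. if k = 0 then of_int r else if k = 1 then of_int (- b) else if k = 2 then of_int (- b) * z else of_int c * z"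
  let ?t = "\<lambda>k::nat. if k = 0 then 1 else if k = 1 then z else if k = 2 then 1 else z"
  have "(\<Sum>k<4. of_int A * cnj (?s k) * ?t k)
     = of_int r * of_int A - of_int b * (of_int A * z) - of_int b * (of_int A * cnj z) + of_int c * (of_int A * cnj z * z)"
    by (simp add: eval_nat_numeral algebra_simps)
  also have "\<dots> = of_int (r * A + b * B + c * C)"
    unfolding A_cnj_z_z unfolding A_cnj_z by (simp add: algebra_simps)
  finally have sum: "(\<Sum>k<4. of_int A * cnj (?s k) * ?t k) = 1" unfolding rbc by simp
  have "of_int k \<in> latt z" for k using latt_I[of k 0] by simp
  then have "?s k \<in> latt z \<and> ?t k \<in> latt z" if "k < 4" for k
    by (simp add: latt_of_int_mult latt_uminus)
  then show ?thesis using sum that[of ?s ?t] by blast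
qed

lemma inv_ideal_lat2: "inv_ideal A z x = lat2 (x * of_int A) (x * of_int A * cnj z)"
proof -
  have "inv_ideal A z x = (\<lambda>s. x * of_int A * s) ` cnj ` latt z" by (simp add: inv_ideal_def image_image)
  then show ?thesis by (simp add: latt_lat2 lat2_cnj lat2_scale)
qed

lemma inv_ideal_int_ideal:
  assumes "x \<in> latt z" "x \<noteq> 0" shows "int_ideal D (inv_ideal A z x)"
proof -
  have "is_ideal D (inv_ideal A z x)"
    unfolding is_ideal_def
  proof (intro conjI ballI)
    show "inv_ideal A z x \<subseteq> OK D"
      using pair_OK assms(1) by (auto simp: inv_ideal_def mult.commute mult.left_commute)
    show "0 \<in> inv_ideal A z x" by (simp add: inv_ideal_lat2)
  next
    fix a b assume "a \<in> inv_ideal A z x" "b \<in> inv_ideal A z x"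
    then show "a + b \<in> inv_ideal A z x" by (simp add: inv_ideal_lat2 lat2_add)
  next
    fix r a assume r: "r \<in> OK D" and "a \<in> inv_ideal A z x"
    then obtain s where s: "s \<in> latt z" "a = x * of_int A * cnj s" by (auto simp: inv_ideal_def)
    have "r * a = x * of_int A * cnj (cnj r * s)" using s by simp
    moreover have "cnj r * s \<in> latt z" using s r by (intro latt_OK_mult OK_cnj)
    ultimately show "r * a \<in> inv_ideal A z x" unfolding inv_ideal_def by blast
  qed
  moreover have "x * of_int A \<in> inv_ideal A z x" by (simp add: inv_ideal_lat2)
  moreover have "x * of_int A \<noteq> 0" using assms A_pos by simp
  ultimately show ?thesis unfolding int_ideal_def by blast
qed

text \<open>This ideal is the complex conjugate of \<open>inv_ideal A z x\<close>, and a multiple of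
  \<open>b\<close> rather than of its inverse.\<close>

lemma scaled_latt_int_ideal:
  assumes "x \<in> latt z" "x \<noteq> 0" shows "int_ideal D ((\<lambda>t. of_int A * cnj x * t) ` latt z)"
proof -
  let ?I = "(\<lambda>t. of_int A * cnj x * t) ` latt z"
  have L: "?I = lat2 (of_int A * cnj x) (of_int A * cnj x * z)" by (simp add: latt_lat2 lat2_scale)
  have "is_ideal D ?I"
    unfolding is_ideal_def
  proof (intro conjI ballI)
    show "?I \<subseteq> OK D" using pair_OK assms(1) by auto
    show "0 \<in> ?I" by (simp add: L)
  next
    fix a b assume "a \<in> ?I" "b \<in> ?I"
    then show "a + b \<in> ?I" by (simp add: L lat2_add)
  next
    fix r a assume r: "r \<in> OK D" and "a \<in> ?I"
    then obtain s where s: "s \<in> latt z" "a = of_int A * cnj x * s" by auto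
    have "r * a = of_int A * cnj x * (r * s)" using s by simp
    then show "r * a \<in> ?I" using latt_OK_mult[OF r s(1)] by blast
  qed
  moreover have "of_int A * cnj x \<in> ?I" by (simp add: L)
  moreover have "of_int A * cnj x \<noteq> 0" using assms A_pos by simp
  ultimately show ?thesis unfolding int_ideal_def by blast
qed

text \<open>The inclusion from left to right is integrality of the pairing. For the converse, the
  decomposition of 1 is inserted into \<open>x * y * r\<close>, the factor \<open>r\<close> being
  absorbed into the lattice vectors \<open>t k\<close>.\<close>

lemma inv_ideal_mult_scaled:
  "idl_mult (inv_ideal A z x) ((\<lambda>t. y * t) ` latt z) = princ D (x * y)"
proof
  show "idl_mult (inv_ideal A z x) ((\<lambda>t. y * t) ` latt z) \<subseteq> princ D (x * y)"
  proof (rule idl_mult_least)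
    show "0 \<in> princ D (x * y)" unfolding princ_def by (rule image_eqI[of _ _ 0]) auto
    show "a + b \<in> princ D (x * y)" if "a \<in> princ D (x * y)" "b \<in> princ D (x * y)" for a b
      using that OK_add unfolding princ_def image_iff by (metis distrib_left)
    fix a b assume "a \<in> inv_ideal A z x" "b \<in> (\<lambda>t. y * t) ` latt z"
    then obtain s t where st: "s \<in> latt z" "t \<in> latt z" "a = x * of_int A * cnj s" "b = y * t"
      by (auto simp: inv_ideal_def)
    then have "a * b = x * y * (of_int A * cnj s * t)" by simp
    then show "a * b \<in> princ D (x * y)" using pair_OK[OF st(1,2)] unfolding princ_def by blast
  qed
next
  obtain s t :: "nat \<Rightarrow> complex" where st: "\<And>k. k < 4 \<Longrightarrow> s k \<in> latt z \<and> t k \<in> latt z"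
    "(\<Sum>k<4. of_int A * cnj (s k) * t k) = 1" by (rule one_decomp) blast
  show "princ D (x * y) \<subseteq> idl_mult (inv_ideal A z x) ((\<lambda>t. y * t) ` latt z)"
  proof
    fix w assume "w \<in> princ D (x * y)"
    then obtain r where r: "r \<in> OK D" "w = x * y * r" by (auto simp: princ_def)
    have "w = x * y * r * (\<Sum>k<4. of_int A * cnj (s k) * t k)" by (simp add: st r)
    also have "\<dots> = (\<Sum>k<4. (x * of_int A * cnj (s k)) * (y * (r * t k)))"
      by (simp add: sum_distrib_left algebra_simps)
    finally have "w = (\<Sum>k<4. (x * of_int A * cnj (s k)) * (y * (r * t k)))" .
    moreover have "\<forall>k<4. x * of_int A * cnj (s k) \<in> inv_ideal A z x \<and> y * (r * t k) \<in> (\<lambda>t. y * t) ` latt z"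
      using st r latt_OK_mult unfolding inv_ideal_def by blast
    ultimately show "w \<in> idl_mult (inv_ideal A z x) ((\<lambda>t. y * t) ` latt z)"
      unfolding idl_mult_def
      by (intro CollectI exI[of _ 4] exI[of _ "\<lambda>k. x * of_int A * cnj (s k)"] exI[of _ "\<lambda>k. y * (r * t k)"] conjI)
  qed
qed

text \<open>Inserting the decomposition of 1 writes \<open>r\<close> as a sum of pairings of
  \<open>s k\<close> with \<open>r * t k\<close>, each of them integral.\<close>

lemma mult_latt_OK:
  assumes "\<And>t. t \<in> latt z \<Longrightarrow> r * t \<in> latt z" shows "r \<in> OK D"
proof -
  obtain s t :: "nat \<Rightarrow> complex" where st: "\<And>k. k < 4 \<Longrightarrow> s k \<in> latt z \<and> t k \<in> latt z"
    "(\<Sum>k<4. of_int A * cnj (s k) * t k) = 1" by (rule one_decomp) blast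
  have "r = r * (\<Sum>k<4. of_int A * cnj (s k) * t k)" by (simp add: st)
  also have "\<dots> = (\<Sum>k<4. of_int A * cnj (s k) * (r * t k))" by (simp add: sum_distrib_left algebra_simps)
  also have "\<dots> \<in> OK D" using st assms pair_OK by (intro OK_sum) blast
  finally show ?thesis .
qed

text \<open>This says that \<open>b\<close> is the inverse of its inverse; inserting the
  decomposition of 1 writes \<open>x\<close> as a combination of lattice vectors with coefficients
  in the ring.\<close>

lemma mem_latt_of_inv:
  assumes "\<And>s. s \<in> latt z \<Longrightarrow> x * of_int A * cnj s \<in> OK D" shows "x \<in> latt z"
proof -
  obtain s t :: "nat \<Rightarrow> complex" where st: "\<And>k. k < 4 \<Longrightarrow> s k \<in> latt z \<and> t k \<in> latt z"
    "(\<Sum>k<4. of_int A * cnj (s k) * t k) = 1" by (rule one_decomp) blast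
  have sum: "(\<Sum>k<n. g k) \<in> latt z" if "\<And>k. k < n \<Longrightarrow> g k \<in> latt z" for g and n :: nat
    using that by (induction n) (auto intro: latt_add)
  have "x = x * (\<Sum>k<4. of_int A * cnj (s k) * t k)" by (simp add: st)
  also have "\<dots> = (\<Sum>k<4. x * of_int A * cnj (s k) * t k)" by (simp add: sum_distrib_left algebra_simps)
  also have "\<dots> \<in> latt z" using st assms latt_OK_mult by (intro sum) blast
  finally show ?thesis .
qed

text \<open>\<open>x' / x\<close> maps \<open>cnj b\<close> into itself, so its conjugate is a
  multiplier of \<open>b\<close> and lies in the ring; the same holds for the inverse
  quotient.\<close>

lemma inv_ideal_eqD:
  assumes eq: "inv_ideal A z x = inv_ideal A z x'" and nz: "x \<noteq> 0" "x' \<noteq> 0"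
  shows "x' / x \<in> units_OK D"
proof -
  have *: "x' / x \<in> OK D" if eq: "inv_ideal A z x' \<subseteq> inv_ideal A z x" and nz: "x \<noteq> 0" for x x'
  proof -
    have "cnj (x' / x) \<in> OK D"
    proof (rule mult_latt_OK)
      fix s assume "s \<in> latt z"
      then have "x' * of_int A * cnj s \<in> inv_ideal A z x" using eq by (auto simp: inv_ideal_def)
      then obtain t where t: "t \<in> latt z" "x' * of_int A * cnj s = x * of_int A * cnj t"
        by (auto simp: inv_ideal_def)
      then have "x' / x * cnj s = cnj t" using nz A_pos by (simp add: field_simps)
      then have "cnj (x' / x * cnj s) = t" by simp
      then show "cnj (x' / x) * s \<in> latt z" using t by simp
    qed
    then show ?thesis using OK_cnj by fastforce
  qed
  have "x' / x \<in> OK D" "x / x' \<in> OK D" using *[of x' x] *[of x x'] assms by auto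
  then show ?thesis using nz unfolding units_OK_def by (auto intro!: bexI[of _ "x / x'"])
qed

lemma inv_ideal_unit:
  assumes "u \<in> units_OK D" shows "inv_ideal A z (u * x) = inv_ideal A z x"
proof -
  have *: "inv_ideal A z (u * x) \<subseteq> inv_ideal A z x" if u: "u \<in> OK D" for u x
  proof
    fix w assume "w \<in> inv_ideal A z (u * x)"
    then obtain s where s: "s \<in> latt z" "w = u * x * of_int A * cnj s" by (auto simp: inv_ideal_def)
    then have "w = x * of_int A * cnj (cnj u * s)" by simp
    then show "w \<in> inv_ideal A z x" unfolding inv_ideal_def using s u latt_OK_mult OK_cnj by blast
  qed
  obtain v where v: "u \<in> OK D" "v \<in> OK D" "u * v = 1" using assms by (auto simp: units_OK_def)
  have "v * (u * x) = x" using v(3) by (metis mult.assoc mult.commute mult_1)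
  then show ?thesis using *[OF v(1), of x] *[OF v(2), of "u * x"] by (simp only: subset_antisym)
qed

text \<open>A ratio of areas: the basis of the ideal spans \<open>A^2 |x|^2 Im z\<close>, while that
  of the ring spans \<open>sqrt (- D) / 2 = A * Im z\<close>.\<close>

lemma ideal_norm_inv_ideal:
  assumes "x \<in> latt z" "x \<noteq> 0"
  shows "real (ideal_norm D (inv_ideal A z x)) = of_int A * (cmod x)\<^sup>2"
proof -
  have sub: "inv_ideal A z x \<subseteq> OK D"
    using inv_ideal_int_ideal[OF assms] by (simp add: int_ideal_def is_ideal_def)
  have im: "Im (cnj (x * of_int A) * (x * of_int A * cnj z)) = - (of_int A * of_int A * (cmod x)\<^sup>2 * Im z)"
    unfolding cmod_power2 by (simp add: power2_eq_square algebra_simps)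
  have nz: "Im (cnj (x * of_int A) * (x * of_int A * cnj z)) \<noteq> 0"
    unfolding im using assms A_pos Im_z by simp
  have "real (ideal_norm D (inv_ideal A z x))
     = \<bar>Im (cnj (x * of_int A) * (x * of_int A * cnj z))\<bar> / \<bar>Im (cnj 1 * omegaK D)\<bar>"
    unfolding ideal_norm_def OK_lat2 inv_ideal_lat2
    using sub by (intro lat2_index omegaK_ind nz) (simp_all add: OK_lat2 inv_ideal_lat2 lat2_subset_iff)
  also have "\<dots> = of_int A * (cmod x)\<^sup>2"
    unfolding im using A_pos Im_z sqrt_D_pos by (simp add: abs_mult Im_omegaK Im_z_eq)
  finally show ?thesis .
qed

lemma form_value:
  "of_int A * cnj (of_int m + of_int n * z) * (of_int m + of_int n * z)
     = of_int (A * m * m - B * m * n + C * n * n)"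
proof -
  have "of_int A * cnj (of_int m + of_int n * z) * (of_int m + of_int n * z)
    = of_int A * of_int m * of_int m + of_int m * of_int n * (of_int A * z + of_int A * cnj z)
      + of_int n * of_int n * (of_int A * cnj z * z)"
    by (simp add: algebra_simps)
  also have "\<dots> = of_int (A * m * m - B * m * n + C * n * n)"
    unfolding A_cnj_z_z unfolding A_cnj_z by (simp add: algebra_simps)
  finally show ?thesis .
qed

lemma exists_coprime_scaled:
  assumes "M \<noteq> 0"
  obtains x q where "x \<in> latt z" "of_int A * cnj x * x = of_int q" "coprime q M"
proof -
  obtain m n where "coprime (A * m * m - B * m * n + C * n * n) M"
    using primitive_form_coprime_value[OF primitive assms] by blast
  then show ?thesis using that[OF latt_I form_value] by blast
qed

end


text \<open>A fundamental discriminant is not a proper square times another discriminant. The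
  delicate case is \<open>D = 4 m\<close> with \<open>k = 2 l\<close>: then
  \<open>m = l^2 d\<close>, squarefreeness gives \<open>m = d\<close>, and \<open>m\<close> is 2 or
  3 modulo 4 while \<open>d\<close> is 0 or 1.\<close>

lemma fundamental_disc_square_factor:
  assumes "fundamental_disc D" "D = k * k * d" "d mod 4 = 0 \<or> d mod 4 = 1"
  shows "\<bar>k\<bar> = 1"
proof (cases "D mod 4 = 1")
  case True
  then have "squarefree D" using assms(1) by (auto simp: fundamental_disc_def)
  moreover have "k\<^sup>2 dvd D" using assms(2) by (simp add: power2_eq_square)
  ultimately show ?thesis by (auto simp: squarefree_def)
next
  case False
  then have D: "D mod 4 = 0" "(D div 4) mod 4 = 2 \<or> (D div 4) mod 4 = 3" "squarefree (D div 4)"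
    using assms(1) by (auto simp: fundamental_disc_def)
  define m where "m = D div 4"
  have m: "D = 4 * m" using D(1) unfolding m_def by presburger
  show ?thesis
  proof (cases "even k")
    case True
    then obtain l where l: "k = 2 * l" by blast
    then have ml: "m = l * l * d" using m assms(2) by simp
    then have "l\<^sup>2 dvd m" by (simp add: power2_eq_square)
    then have "\<bar>l\<bar> = 1" using D(3) by (auto simp: squarefree_def m_def)
    then have "l * l = 1" by (metis abs_mult_self_eq mult_1)
    then have "m = d" using ml by simp
    then show ?thesis using D(2) assms(3) by (auto simp: m_def)
  next
    case False
    then have "coprime (k * k) (2 * 2)"
      by (simp only: coprime_mult_left_iff coprime_mult_right_iff coprime_right_2_iff_odd even_mult_iff de_Morgan_disj) simp
    then have "coprime (k * k) 4" by simp
    moreover have "k * k dvd 4 * m" using assms(2) m by (metis dvd_triv_left)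
    ultimately have "k * k dvd m" by (simp add: coprime_dvd_mult_right_iff)
    then have "k\<^sup>2 dvd m" by (simp add: power2_eq_square)
    then show ?thesis using D(3) by (auto simp: squarefree_def m_def)
  qed
qed

lemma fundamental_disc_quad_order:
  assumes "fundamental_disc D" "D < 0" shows "quad_order D"
  using assms by unfold_locales (auto simp: fundamental_disc_def)

section \<open>Primitive forms and the multiplier ring of a lattice\<close>

context
  fixes A B C :: int and z :: complex
  assumes A_pos: "A > 0" and primitive: "gcd (gcd A B) C = 1"
    and z_root: "of_int A * z\<^sup>2 + of_int B * z + of_int C = 0" and Im_z: "Im z > 0"
begin

lemma form_Im: "(2 * of_int A * Im z)\<^sup>2 = of_int (4 * A * C - B * B)"
proof -
  have "Im (of_int A * z\<^sup>2 + of_int B * z + of_int C) = 0" "Re (of_int A * z\<^sup>2 + of_int B * z + of_int C) = 0"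
    unfolding z_root by simp_all
  then have 1: "(2 * of_int A * Re z + of_int B) * Im z = 0"
    and 2: "of_int A * (Re z * Re z - Im z * Im z) + of_int B * Re z + of_int C = 0"
    by (simp_all add: power2_eq_square algebra_simps)
  have 3: "of_int B = - (2 * of_int A * Re z)" using 1 Im_z by simp
  have "of_int A * (Im z * Im z) = of_int A * (Re z * Re z) + of_int B * Re z + of_int C"
    using 2 by (simp add: algebra_simps)
  then have 4: "of_int C = of_int A * (Re z * Re z + Im z * Im z)" unfolding 3 by (simp add: algebra_simps)
  have "real_of_int (4 * A * C - B * B) = 4 * of_int A * of_int C - of_int B * of_int B" by simp
  also have "\<dots> = (2 * of_int A * Im z)\<^sup>2" unfolding 3 4 by (simp add: power2_eq_square algebra_simps)
  finally show ?thesis ..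
qed

lemma A_z_sq: "of_int A * z\<^sup>2 = - of_int B * z - of_int C"
proof -
  have "of_int A * z\<^sup>2 - (- of_int B * z - of_int C) = 0" using z_root by (simp add: algebra_simps)
  then show ?thesis by (simp only: right_minus_eq)
qed

text \<open>Write \<open>r = p + q z\<close>. Comparing coordinates in \<open>A * (r * z)\<close>
  shows that \<open>A\<close> divides \<open>q C\<close> and \<open>q B\<close>; it divides
  \<open>q A\<close> as well, so by primitivity it divides \<open>q\<close>. Multipliers thus lie in
  the order generated by \<open>A z\<close>.\<close>

lemma latt_multiplier:
  assumes "r \<in> latt z" "r * z \<in> latt z"
  obtains p k where "r = of_int p + of_int k * (of_int A * z)"
proof -
  obtain p q where r: "r = of_int p + of_int q * z" using assms(1) by (auto simp: latt_def)
  obtain m n where rz: "r * z = of_int m + of_int n * z" using assms(2) by (auto simp: latt_def)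
  have "of_int A * (r * z) = of_int (A * p) * z + of_int q * (of_int A * z\<^sup>2)"
    by (simp add: r power2_eq_square algebra_simps)
  also have "of_int A * z\<^sup>2 = - of_int B * z - of_int C"
    by (rule A_z_sq)
  finally have "of_int (A * m) * 1 + of_int (A * n) * z = of_int (- q * C) * 1 + of_int (A * p - q * B) * z"
    unfolding rz by (simp add: algebra_simps)
  then have eq: "A * m = - q * C \<and> A * n = A * p - q * B"
    by (intro lat2_coords_unique_int[of 1 z]) (use Im_z in simp_all)
  obtain x y w where xyw: "x * A + y * B + w * C = 1" using gcd3_bezout[OF primitive] by blast
  have qC: "q * C = A * (- m)" and qB: "q * B = A * (p - n)" using eq by (simp_all add: algebra_simps)
  have "x * (q * A) + y * (q * B) + w * (q * C) = A * (x * q + y * (p - n) + w * (- m))"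
    unfolding qB qC by (simp add: algebra_simps)
  then have "q * (x * A + y * B + w * C) = A * (x * q + y * (p - n) + w * (- m))"
    by (simp add: algebra_simps)
  then have "q = (x * q + y * (p - n) + w * (- m)) * A" unfolding xyw by (simp add: mult.commute)
  then obtain k where "q = k * A" by blast
  then show ?thesis using that[of p k] r by (simp add: mult.assoc)
qed

lemma A_z_mult_ring: "of_int A * z \<in> mult_ring (latt z)"
proof -
  have *: "of_int A * z * z = of_int (- C) + of_int (- B) * z"
    using A_z_sq by (simp add: power2_eq_square mult.assoc)
  have "of_int A * z * x \<in> latt z" if xl: "x \<in> latt z" for x
  proof -
    obtain p q where x: "x = of_int p + of_int q * z" using xl by (auto simp: latt_def)
    have "of_int A * z * x = of_int (p * A) * z + of_int q * (of_int A * z * z)"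
      by (simp add: x algebra_simps)
    also have "\<dots> = of_int (- q * C) + of_int (p * A - q * B) * z" unfolding * by (simp add: algebra_simps)
    finally show ?thesis unfolding latt_def by blast
  qed
  then show ?thesis by (auto simp: mult_ring_def)
qed

text \<open>\<open>omegaK D\<close> and \<open>A z\<close> each lie in the order generated by the
  other, so their imaginary parts agree up to sign. By \<open>form_Im\<close> the squares of these
  imaginary parts carry the two discriminants.\<close>

lemma cm_form_of_CM:
  assumes D: "quad_order D" and cm: "has_CM_OK D (latt z)"
  shows "cm_form D A B C z"
proof -
  interpret quad_order D by (rule D)
  have mr: "mult_ring (latt z) = OK D" using cm by (simp add: has_CM_OK_def)
  have mem: "1 \<in> latt z" "z \<in> latt z" by (simp_all add: latt_lat2)
  have "omegaK D \<in> mult_ring (latt z)" by (simp add: mr)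
  then have "omegaK D * 1 \<in> latt z" "omegaK D * z \<in> latt z" using mem unfolding mult_ring_def by blast+
  then obtain p k where pk: "omegaK D = of_int p + of_int k * (of_int A * z)" using latt_multiplier[of "omegaK D"] by auto
  have "of_int A * z \<in> OK D" using A_z_mult_ring by (simp add: mr)
  then obtain x y where xy: "of_int A * z = of_int x + of_int y * omegaK D" by (auto simp: OK_def)
  have 1: "Im (omegaK D) = of_int k * (of_int A * Im z)" using arg_cong[OF pk, of Im] by simp
  have 2: "of_int A * Im z = of_int y * Im (omegaK D)" using arg_cong[OF xy, of Im] by simp
  have pos: "Im (omegaK D) > 0" using sqrt_D_pos by (simp add: Im_omegaK)
  have "Im (omegaK D) * (of_int k * of_int y) = Im (omegaK D)" using 1 unfolding 2 by (simp add: mult.commute mult.left_commute)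
  then have "Im (omegaK D) * (of_int k * of_int y) = Im (omegaK D) * 1" by simp
  then have "of_int k * of_int y = (1 :: real)" using pos by (metis less_irrefl mult_left_cancel)
  then have "k * y = 1" by (metis of_int_1 of_int_eq_iff of_int_mult)
  then have "\<bar>y\<bar> = 1" by (auto simp: zmult_eq_1_iff)
  then have "y * y = 1" by (metis abs_mult_self_eq mult_1)
  have "(2 * of_int A * Im z)\<^sup>2 = (of_int y * (2 * Im (omegaK D)))\<^sup>2"
    by (rule arg_cong[of _ _ "\<lambda>t. t\<^sup>2"]) (use 2 in simp)
  also have "\<dots> = of_int (y * y) * (2 * Im (omegaK D))\<^sup>2" by (simp add: power2_eq_square)
  also have "\<dots> = of_int (- D)" unfolding \<open>y * y = 1\<close> using D_neg by (simp add: Im_omegaK)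
  finally have "4 * A * C - B * B = - D" unfolding form_Im of_int_eq_iff .
  then show ?thesis using D_neg A_pos primitive z_root Im_z by unfold_locales auto
qed

end

section \<open>Nonzero ideals as scaled lattices with full complex multiplication\<close>

lemma primitive_form_exists:
  fixes a b c :: int and w :: complex
  assumes "a > 0" "of_int a * w\<^sup>2 + of_int b * w + of_int c = 0"
  obtains A B C where "A > 0" "gcd (gcd A B) C = 1" "of_int A * w\<^sup>2 + of_int B * w + of_int C = 0"
proof -
  define g where "g = gcd (gcd a b) c"
  have g: "g > 0" using assms(1) by (simp add: g_def)
  have "g dvd gcd a b" "g dvd c" unfolding g_def by (rule gcd_dvd1, rule gcd_dvd2)
  then have "g dvd a" "g dvd b" "g dvd c" by (meson gcd_dvd1 gcd_dvd2 dvd_trans)+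
  then obtain A B C where ABC: "a = g * A" "b = g * B" "c = g * C" unfolding dvd_def by blast
  have "gcd (gcd (g * A) (g * B)) (g * C) = g"
    unfolding ABC[symmetric] by (rule g_def[symmetric])
  then have "g * gcd (gcd A B) C = g" using g by (simp add: gcd_mult_left)
  then have "gcd (gcd A B) C = 1" using g by simp
  moreover have "A > 0" using ABC(1) assms(1) g by (simp add: zero_less_mult_iff)
  moreover have "of_int g * (of_int A * w\<^sup>2 + of_int B * w + of_int C) = 0"
    using assms(2) by (simp add: ABC algebra_simps)
  ultimately show ?thesis using that g by auto
qed

context quad_order begin

text \<open>Hermite normal form: division with remainder by the least positive
  \<open>omegaK D\<close> coefficient \<open>k\<close>, and then by the least positive integer
  \<open>U\<close> of the ideal.\<close>

lemma ideal_basis: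
  assumes "int_ideal D I"
  obtains u p k :: int where "u > 0" "k > 0" "I = lat2 (of_int u) (of_int p + of_int k * omegaK D)"
proof -
  have I: "is_ideal D I" using assms by (simp add: int_ideal_def)
  obtain x where x: "x \<in> I" "x \<noteq> 0" using assms is_ideal_0[OF I] by (auto simp: int_ideal_def)
  have xO: "x \<in> OK D" using is_ideal_OK[OF I x(1)] .
  have "cnj x * x \<in> I" using is_ideal_mult[OF I OK_cnj[OF xO] x(1)] .
  moreover obtain N where N: "cnj x * x = of_int N"
    using OK_real_int[of "cnj x * x"] xO OK_cnj OK_mult by auto
  moreover have "N > 0"
  proof -
    have "of_int N = (of_real ((cmod x)\<^sup>2) :: complex)" using N complex_norm_square[of x] by (simp add: mult.commute)
    then have "of_int N = (cmod x)\<^sup>2" by (metis of_real_eq_iff of_real_of_int_eq)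
    then show ?thesis using x(2) by (metis of_int_0_less_iff zero_less_norm_iff zero_less_power)
  qed
  ultimately have ex1: "of_nat (nat N) \<in> I \<and> 0 < nat N" by simp
  \<comment> \<open>The norm of a nonzero element shows that the ideal contains a positive integer
    at all.\<close>
  define U where "U = (LEAST n. of_nat n \<in> I \<and> 0 < n)"
  have U: "of_nat U \<in> I" "0 < U" using LeastI[of "\<lambda>n. of_nat n \<in> I \<and> 0 < n", OF ex1] by (auto simp: U_def)
  have Umin: "U \<le> n" if "of_nat n \<in> I" "0 < n" for n unfolding U_def using that by (intro Least_le) auto
  let ?P = "\<lambda>n. 0 < n \<and> (\<exists>p::int. of_int p + of_nat n * omegaK D \<in> I)"
  have "omegaK D * of_nat U \<in> I" using is_ideal_mult[OF I OK_omegaK U(1)] .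
  then have ex2: "?P U" using U(2) by (auto intro!: exI[of _ 0] simp: mult.commute)
  define k where "k = (LEAST n. ?P n)"
  have "?P k" unfolding k_def by (rule LeastI[of ?P, OF ex2])
  then obtain p where k: "0 < k" "of_int p + of_nat k * omegaK D \<in> I" by blast
  have kmin: "k \<le> n" if "?P n" for n unfolding k_def using that by (rule Least_le)
  have "I = lat2 (of_int (int U)) (of_int p + of_int (int k) * omegaK D)"
  proof
    show "lat2 (of_int (int U)) (of_int p + of_int (int k) * omegaK D) \<subseteq> I"
      using U k by (auto elim!: lat2E intro!: is_ideal_add[OF I] is_ideal_mult[OF I])
    show "I \<subseteq> lat2 (of_int (int U)) (of_int p + of_int (int k) * omegaK D)"
    proof
      fix w assume w: "w \<in> I"
      obtain m n where wmn: "w = of_int m + of_int n * omegaK D"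
        using is_ideal_OK[OF I w] by (auto simp: OK_def)
      define q where "q = n div int k"
      let ?w = "w - of_int q * (of_int p + of_nat k * omegaK D)"
      have w1: "?w \<in> I" by (intro is_ideal_diff[OF I] w is_ideal_mult[OF I] k OK_of_int)
      have nk: "n - q * int k = n mod int k" by (simp add: q_def minus_div_mult_eq_mod)
      have w2: "?w = of_int (m - q * p) + of_int (n mod int k) * omegaK D"
        unfolding nk[symmetric] by (simp add: wmn algebra_simps)
      have lt: "nat (n mod int k) < k" using k(1) by (simp add: nat_less_iff)
      have "n mod int k = 0"
      proof (rule ccontr)
        assume "n mod int k \<noteq> 0"
        moreover have "n mod int k \<ge> 0" using k(1) by simp
        ultimately have pos: "0 < nat (n mod int k)" and "int (nat (n mod int k)) = n mod int k" by linarith+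
        then have "of_int (m - q * p) + of_nat (nat (n mod int k)) * omegaK D \<in> I"
          using w1 unfolding w2 by (metis of_int_of_nat_eq)
        then have "k \<le> nat (n mod int k)" using pos by (intro kmin) blast
        then show False using lt by simp
      qed
      then have w3: "?w = of_int (m - q * p)" using w2 by simp
      define e where "e = m - q * p"
      have "of_int e - of_int (e div int U) * of_nat U \<in> I"
        using w1 U(1) unfolding w3 e_def by (intro is_ideal_diff[OF I] is_ideal_mult[OF I] OK_of_int)
      then have "of_int (e - e div int U * int U) \<in> I" by simp
      then have em: "of_int (e mod int U) \<in> I" by (simp only: minus_div_mult_eq_mod)
      have "e mod int U = 0"
      proof (rule ccontr)
        assume "e mod int U \<noteq> 0"
        moreover have "e mod int U \<ge> 0" using U(2) by simp
        ultimately have pos: "0 < nat (e mod int U)" and eq: "int (nat (e mod int U)) = e mod int U" by linarith+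
        then have "of_nat (nat (e mod int U)) \<in> I" using em by (metis of_int_of_nat_eq)
        then have "U \<le> nat (e mod int U)" using pos by (intro Umin)
        moreover have "nat (e mod int U) < U" using U(2) by (simp add: nat_less_iff)
        ultimately show False by simp
      qed
      then have "e = (e div int U) * int U" by (metis add.right_neutral div_mult_mod_eq)
      then have "of_int e = of_int (e div int U) * (of_int (int U) :: complex)" by (metis of_int_mult)
      then have "w = of_int (e div int U) * of_int (int U) + of_int q * (of_int p + of_int (int k) * omegaK D)"
        using w3 by (simp add: e_def algebra_simps)
      then show "w \<in> lat2 (of_int (int U)) (of_int p + of_int (int k) * omegaK D)"
        by (metis lat2I)
    qed
  qed
  then show ?thesis using that[of "int U" "int k" p] U k by simp
qed

text \<open>The multiplier ring of the ideal is a priori some order containing \<open>OK D\<close>,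
  of discriminant \<open>B^2 - 4AC\<close>. Comparing imaginary parts gives
  \<open>D = k'^2 * (B^2 - 4AC)\<close>, and fundamentality of \<open>D\<close> forces
  \<open>k'\<close> to be 1 or -1.\<close>

lemma ideal_CM:
  assumes fd: "fundamental_disc D" and idl: "int_ideal D I"
  obtains t w where "t \<noteq> 0" "Im w > 0" "has_CM_OK D (latt w)" "I = (\<lambda>x. t * x) ` latt w"
proof -
  have I: "is_ideal D I" using idl by (simp add: int_ideal_def)
  obtain u p k :: int where u: "u > 0" and k: "k > 0"
    and Ilat: "I = lat2 (of_int u) (of_int p + of_int k * omegaK D)" using ideal_basis[OF idl] by blast
  define w where "w = (of_int p + of_int k * omegaK D) / of_int u"
  have uw: "of_int u * w = of_int p + of_int k * omegaK D" using u by (simp add: w_def)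
  have Iw: "I = (\<lambda>x. of_int u * x) ` latt w" by (simp add: latt_lat2 lat2_scale uw Ilat)
  have "of_int u * Im w = of_int k * Im (omegaK D)" using arg_cong[OF uw, of Im] by simp
  moreover have "of_int k * Im (omegaK D) > 0" using k sqrt_D_pos by (simp add: Im_omegaK)
  ultimately have Imw: "Im w > 0" using u by (metis of_int_0_less_iff zero_less_mult_pos)
  define E where "E = (D * D - D) div 4"
  have kw: "of_int k * omegaK D = of_int u * w - of_int p" using uw by simp
  have "(of_int k * omegaK D) * (of_int k * omegaK D) = of_int k * of_int k * (of_int D * omegaK D - of_int E)"
    unfolding E_def omegaK_square[symmetric] by simp
  also have "\<dots> = of_int D * of_int k * (of_int k * omegaK D) - of_int k * of_int k * of_int E"
    by (simp add: algebra_simps)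
  finally have "(of_int u * w - of_int p) * (of_int u * w - of_int p)
     - of_int D * of_int k * (of_int u * w - of_int p) + of_int k * of_int k * of_int E = 0"
    unfolding kw by simp
  \<comment> \<open>A quadratic equation for \<open>w\<close> results from
    \<open>k * omegaK D = u w - p\<close> and the minimal polynomial of \<open>omegaK D\<close>
    scaled by \<open>k^2\<close>. It need not be primitive, so the common factor is removed
    next.\<close>
  then have "of_int (u * u) * w\<^sup>2 + of_int (- 2 * p * u - D * k * u) * w + of_int (p * p + D * k * p + k * k * E) = 0"
    by (simp add: power2_eq_square algebra_simps)
  moreover have "u * u > 0" using u by simp
  ultimately obtain A B C where ABC: "A > 0" "gcd (gcd A B) C = 1"
      "of_int A * w\<^sup>2 + of_int B * w + of_int C = 0"
    using primitive_form_exists[of "u * u" w] by metis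
  have OKw: "r * x \<in> latt w" if "r \<in> OK D" "x \<in> latt w" for r x
  proof -
    have "of_int u * x \<in> I" using that Iw by blast
    then have "r * (of_int u * x) \<in> I" using is_ideal_mult[OF I that(1)] by blast
    then obtain y where "y \<in> latt w" "r * (of_int u * x) = of_int u * y" using Iw by blast
    moreover from this have "r * x = y" using u by simp
    ultimately show ?thesis by simp
  qed
  have mem: "1 \<in> latt w" "w \<in> latt w" by (simp_all add: latt_lat2)
  obtain p' k' where pk: "omegaK D = of_int p' + of_int k' * (of_int A * w)"
    using latt_multiplier[OF ABC Imw, of "omegaK D"] OKw[OF OK_omegaK] mem by (metis mult.right_neutral)
  have "Im (omegaK D) = of_int k' * (of_int A * Im w)" using arg_cong[OF pk, of Im] by simp
  moreover have "(2 * Im (omegaK D))\<^sup>2 = of_int (- D)" using D_neg by (simp add: Im_omegaK)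
  ultimately have "of_int (- D) = of_int (k' * k') * (2 * of_int A * Im w)\<^sup>2"
    by (simp add: power2_eq_square mult.commute mult.left_commute)
  then have "of_int (- D) = (of_int (k' * k' * (4 * A * C - B * B)) :: real)"
    unfolding form_Im[OF ABC Imw] by simp
  then have "- D = k' * k' * (4 * A * C - B * B)" by (simp only: of_int_eq_iff)
  then have "D = k' * k' * (B * B - 4 * A * C)" by (simp add: algebra_simps)
  then have "\<bar>k'\<bar> = 1" by (rule fundamental_disc_square_factor[OF fd _ disc_mod4])
  then have kk: "k' * k' = 1" by (metis abs_mult_self_eq mult_1)
  have "of_int A * w = of_int (k' * k') * (of_int A * w)" by (simp add: kk)
  also have "\<dots> = of_int k' * (omegaK D - of_int p')" by (simp add: pk mult.assoc)
  also have "\<dots> \<in> OK D" by (intro OK_mult OK_diff) auto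
  finally have Aw: "of_int A * w \<in> OK D" .
  have "mult_ring (latt w) = OK D"
  proof
    show "OK D \<subseteq> mult_ring (latt w)" using OKw by (auto simp: mult_ring_def)
    show "mult_ring (latt w) \<subseteq> OK D"
    proof
      fix r assume "r \<in> mult_ring (latt w)"
      then have "r * 1 \<in> latt w" "r * w \<in> latt w" using mem unfolding mult_ring_def by blast+
      then obtain a b where "r = of_int a + of_int b * (of_int A * w)"
        using latt_multiplier[OF ABC Imw, of r] by auto
      then show "r \<in> OK D" using Aw by (auto intro!: OK_add OK_mult)
    qed
  qed
  then show ?thesis using that[of "of_int u" w] u Imw Iw by (auto simp: has_CM_OK_def)
qed

lemma cnj_int_ideal:
  assumes "int_ideal D I" shows "int_ideal D (cnj ` I)"
proof -
  have I: "is_ideal D I" and ne: "I \<noteq> {0}" using assms by (auto simp: int_ideal_def)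
  have "is_ideal D (cnj ` I)"
    unfolding is_ideal_def
  proof (intro conjI ballI)
    show "cnj ` I \<subseteq> OK D" using is_ideal_OK[OF I] OK_cnj by auto
    show "0 \<in> cnj ` I" using is_ideal_0[OF I] by (metis complex_cnj_zero imageI)
    show "x + y \<in> cnj ` I" if "x \<in> cnj ` I" "y \<in> cnj ` I" for x y
      using that is_ideal_add[OF I] by (auto simp flip: complex_cnj_add)
    show "r * x \<in> cnj ` I" if r: "r \<in> OK D" and x: "x \<in> cnj ` I" for r x
    proof -
      obtain y where y: "y \<in> I" "x = cnj y" using x by auto
      have "r * x = cnj (cnj r * y)" by (simp add: y)
      then show ?thesis using is_ideal_mult[OF I OK_cnj[OF r] y(1)] by blast
    qed
  qed
  moreover have "cnj ` I \<noteq> {0}"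
  proof
    assume "cnj ` I = {0}"
    then have "cnj ` cnj ` I = {0}" by simp
    then show False using ne by (simp add: image_image)
  qed
  ultimately show ?thesis by (simp add: int_ideal_def)
qed

end


section \<open>The discriminant group and the action of the CM group\<close>

lemma complex_of_real_of_rat [simp]: "complex_of_real (of_rat q) = of_rat q"
  by (cases q) (simp add: of_rat_rat)

locale cm_lattice = cm_form +
  fixes f :: nat
  assumes f_pos: "f > 0"
begin

abbreviation "dual \<equiv> dual_lat f A B C"
abbreviation "disc_group \<equiv> disc_grp f A B C"

text \<open>\<open>Omega\<close> with the order of the discriminant group evaluated; \<open>cL\<close> is the lattice \<open>c b\<close>.\<close>
definition om :: "rat \<times> rat \<Rightarrow> complex" where
  "om y = of_nat f * sqrtD D * (of_rat (fst y) - of_rat (snd y) * z)"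

definition cL :: "complex set" where
  "cL = (\<lambda>t. of_nat f * sqrtD D * t) ` latt z"

lemma sqrtD_nz: "sqrtD D \<noteq> 0"
  using sqrt_D_pos by (auto simp: complex_eq_iff)

lemma c_gen_nz: "of_nat f * sqrtD D \<noteq> 0"
  using sqrtD_nz f_pos by simp

lemma c_gen_OK: "of_nat f * sqrtD D \<in> OK D"
  by (intro OK_mult sqrtD_OK OK_of_nat)

lemma of_rat_coords_unique:
  assumes "of_rat a + of_rat b * z = of_rat c + of_rat d * z" shows "a = c \<and> b = d"
proof -
  have "complex_of_real (of_rat a) * 1 + of_real (of_rat b) * z = of_real (of_rat c) * 1 + of_real (of_rat d) * z"
    using assms by simp
  then have "real_of_rat a = of_rat c \<and> real_of_rat b = of_rat d"
    by (rule lat2_coords_unique[OF latt_ind])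
  then show ?thesis by simp
qed

lemma om_inj: "om y = om y' \<Longrightarrow> y = y'"
  using of_rat_coords_unique[of "fst y" "- snd y" "fst y'" "- snd y'"] c_gen_nz
  by (auto simp: om_def of_rat_minus prod_eq_iff)

text \<open>Substituting \<open>sqrtD D = 2 A z + B\<close> and reducing \<open>A z^2\<close> shows
  that the coordinates of \<open>om y\<close> in the basis 1, \<open>z\<close> are the pairings of
  \<open>y\<close> with \<open>e1\<close> and \<open>e2\<close>. Membership in the dual lattice
  therefore becomes membership in \<open>latt z\<close>.\<close>

lemma om_coords:
  "om y = of_rat (bil f A B C (0, 1) y) + of_rat (bil f A B C (1, 0) y) * z"
proof -
  obtain a b where y: "y = (a, b)" by fastforce
  have s: "sqrtD D = 2 * of_int A * z + of_int B" using two_A_z by simp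
  have "om y = of_nat f * (of_int B * of_rat a + (2 * of_int A * of_rat a - of_int B * of_rat b) * z
      - 2 * of_rat b * (of_int A * z * z))"
    unfolding om_def s y by (simp add: algebra_simps)
  also have "\<dots> = of_rat (bil f A B C (0, 1) y) + of_rat (bil f A B C (1, 0) y) * z"
    unfolding A_z_z by (simp add: bil_def y of_rat_add of_rat_mult algebra_simps)
  finally show ?thesis .
qed

lemma dual_iff: "y \<in> dual \<longleftrightarrow> bil f A B C (0, 1) y \<in> \<int> \<and> bil f A B C (1, 0) y \<in> \<int>"
proof
  assume "y \<in> dual"
  then show "bil f A B C (0, 1) y \<in> \<int> \<and> bil f A B C (1, 0) y \<in> \<int>"
    unfolding dual_lat_def std_lat_def by auto
next
  assume *: "bil f A B C (0, 1) y \<in> \<int> \<and> bil f A B C (1, 0) y \<in> \<int>"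
  have "bil f A B C x y \<in> \<int>" if "x \<in> std_lat" for x
  proof -
    have "bil f A B C x y = fst x * bil f A B C (1, 0) y + snd x * bil f A B C (0, 1) y"
      by (simp add: bil_def algebra_simps)
    also have "\<dots> \<in> \<int>" using * that by (intro Ints_add Ints_mult) (auto simp: std_lat_def)
    finally show ?thesis .
  qed
  then show "y \<in> dual" unfolding dual_lat_def by blast
qed

lemma om_mem_iff: "om y \<in> latt z \<longleftrightarrow> y \<in> dual"
proof
  assume "om y \<in> latt z"
  then obtain m n where "om y = of_int m + of_int n * z" by (auto simp: latt_def)
  then have "of_rat (bil f A B C (0, 1) y) + of_rat (bil f A B C (1, 0) y) * z
     = of_rat (of_int m) + of_rat (of_int n) * z"
    unfolding om_coords by simp
  from of_rat_coords_unique[OF this] show "y \<in> dual" unfolding dual_iff by auto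
next
  assume "y \<in> dual"
  then obtain m n where "bil f A B C (0, 1) y = of_int m" "bil f A B C (1, 0) y = of_int n"
    unfolding dual_iff by (auto elim!: Ints_cases)
  then show "om y \<in> latt z" unfolding om_coords by (simp add: latt_I)
qed

lemma om_surj:
  assumes "x \<in> latt z" obtains y where "y \<in> dual" "om y = x"
proof -
  obtain n m where x: "x = of_int n + of_int m * z" using assms by (auto simp: latt_def)
  \<comment> \<open>Cramer's rule for prescribed pairings \<open>m\<close> with \<open>e2\<close>
    and \<open>n\<close> with \<open>e1\<close>: the Gram matrix has determinant
    \<open>f^2 * (- D)\<close>, and one factor \<open>f\<close> cancels against its
    adjugate.\<close>
  define y :: "rat \<times> rat" where "y = ((2 * of_int C * of_int m - of_int B * of_int n) / (of_nat f * - of_int D),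
      (2 * of_int A * of_int n - of_int B * of_int m) / (of_nat f * - of_int D))"
  have nz: "of_nat f * - of_int D \<noteq> (0::rat)" using f_pos D_neg by simp
  have D': "(of_int D :: rat) = of_int B * of_int B - 4 * of_int A * of_int C"
    using disc by (metis of_int_diff of_int_mult of_int_numeral)
  have fy: "of_nat f * - of_int D * fst y = 2 * of_int C * of_int m - of_int B * of_int n"
    "of_nat f * - of_int D * snd y = 2 * of_int A * of_int n - of_int B * of_int m"
    using nz by (simp_all add: y_def)
  have "- of_int D * bil f A B C (0, 1) y
     = of_int B * (of_nat f * - of_int D * fst y) + 2 * of_int C * (of_nat f * - of_int D * snd y)"
    by (simp add: bil_def algebra_simps)
  also have "\<dots> = - of_int D * of_int n" unfolding fy unfolding D' by (simp add: algebra_simps)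
  finally have 1: "bil f A B C (0, 1) y = of_int n" using D_neg by simp
  have "- of_int D * bil f A B C (1, 0) y
     = 2 * of_int A * (of_nat f * - of_int D * fst y) + of_int B * (of_nat f * - of_int D * snd y)"
    by (simp add: bil_def algebra_simps)
  also have "\<dots> = - of_int D * of_int m" unfolding fy unfolding D' by (simp add: algebra_simps)
  finally have 2: "bil f A B C (1, 0) y = of_int m" using D_neg by simp
  have "om y = x" unfolding om_coords 1 2 x by simp
  then show ?thesis using that om_mem_iff assms by metis
qed

lemma om_dual: "om ` dual = latt z"
proof
  show "latt z \<subseteq> om ` dual"
  proof
    fix x assume "x \<in> latt z"
    then obtain y where "y \<in> dual" "om y = x" by (rule om_surj)
    then show "x \<in> om ` dual" by blast
  qed
qed (use om_mem_iff in auto)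

lemma om_std: "om ` std_lat = cL"
proof
  show "om ` std_lat \<subseteq> cL"
  proof
    fix w assume "w \<in> om ` std_lat"
    then obtain y where y: "fst y \<in> \<int>" "snd y \<in> \<int>" "w = om y" by (auto simp: std_lat_def)
    then obtain m n where "fst y = of_int m" "snd y = of_int n" by (auto elim!: Ints_cases)
    then have "w = of_nat f * sqrtD D * (of_int m + of_int (- n) * z)" by (simp add: y om_def)
    then show "w \<in> cL" unfolding cL_def using latt_I by blast
  qed
  show "cL \<subseteq> om ` std_lat"
  proof
    fix w assume "w \<in> cL"
    then obtain m n where w: "w = of_nat f * sqrtD D * (of_int m + of_int n * z)"
      by (auto simp: cL_def latt_def)
    have "w = om (of_int m, of_int (- n))" by (simp add: w om_def of_rat_minus)
    moreover have "(of_int m, of_int (- n)) \<in> std_lat" by (simp add: std_lat_def)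
    ultimately show "w \<in> om ` std_lat" by blast
  qed
qed

lemma cL_lat2: "cL = lat2 (of_nat f * sqrtD D) (of_nat f * sqrtD D * z)"
  by (simp add: cL_def latt_lat2 lat2_scale)

lemma cL_add: "x \<in> cL \<Longrightarrow> y \<in> cL \<Longrightarrow> x + y \<in> cL"
  and cL_diff: "x \<in> cL \<Longrightarrow> y \<in> cL \<Longrightarrow> x - y \<in> cL"
  and cL_uminus: "x \<in> cL \<Longrightarrow> - x \<in> cL" and cL_0 [simp]: "0 \<in> cL"
  by (simp_all add: cL_lat2 lat2_add lat2_diff lat2_uminus)

lemma cL_minus_commute: "x - y \<in> cL \<Longrightarrow> y - x \<in> cL"
  using cL_uminus[of "x - y"] by simp

lemma cL_OK_mult:
  assumes "r \<in> OK D" "x \<in> cL" shows "r * x \<in> cL"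
proof -
  obtain t where t: "t \<in> latt z" "x = of_nat f * sqrtD D * t" using assms(2) by (auto simp: cL_def)
  have "r * x = of_nat f * sqrtD D * (r * t)" by (simp add: t)
  then show ?thesis using latt_OK_mult[OF assms(1) t(1)] by (auto simp: cL_def)
qed

lemma cideal_mult_latt:
  assumes "c \<in> cideal D f" "x \<in> latt z" shows "c * x \<in> cL"
proof -
  obtain t where t: "t \<in> OK D" "c = of_nat f * sqrtD D * t" using assms(1) by (auto simp: cideal_def princ_def)
  have "c * x = of_nat f * sqrtD D * (t * x)" by (simp add: t)
  then show ?thesis using latt_OK_mult[OF t(1) assms(2)] by (auto simp: cL_def)
qed

lemma cL_sub: "cL \<subseteq> latt z"
  using latt_OK_mult c_gen_OK by (auto simp: cL_def)

lemma om_add: "om (fst y + fst x, snd y + snd x) = om y + om x"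
  by (simp add: om_def of_rat_add algebra_simps)

lemma coset_eq:
  assumes "y \<in> dual" shows "coset y = {y' \<in> dual. om y' - om y \<in> cL}"
proof (intro equalityI subsetI)
  fix y' assume "y' \<in> coset y"
  then obtain x where x: "x \<in> std_lat" "y' = (fst y + fst x, snd y + snd x)" by (auto simp: coset_def)
  have "om x \<in> cL" using x(1) om_std by blast
  moreover have "om y' = om y + om x" unfolding x(2) by (rule om_add)
  ultimately show "y' \<in> {y' \<in> dual. om y' - om y \<in> cL}"
    using assms cL_sub by (auto simp flip: om_mem_iff intro: latt_add)
next
  fix y' assume "y' \<in> {y' \<in> dual. om y' - om y \<in> cL}"
  then have "om y' - om y \<in> om ` std_lat" by (simp add: om_std)
  then obtain x where x: "x \<in> std_lat" "om y' - om y = om x" by blast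
  have "om y' = om (fst y + fst x, snd y + snd x)" unfolding om_add using x(2) by (simp add: algebra_simps)
  then have "y' = (fst y + fst x, snd y + snd x)" by (rule om_inj)
  then show "y' \<in> coset y" using x(1) by (auto simp: coset_def)
qed

lemma coset_eq_iff:
  assumes "y \<in> dual" "y' \<in> dual" shows "coset y = coset y' \<longleftrightarrow> om y - om y' \<in> cL"
proof
  assume "coset y = coset y'"
  moreover have "y \<in> coset y" using assms by (simp add: coset_eq)
  ultimately show "om y - om y' \<in> cL" using assms by (simp add: coset_eq)
next
  assume d: "om y - om y' \<in> cL"
  have "om w - om y \<in> cL \<longleftrightarrow> om w - om y' \<in> cL" for w
    using cL_add[of "om w - om y" "om y - om y'"] cL_diff[of "om w - om y'" "om y - om y'"] d by auto
  then show "coset y = coset y'" using assms by (simp add: coset_eq)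
qed

text \<open>Under \<open>om\<close> this is the index of \<open>c b\<close> in \<open>b\<close>,
  hence the squared modulus of \<open>f * sqrtD D\<close>. It evaluates the square root in the
  definition of \<open>Omega\<close>.\<close>

lemma card_disc_group: "real (card disc_group) = (real f)\<^sup>2 * of_int (- D)"
proof -
  let ?u = "of_nat f * sqrtD D"
  have im: "Im (cnj ?u * (?u * z)) = (real f)\<^sup>2 * of_int (- D) * Im z"
  proof -
    have "cnj ?u * (?u * z) = of_nat f * of_nat f * (- (sqrtD D * sqrtD D)) * z"
      by (simp add: algebra_simps)
    also have "\<dots> = of_real ((real f)\<^sup>2 * of_int (- D)) * z"
      unfolding sqrtD_square[OF D_neg] by (simp add: power2_eq_square)
    finally show ?thesis by (simp only: Im_complex_of_real Re_complex_of_real times_complex.simps mult_zero_left add_0_right)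
  qed
  have "card disc_group = card ((\<lambda>y. {w \<in> lat2 1 z. om y - w \<in> lat2 ?u (?u * z)}) ` dual)"
    unfolding disc_grp_def
  proof (rule card_image_cong_iff)
    fix y y' assume yy: "y \<in> dual" "y' \<in> dual"
    then have "om y \<in> lat2 1 z" "om y' \<in> lat2 1 z" by (simp_all add: om_mem_iff flip: latt_lat2)
    then show "(coset y = coset y') = ({w \<in> lat2 1 z. om y - w \<in> lat2 ?u (?u * z)}
       = {w \<in> lat2 1 z. om y' - w \<in> lat2 ?u (?u * z)})"
      using yy by (simp only: coset_eq_iff lat2_class_eq_iff cL_lat2)
  qed
  also have "(\<lambda>y. {w \<in> lat2 1 z. om y - w \<in> lat2 ?u (?u * z)}) ` dual
     = (\<lambda>x. {w \<in> lat2 1 z. x - w \<in> lat2 ?u (?u * z)}) ` lat2 1 z"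
    unfolding latt_lat2[symmetric] om_dual[symmetric] by (simp add: image_image)
  finally have "real (card disc_group) = \<bar>Im (cnj ?u * (?u * z))\<bar> / \<bar>Im (cnj 1 * z)\<bar>"
  proof (simp only:, intro lat2_index latt_ind)
    show "Im (cnj ?u * (?u * z)) \<noteq> 0" unfolding im using f_pos D_neg Im_z by simp
    show "?u \<in> lat2 1 z" "?u * z \<in> lat2 1 z"
      using latt_OK_mult[OF c_gen_OK] latt_1 latt_z by (metis latt_lat2 mult.right_neutral)+
  qed
  also have "\<dots> = (real f)\<^sup>2 * of_int (- D)" unfolding im using Im_z D_neg by (simp add: abs_mult)
  finally show ?thesis .
qed

lemma finite_disc_group: "finite disc_group"
  using card_disc_group f_pos D_neg by (metis card.infinite less_irrefl mult_pos_pos neg_0_less_iff_less of_int_0_less_iff of_nat_0 of_nat_0_less_iff zero_less_power)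

lemma sqrt_2Af_pos: "sqrt (2 * of_int A * of_nat f) > 0"
  using A_pos f_pos by simp

lemma Omega_om: "Omega f A B C z y = om y"
proof -
  have "sqrt (real (card disc_group)) = real f * sqrt (of_int (- D))"
    unfolding card_disc_group real_sqrt_mult by simp
  then have "\<i> * complex_of_real (sqrt (real (card disc_group))) = of_nat f * sqrtD D"
    by (simp add: sqrtD_def)
  moreover have "complex_of_real (inverse (sqrt (2 * of_int A * of_nat f))) * complex_of_real (sqrt (2 * of_int A * of_nat f)) = 1"
    using sqrt_2Af_pos by (metis left_inverse less_irrefl of_real_1 of_real_mult)
  ultimately show ?thesis unfolding Omega_def Omega'_def om_def by (simp add: mult.assoc[symmetric])
qed

text \<open>The ratio of \<open>Omega'\<close> to \<open>Omega\<close>. Its modulus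
  \<open>sqrt (2 A / (f |D|))\<close> depends on the lattice through \<open>sqrt A\<close>
  alone.\<close>

definition kappa :: complex where
  "kappa = of_real (sqrt (2 * of_int A * of_nat f)) / (of_nat f * sqrtD D)"

lemma kappa_nz: "kappa \<noteq> 0"
  using A_pos f_pos sqrtD_nz unfolding kappa_def by simp

lemma Omega'_om: "Omega' f A z y = kappa * om y"
  using c_gen_nz by (simp add: Omega'_def kappa_def om_def)

text \<open>The exponent contains \<open>A |x|^2\<close>, which is the norm of the ideal
  \<open>x b^-1\<close>; the terms thus match those of the Hecke theta series.\<close>

definition gterm :: "complex \<Rightarrow> complex \<Rightarrow> complex" where
  "gterm \<tau> x = x * exp (2 * pi * \<i> * \<tau> * of_real (of_int A * (cmod x)\<^sup>2))"

text \<open>The level \<open>f |D|\<close> is what the scaling in \<open>om\<close> absorbs: the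
  form at \<open>y\<close> is \<open>2 f A |w|^2\<close> with \<open>om y = f * sqrtD D * w\<close>,
  and \<open>|om y|^2\<close> contributes the factor \<open>f^2 |D|\<close>.\<close>

lemma bil_om:
  "of_nat (f * nat \<bar>D\<bar>) * of_rat (bil f A B C y y) = 2 * complex_of_real (of_int A * (cmod (om y))\<^sup>2)"
proof -
  let ?w = "of_rat (fst y) - of_rat (snd y) * z"
  have cr: "cnj (of_rat q) = of_rat q" for q
    by (metis complex_cnj_complex_of_real complex_of_real_of_rat)
  have N: "of_nat (nat \<bar>D\<bar>) = (- of_int D :: complex)"
    using D_neg by (simp add: of_nat_nat)
  have "complex_of_real ((cmod (om y))\<^sup>2) = om y * cnj (om y)" by (rule complex_norm_square)
  also have "\<dots> = of_nat f * of_nat f * (- (sqrtD D * sqrtD D)) * (?w * cnj ?w)"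
    unfolding om_def by (simp add: algebra_simps)
  also have "\<dots> = of_nat f * of_nat f * (- of_int D) * (?w * cnj ?w)" by (simp only: sqrtD_square[OF D_neg])
  finally have 1: "complex_of_real (of_int A * (cmod (om y))\<^sup>2)
     = of_nat f * of_nat f * (- of_int D) * (of_int A * (?w * cnj ?w))"
    unfolding of_real_mult of_real_of_int_eq by (simp only: ac_simps)
  have "of_int A * (?w * cnj ?w) = of_int A * of_rat (fst y) * of_rat (fst y)
     - of_rat (fst y) * of_rat (snd y) * (of_int A * z + of_int A * cnj z)
     + of_rat (snd y) * of_rat (snd y) * (of_int A * cnj z * z)"
    by (simp add: cr algebra_simps)
  also have "\<dots> = of_int A * of_rat (fst y) * of_rat (fst y) + of_int B * of_rat (fst y) * of_rat (snd y)
     + of_int C * of_rat (snd y) * of_rat (snd y)"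
    unfolding A_cnj_z_z unfolding A_cnj_z by (simp add: algebra_simps)
  finally have 2: "of_rat (bil f A B C y y) = 2 * of_nat f * (of_int A * (?w * cnj ?w))"
    by (simp add: bil_def of_rat_add of_rat_mult algebra_simps)
  show ?thesis unfolding 1 2 of_nat_mult N by (simp add: algebra_simps)
qed

lemma theta_fa_om: "theta_fa D f A B C z \<tau> \<beta> = kappa * infsum (gterm \<tau>) (om ` \<beta>)"
proof -
  have "Omega' f A z y * exp (pi * \<i> * of_nat (f * nat \<bar>D\<bar>) * \<tau> * of_rat (bil f A B C y y))
     = kappa * gterm \<tau> (om y)" for y
  proof -
    have "pi * \<i> * of_nat (f * nat \<bar>D\<bar>) * \<tau> * of_rat (bil f A B C y y)
       = pi * \<i> * \<tau> * (of_nat (f * nat \<bar>D\<bar>) * of_rat (bil f A B C y y))" by (simp only: ac_simps)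
    also have "\<dots> = 2 * pi * \<i> * \<tau> * of_real (of_int A * (cmod (om y))\<^sup>2)"
      unfolding bil_om by simp
    finally show ?thesis by (simp only: Omega'_om gterm_def mult.assoc)
  qed
  then have "theta_fa D f A B C z \<tau> \<beta> = infsum (\<lambda>y. kappa * gterm \<tau> (om y)) \<beta>"
    unfolding theta_fa_def by (simp only:)
  also have "\<dots> = kappa * infsum (\<lambda>y. gterm \<tau> (om y)) \<beta>" by (rule infsum_cmult_right')
  also have "infsum (\<lambda>y. gterm \<tau> (om y)) \<beta> = infsum (gterm \<tau>) (om ` \<beta>)"
    by (subst infsum_reindex) (auto simp: inj_on_def o_def dest: om_inj)
  finally show ?thesis .
qed

section \<open>Functions on the lattice that are constant modulo \<open>c b\<close>\<close>

definition cls_val :: "(complex \<Rightarrow> complex) \<Rightarrow> (rat \<times> rat) set \<Rightarrow> complex" where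
  "cls_val k \<beta> = k (om (SOME y. y \<in> \<beta>))"

definition periodic :: "(complex \<Rightarrow> complex) \<Rightarrow> bool" where
  "periodic k \<longleftrightarrow> (\<forall>x\<in>latt z. \<forall>y\<in>latt z. x - y \<in> cL \<longrightarrow> k x = k y)"

lemma cls_val_coset:
  assumes "periodic k" "y \<in> dual" shows "cls_val k (coset y) = k (om y)"
proof -
  have "y \<in> coset y" using assms by (simp add: coset_eq)
  then have "(SOME y'. y' \<in> coset y) \<in> coset y" by (rule someI)
  then have "(SOME y'. y' \<in> coset y) \<in> dual" "om (SOME y'. y' \<in> coset y) - om y \<in> cL"
    using assms(2) by (auto simp: coset_eq)
  then show ?thesis using assms unfolding cls_val_def periodic_def by (auto simp: om_mem_iff)
qed

lemma cls_val_mem: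
  assumes "periodic k" "\<beta> \<in> disc_group" "x \<in> om ` \<beta>" shows "cls_val k \<beta> = k x"
proof -
  obtain y where y: "y \<in> dual" "\<beta> = coset y" using assms(2) by (auto simp: disc_grp_def)
  obtain y' where y': "y' \<in> \<beta>" "x = om y'" using assms(3) by blast
  have y'd: "y' \<in> dual" "om y' - om y \<in> cL" using y y' by (auto simp: coset_eq)
  have "cls_val k \<beta> = k (om y)" using cls_val_coset assms(1) y by simp
  also have "\<dots> = k x"
    using assms(1) y(1) y'd cL_minus_commute[OF y'd(2)] unfolding periodic_def y'(2) by (auto simp: om_mem_iff)
  finally show ?thesis .
qed

lemma latt_partition: "latt z = (\<Union>\<beta>\<in>disc_group. om ` \<beta>)"
proof
  show "latt z \<subseteq> (\<Union>\<beta>\<in>disc_group. om ` \<beta>)"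
  proof
    fix x assume "x \<in> latt z"
    then obtain y where y: "y \<in> dual" "om y = x" by (rule om_surj)
    then have "y \<in> coset y" by (simp add: coset_eq)
    then show "x \<in> (\<Union>\<beta>\<in>disc_group. om ` \<beta>)" using y by (auto simp: disc_grp_def)
  qed
  show "(\<Union>\<beta>\<in>disc_group. om ` \<beta>) \<subseteq> latt z"
    by (auto simp: disc_grp_def coset_eq om_mem_iff)
qed

lemma disc_group_disjoint:
  assumes "\<beta> \<in> disc_group" "\<gamma> \<in> disc_group" "\<beta> \<noteq> \<gamma>" shows "om ` \<beta> \<inter> om ` \<gamma> = {}"
proof (rule ccontr)
  assume "om ` \<beta> \<inter> om ` \<gamma> \<noteq> {}"
  then obtain w w' where ww: "w \<in> \<beta>" "w' \<in> \<gamma>" "om w = om w'" by blast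
  then have w: "w \<in> \<beta>" "w \<in> \<gamma>" using om_inj[OF ww(3)] by auto
  obtain y y' where y: "y \<in> dual" "\<beta> = coset y" "y' \<in> dual" "\<gamma> = coset y'"
    using assms by (auto simp: disc_grp_def)
  have "om w - om y \<in> cL" "om w - om y' \<in> cL" using w y by (auto simp: coset_eq)
  then have "(om w - om y') - (om w - om y) \<in> cL" by (intro cL_diff[of "om w - om y'"])
  then have "coset y = coset y'" using y by (simp add: coset_eq_iff)
  then show False using assms y by simp
qed

text \<open>The lattice splits into the finitely many cosets of \<open>c b\<close>, on each of which
  \<open>k\<close> is a constant that can be pulled out of the sum. Division by \<open>kappa\<close>
  compensates for the factor carried by \<open>theta_fa\<close>.\<close>

lemma theta_fa_sum:
  assumes k: "periodic k" and s: "gterm \<tau> summable_on latt z"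
  shows "infsum (\<lambda>x. k x * gterm \<tau> x) (latt z)
     = (\<Sum>\<beta>\<in>disc_group. cls_val k \<beta> / kappa * theta_fa D f A B C z \<tau> \<beta>)"
    and "(\<lambda>x. k x * gterm \<tau> x) summable_on latt z"
proof -
  have hs: "((\<lambda>x. k x * gterm \<tau> x) has_sum cls_val k \<beta> * infsum (gterm \<tau>) (om ` \<beta>)) (om ` \<beta>)"
    if "\<beta> \<in> disc_group" for \<beta>
  proof -
    have "gterm \<tau> summable_on om ` \<beta>"
      using s by (rule summable_on_subset_banach) (use that latt_partition in auto)
    then have "((\<lambda>x. cls_val k \<beta> * gterm \<tau> x) has_sum cls_val k \<beta> * infsum (gterm \<tau>) (om ` \<beta>)) (om ` \<beta>)"
      by (intro has_sum_cmult_right has_sum_infsum)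
    then show ?thesis
      by (rule has_sum_cong[THEN iffD1, rotated]) (use cls_val_mem[OF k that] in auto)
  qed
  have "((\<lambda>x. k x * gterm \<tau> x) has_sum (\<Sum>\<beta>\<in>disc_group. cls_val k \<beta> * infsum (gterm \<tau>) (om ` \<beta>)))
      (\<Union>\<beta>\<in>disc_group. om ` \<beta>)"
    using disc_group_disjoint by (intro sum_has_sum finite_disc_group hs) auto
  then have *: "((\<lambda>x. k x * gterm \<tau> x) has_sum (\<Sum>\<beta>\<in>disc_group. cls_val k \<beta> * infsum (gterm \<tau>) (om ` \<beta>))) (latt z)"
    by (simp only: latt_partition)
  then show "(\<lambda>x. k x * gterm \<tau> x) summable_on latt z" by (auto simp: summable_on_def)
  have "infsum (\<lambda>x. k x * gterm \<tau> x) (latt z) = (\<Sum>\<beta>\<in>disc_group. cls_val k \<beta> * infsum (gterm \<tau>) (om ` \<beta>))"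
    using * by (rule infsumI)
  also have "\<dots> = (\<Sum>\<beta>\<in>disc_group. cls_val k \<beta> / kappa * theta_fa D f A B C z \<tau> \<beta>)"
    using kappa_nz by (intro sum.cong refl) (simp add: theta_fa_om)
  finally show "infsum (\<lambda>x. k x * gterm \<tau> x) (latt z)
     = (\<Sum>\<beta>\<in>disc_group. cls_val k \<beta> / kappa * theta_fa D f A B C z \<tau> \<beta>)" .
qed

section \<open>The CM group and its action on cosets\<close>

lemma cideal_is_ideal: "is_ideal D (cideal D f)"
  unfolding cideal_def by (rule princ_ideal[OF c_gen_OK])

lemma cideal_lat2: "cideal D f = lat2 (of_nat f * sqrtD D) (of_nat f * sqrtD D * omegaK D)"
  by (simp add: cideal_def princ_def OK_lat2 lat2_scale)

lemma finite_cm_group: "finite (cm_group D (cideal D f))"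
proof -
  let ?u = "of_nat f * sqrtD D" and ?w = "omegaK D"
  let ?F = "\<lambda>x. {w \<in> lat2 1 ?w. x - w \<in> lat2 ?u (?u * ?w)}"
  have im: "Im (cnj ?u * (?u * ?w)) \<noteq> 0"
  proof -
    have "cnj ?u * (?u * ?w) = of_nat f * of_nat f * (- (sqrtD D * sqrtD D)) * ?w"
      by (simp add: algebra_simps)
    also have "\<dots> = of_real ((real f)\<^sup>2 * of_int (- D)) * ?w"
      unfolding sqrtD_square[OF D_neg] by (simp add: power2_eq_square)
    finally have "Im (cnj ?u * (?u * ?w)) = (real f)\<^sup>2 * of_int (- D) * Im ?w"
      by (simp only: Im_complex_of_real Re_complex_of_real times_complex.simps mult_zero_left add_0_right)
    then show ?thesis using f_pos D_neg omegaK_ind by simp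
  qed
  have "real (card (?F ` lat2 1 ?w)) = \<bar>Im (cnj ?u * (?u * ?w))\<bar> / \<bar>Im (cnj 1 * ?w)\<bar>"
    by (intro lat2_index omegaK_ind im)
      (auto simp flip: OK_lat2 intro: OK_mult c_gen_OK OK_omegaK sqrtD_OK)
  also have "\<dots> > 0" using im omegaK_ind by simp
  finally have "card (?F ` lat2 1 ?w) > 0" by simp
  then have fin: "finite (?F ` OK D)" unfolding OK_lat2 by (rule card_ge_0_finite)
  have cls: "{b \<in> OK D. b - a \<in> cideal D f} = ?F a" for a
  proof -
    have "b - a \<in> cideal D f \<longleftrightarrow> a - b \<in> cideal D f" for b
      using is_ideal_uminus[OF cideal_is_ideal, of "b - a"] is_ideal_uminus[OF cideal_is_ideal, of "a - b"] by auto
    then show ?thesis by (simp only: OK_lat2 cideal_lat2)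
  qed
  have "cm_group D (cideal D f) \<subseteq> ?F ` OK D"
    unfolding cm_group_def cls by (rule image_mono) simp
  then show ?thesis using fin by (rule finite_subset)
qed

lemma card_cm_group_pos: "card (cm_group D (cideal D f)) > 0"
proof -
  have "{b \<in> OK D. b - 1 \<in> cideal D f} \<in> cm_group D (cideal D f)"
    unfolding cm_group_def using coprime_elt_1[OF cideal_is_ideal] by (intro imageI) simp
  then show ?thesis using finite_cm_group card_gt_0_iff by blast
qed

text \<open>The representative is the very element at which \<open>char_cls\<close> evaluates the
  character.\<close>

lemma cm_group_rep:
  assumes "g \<in> cm_group D (cideal D f)"
  defines "a \<equiv> SOME a. a \<in> g"
  shows "a \<in> OK D" "coprime_elt D a (cideal D f)" "g = {b \<in> OK D. b - a \<in> cideal D f}"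
proof -
  obtain \<alpha> where al: "\<alpha> \<in> OK D" "coprime_elt D \<alpha> (cideal D f)" "g = {b \<in> OK D. b - \<alpha> \<in> cideal D f}"
    using assms(1) by (auto simp: cm_group_def)
  have "\<alpha> \<in> g" using al is_ideal_0[OF cideal_is_ideal] by simp
  then have "a \<in> g" unfolding a_def by (rule someI)
  then have a: "a \<in> OK D" "a - \<alpha> \<in> cideal D f" using al by auto
  then show "a \<in> OK D" "coprime_elt D a (cideal D f)"
    using coprime_elt_cong[OF cideal_is_ideal a(1) al(1) a(2)] al(2) by auto
  have "b - \<alpha> \<in> cideal D f \<longleftrightarrow> b - a \<in> cideal D f" for b
    using is_ideal_add[OF cideal_is_ideal, of "b - a" "a - \<alpha>"]
      is_ideal_diff[OF cideal_is_ideal, of "b - \<alpha>" "a - \<alpha>"] a(2) by auto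
  then show "g = {b \<in> OK D. b - a \<in> cideal D f}" unfolding al(3) by simp
qed

lemma cm_act_coset:
  assumes a: "a \<in> OK D" "g = {b \<in> OK D. b - a \<in> cideal D f}" and y: "y \<in> dual"
  shows "cm_act f A B C z g (coset y) = {y' \<in> dual. om y' - a * om y \<in> cL}"
proof (intro equalityI subsetI)
  fix y' assume "y' \<in> cm_act f A B C z g (coset y)"
  then obtain x b where xb: "y' \<in> dual" "x \<in> coset y" "b \<in> g" "om y' - b * om x \<in> cL"
    unfolding cm_act_def Omega_om om_std by blast
  have x: "x \<in> dual" "om x - om y \<in> cL" using xb(2) y by (auto simp: coset_eq)
  have b: "b - a \<in> cideal D f" using xb(3) a(2) by simp
  have "om y' - a * om y = (om y' - b * om x) + (b - a) * om x + a * (om x - om y)"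
    by (simp add: algebra_simps)
  also have "\<dots> \<in> cL"
    using xb x b a by (intro cL_add cL_OK_mult cideal_mult_latt) (auto simp: om_mem_iff)
  finally show "y' \<in> {y' \<in> dual. om y' - a * om y \<in> cL}" using xb by simp
next
  fix y' assume y': "y' \<in> {y' \<in> dual. om y' - a * om y \<in> cL}"
  have "y \<in> coset y" using y by (simp add: coset_eq)
  moreover have "a \<in> g" using a is_ideal_0[OF cideal_is_ideal] by simp
  ultimately show "y' \<in> cm_act f A B C z g (coset y)"
    using y' unfolding cm_act_def Omega_om om_std by blast
qed

text \<open>With \<open>r\<close> an inverse of \<open>a\<close> modulo the ideal, the preimage is
  the coset of a vector \<open>y1\<close> lifting \<open>r * om y0\<close>.\<close>

lemma cm_act_inv_coset:
  assumes a: "a \<in> OK D" "coprime_elt D a (cideal D f)" "g = {b \<in> OK D. b - a \<in> cideal D f}"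
    and y0: "y0 \<in> dual"
  obtains y1 where "y1 \<in> dual" "a * om y1 - om y0 \<in> cL" "cm_act_inv f A B C z g (coset y0) = coset y1"
proof -
  obtain r c where rc: "r \<in> OK D" "c \<in> cideal D f" "a * r + c = 1" using a(2) unfolding coprime_elt_iff by blast
  have "r * om y0 \<in> latt z" using latt_OK_mult[OF rc(1)] y0 by (simp add: om_mem_iff)
  then obtain y1 where y1: "y1 \<in> dual" "om y1 = r * om y0" by (rule om_surj)
  have "a * om y1 - om y0 = (a * r + c) * om y0 - c * om y0 - om y0" unfolding y1 by (simp add: algebra_simps)
  also have "\<dots> = - (c * om y0)" unfolding rc(3) by simp
  also have "\<dots> \<in> cL" using cideal_mult_latt[OF rc(2)] y0 by (intro cL_uminus) (simp add: om_mem_iff)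
  finally have 1: "a * om y1 - om y0 \<in> cL" .
  have "cm_act f A B C z g (coset y) = coset y0 \<longleftrightarrow> om y - om y1 \<in> cL" if y: "y \<in> dual" for y
  proof -
    have "a * om y \<in> latt z" using latt_OK_mult[OF a(1)] y by (simp add: om_mem_iff)
    then obtain y2 where y2: "y2 \<in> dual" "om y2 = a * om y" by (rule om_surj)
    have "cm_act f A B C z g (coset y) = coset y2"
      using cm_act_coset[OF a(1,3) y] y2 by (simp add: coset_eq)
    then have "cm_act f A B C z g (coset y) = coset y0 \<longleftrightarrow> a * om y - om y0 \<in> cL"
      using y2 y0 by (simp add: coset_eq_iff)
    also have "\<dots> \<longleftrightarrow> om y - om y1 \<in> cL"
    proof
      assume *: "a * om y - om y0 \<in> cL"
      have "om y - om y1 = (a * r + c) * om y - r * om y0" unfolding rc(3) y1 by simp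
      also have "\<dots> = r * (a * om y - om y0) + c * om y" by (simp add: algebra_simps)
      also have "\<dots> \<in> cL" using * rc y by (intro cL_add cL_OK_mult cideal_mult_latt) (auto simp: om_mem_iff)
      finally show "om y - om y1 \<in> cL" .
    next
      assume *: "om y - om y1 \<in> cL"
      have "a * om y - om y0 = a * (om y - om y1) + (a * om y1 - om y0)" by (simp add: algebra_simps)
      also have "\<dots> \<in> cL" using * 1 a(1) by (intro cL_add cL_OK_mult)
      finally show "a * om y - om y0 \<in> cL" .
    qed
    finally show ?thesis .
  qed
  then have "cm_act_inv f A B C z g (coset y0) = coset y1"
    unfolding cm_act_inv_def coset_eq[OF y1(1)] by blast
  then show ?thesis using that y1(1) 1 by blast
qed

text \<open>Injectivity holds because \<open>\<beta>\<close> is recovered by letting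
  \<open>g\<close> act on any vector of its preimage; the discriminant group is finite, so
  bijectivity follows.\<close>

lemma cm_act_inv_bij:
  assumes g: "g \<in> cm_group D (cideal D f)"
  shows "bij_betw (cm_act_inv f A B C z g) disc_group disc_group"
proof -
  note r = cm_group_rep[OF g]
  have ex: "\<exists>y1\<in>dual. cm_act_inv f A B C z g \<beta> = coset y1" if b: "\<beta> \<in> disc_group" for \<beta>
  proof -
    obtain y0 where "y0 \<in> dual" "\<beta> = coset y0" using b by (auto simp: disc_grp_def)
    then show ?thesis using cm_act_inv_coset[OF r, of y0] by blast
  qed
  have "inj_on (cm_act_inv f A B C z g) disc_group"
  proof (rule inj_onI)
    fix \<beta> \<gamma> assume bg: "\<beta> \<in> disc_group" "\<gamma> \<in> disc_group"
      "cm_act_inv f A B C z g \<beta> = cm_act_inv f A B C z g \<gamma>"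
    obtain y1 where y1: "y1 \<in> dual" "cm_act_inv f A B C z g \<beta> = coset y1" using ex[OF bg(1)] by blast
    have "y1 \<in> coset y1" using y1 by (simp add: coset_eq)
    then have "y1 \<in> cm_act_inv f A B C z g \<beta>" "y1 \<in> cm_act_inv f A B C z g \<gamma>" using y1 bg(3) by auto
    then show "\<beta> = \<gamma>" unfolding cm_act_inv_def by auto
  qed
  moreover have "cm_act_inv f A B C z g ` disc_group \<subseteq> disc_group"
    using ex by (auto simp: disc_grp_def)
  ultimately show ?thesis using finite_disc_group by (simp add: bij_betw_def endo_inj_surj)
qed

text \<open>The eigenvector condition absorbs \<open>ch\<close> at \<open>g\<close> into moving the
  argument of \<open>k\<close> by the inverse of \<open>g\<close>. As this motion permutes the
  cosets, every \<open>g\<close> contributes the same sum.\<close>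

lemma twisted_sum:
  assumes k: "periodic k"
    and eig: "\<And>a x. a \<in> OK D \<Longrightarrow> coprime_elt D a (cideal D f) \<Longrightarrow> x \<in> latt z \<Longrightarrow> ch a * k (a * x) = k x"
  shows "(\<Sum>\<beta>\<in>disc_group. cls_val k \<beta> * twisted D f A B C z ch \<tau> \<beta>)
     = of_nat (card (cm_group D (cideal D f))) * (\<Sum>\<beta>\<in>disc_group. cls_val k \<beta> * theta_fa D f A B C z \<tau> \<beta>)"
proof -
  let ?G = "cm_group D (cideal D f)" and ?T = "theta_fa D f A B C z \<tau>"
  have tr: "cls_val k \<beta> * char_cls ch g = cls_val k (cm_act_inv f A B C z g \<beta>)"
    if g: "g \<in> ?G" and b: "\<beta> \<in> disc_group" for g \<beta>
  proof -
    note r = cm_group_rep[OF g]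
    define a where "a = (SOME a. a \<in> g)"
    obtain y0 where y0: "y0 \<in> dual" "\<beta> = coset y0" using b by (auto simp: disc_grp_def)
    obtain y1 where y1: "y1 \<in> dual" "a * om y1 - om y0 \<in> cL" "cm_act_inv f A B C z g \<beta> = coset y1"
      using cm_act_inv_coset[OF r y0(1)] unfolding y0(2) a_def by blast
    have m: "om y1 \<in> latt z" "om y0 \<in> latt z" using y0 y1 by (simp_all add: om_mem_iff)
    have "k (a * om y1) = k (om y0)"
      using k y1(2) m latt_OK_mult[OF r(1), of "om y1"] unfolding periodic_def a_def by blast
    moreover have "ch a * k (a * om y1) = k (om y1)" using eig[OF r(1,2) m(1)] by (simp add: a_def)
    ultimately show ?thesis
      using y0 y1 k by (simp add: cls_val_coset char_cls_def mult.commute flip: a_def)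
  qed
  have "(\<Sum>\<beta>\<in>disc_group. cls_val k \<beta> * twisted D f A B C z ch \<tau> \<beta>)
    = (\<Sum>\<beta>\<in>disc_group. \<Sum>g\<in>?G. cls_val k (cm_act_inv f A B C z g \<beta>) * ?T (cm_act_inv f A B C z g \<beta>))"
    unfolding twisted_def sum_distrib_left mult.assoc[symmetric] by (intro sum.cong refl) (simp add: tr)
  also have "\<dots> = (\<Sum>g\<in>?G. \<Sum>\<beta>\<in>disc_group. cls_val k (cm_act_inv f A B C z g \<beta>) * ?T (cm_act_inv f A B C z g \<beta>))"
    by (rule sum.swap)
  also have "\<dots> = (\<Sum>g\<in>?G. \<Sum>\<beta>\<in>disc_group. cls_val k \<beta> * ?T \<beta>)"
    by (intro sum.cong refl sum.reindex_bij_betw[OF cm_act_inv_bij])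
  also have "\<dots> = of_nat (card ?G) * (\<Sum>\<beta>\<in>disc_group. cls_val k \<beta> * ?T \<beta>)" by simp
  finally show ?thesis .
qed

end


section \<open>Convergence of the lattice sums\<close>

lemma summable_on_int_power_abs:
  fixes q :: real assumes "0 < q" "q < 1"
  shows "(\<lambda>n::int. q ^ nat \<bar>n\<bar>) summable_on UNIV"
proof -
  have geo: "(\<lambda>n. q ^ n) summable_on UNIV"
    using assms by (intro norm_summable_imp_summable_on) (simp add: summable_geometric_iff)
  have 1: "(\<lambda>n::int. q ^ nat \<bar>n\<bar>) summable_on range int"
    by (subst summable_on_reindex) (auto simp: o_def geo)
  have 2: "(\<lambda>n::int. q ^ nat \<bar>n\<bar>) summable_on range (\<lambda>n. - int n)"
    by (subst summable_on_reindex) (auto simp: o_def geo inj_def)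
  have "(\<lambda>n::int. q ^ nat \<bar>n\<bar>) summable_on range int \<union> (range (\<lambda>n. - int n) - range int)"
    by (intro summable_on_Un_disjoint 1 summable_on_subset_banach[OF 2]) auto
  moreover have "range int \<union> (range (\<lambda>n. - int n) - range int) = UNIV"
    by (auto simp: image_iff) (metis int_cases2)
  ultimately show ?thesis by simp
qed

lemma summable_on_int2_power_abs:
  fixes q :: real assumes "0 < q" "q < 1"
  shows "(\<lambda>(m::int, n::int). q ^ nat \<bar>m\<bar> * q ^ nat \<bar>n\<bar>) summable_on UNIV"
proof -
  note s = summable_on_int_power_abs[OF assms]
  let ?S = "infsum (\<lambda>n::int. q ^ nat \<bar>n\<bar>) UNIV"
  have "(\<lambda>(m::int, n::int). q ^ nat \<bar>m\<bar> * q ^ nat \<bar>n\<bar>) summable_on (SIGMA m:UNIV. UNIV)"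
  proof (rule summable_on_SigmaI[where g = "\<lambda>m. q ^ nat \<bar>m\<bar> * ?S"])
    show "((\<lambda>n. case (m, n) of (m, n) \<Rightarrow> q ^ nat \<bar>m\<bar> * q ^ nat \<bar>n\<bar>) has_sum q ^ nat \<bar>m\<bar> * ?S) UNIV" for m :: int
      using has_sum_cmult_right[OF has_sum_infsum[OF s]] by simp
    show "(\<lambda>m::int. q ^ nat \<bar>m\<bar> * ?S) summable_on UNIV" by (intro summable_on_cmult_left s)
  qed (use assms in auto)
  then show ?thesis by simp
qed

text \<open>From \<open>r \<le> exp r\<close> and the square
  \<open>(s r - 1)^2 / s = s r^2 - 2 r + 1 / s\<close>, which is nonnegative.\<close>

lemma gauss_tail_bound:
  fixes r s :: real assumes "s > 0" "r \<ge> 0"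
  shows "r * exp (- (s * r\<^sup>2)) \<le> exp (1 / s) * exp (- r)"
proof -
  have "r \<le> exp r" using exp_ge_add_one_self[of r] by linarith
  then have "r * exp (- (s * r\<^sup>2)) \<le> exp r * exp (- (s * r\<^sup>2))" by (intro mult_right_mono) auto
  also have "\<dots> = exp (r - s * r\<^sup>2)" by (simp flip: exp_add)
  also have "\<dots> \<le> exp (1 / s - r)"
  proof -
    have "0 \<le> (s * r - 1)\<^sup>2 / s" using assms by simp
    also have "\<dots> = s * r\<^sup>2 - 2 * r + 1 / s" using assms by (simp add: power2_eq_square field_simps)
    finally show ?thesis by simp
  qed
  also have "\<dots> = exp (1 / s) * exp (- r)" by (simp flip: exp_add)
  finally show ?thesis .
qed

context cm_lattice begin

lemma latt_coeff_bound:
  obtains c where "c > 0" "\<And>m n :: int. \<bar>real_of_int m\<bar> + \<bar>real_of_int n\<bar> \<le> c * cmod (of_int m + of_int n * z)"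
proof -
  \<comment> \<open>The imaginary part bounds \<open>|n|\<close> by \<open>|x| / Im z\<close>, and
    the triangle inequality then bounds \<open>|m|\<close> by \<open>|x| * (1 + |z| / Im z)\<close>;
    \<open>c\<close> is the sum of both factors.\<close>
  define c where "c = 1 + (1 + cmod z) / Im z"
  have c: "c > 0" unfolding c_def using Im_z by (intro add_pos_nonneg) auto
  have "\<bar>real_of_int m\<bar> + \<bar>real_of_int n\<bar> \<le> c * cmod (of_int m + of_int n * z)" for m n :: int
  proof -
    let ?x = "of_int m + of_int n * z"
    have "\<bar>of_int n\<bar> * Im z = \<bar>Im ?x\<bar>" using Im_z by (simp add: abs_mult)
    also have "\<dots> \<le> cmod ?x" by (rule abs_Im_le_cmod)
    finally have n: "\<bar>of_int n\<bar> \<le> cmod ?x / Im z" using Im_z by (simp add: field_simps)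
    have "cmod (of_int m) = cmod (?x - of_int n * z)" by simp
    also have "\<dots> \<le> cmod ?x + \<bar>of_int n\<bar> * cmod z"
      using norm_triangle_ineq4[of ?x "of_int n * z"] by (simp add: norm_mult)
    also have "\<dots> \<le> cmod ?x + cmod ?x / Im z * cmod z"
      using n by (intro add_left_mono mult_right_mono) auto
    finally have m: "\<bar>of_int m\<bar> \<le> cmod ?x + cmod ?x / Im z * cmod z" by simp
    have "c * cmod ?x = cmod ?x + cmod ?x / Im z * cmod z + cmod ?x / Im z"
      unfolding c_def using Im_z by (simp add: field_simps)
    then show ?thesis using m n by linarith
  qed
  then show ?thesis using that c by blast
qed

lemma norm_gterm: "norm (gterm \<tau> x) = cmod x * exp (- (2 * pi * Im \<tau> * of_int A * (cmod x)\<^sup>2))"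
proof -
  have "Re (2 * pi * \<i> * \<tau> * of_real (of_int A * (cmod x)\<^sup>2)) = - (2 * pi * Im \<tau> * of_int A * (cmod x)\<^sup>2)"
    by simp
  then show ?thesis unfolding gterm_def norm_mult norm_exp_eq_Re by (simp only:)
qed

lemma gterm_summable:
  assumes "Im \<tau> > 0" shows "gterm \<tau> summable_on latt z"
proof -
  define s where "s = 2 * pi * Im \<tau> * of_int A"
  have s: "s > 0" unfolding s_def using assms A_pos by simp
  obtain c where c: "c > 0" "\<And>m n :: int. \<bar>real_of_int m\<bar> + \<bar>real_of_int n\<bar> \<le> c * cmod (of_int m + of_int n * z)"
    by (rule latt_coeff_bound) blast
  \<comment> \<open>With this ratio \<open>exp (- |x|)\<close> is at most
    \<open>q ^ |m| * q ^ |n|\<close>, so a product of two geometric series dominates the lattice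
    sum.\<close>
  define q where "q = exp (- (1 / c))"
  have q: "0 < q" "q < 1" unfolding q_def using c by auto
  define e where "e = (\<lambda>p::int \<times> int. of_int (fst p) * 1 + of_int (snd p) * z)"
  have bound: "norm (gterm \<tau> (e p)) \<le> exp (1 / s) * (case p of (m, n) \<Rightarrow> q ^ nat \<bar>m\<bar> * q ^ nat \<bar>n\<bar>)" for p
  proof -
    obtain m n where p: "p = (m, n)" by fastforce
    let ?x = "of_int m + of_int n * z"
    have "norm (gterm \<tau> ?x) = cmod ?x * exp (- (s * (cmod ?x)\<^sup>2))" unfolding norm_gterm s_def ..
    also have "\<dots> \<le> exp (1 / s) * exp (- cmod ?x)" using s by (intro gauss_tail_bound) auto
    also have "\<dots> \<le> exp (1 / s) * exp (- ((\<bar>real_of_int m\<bar> + \<bar>real_of_int n\<bar>) / c))"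
      using c(1) c(2)[of m n] by (simp add: field_simps)
    also have "- ((\<bar>real_of_int m\<bar> + \<bar>real_of_int n\<bar>) / c) = real (nat \<bar>m\<bar>) * (- (1 / c)) + real (nat \<bar>n\<bar>) * (- (1 / c))"
      by (simp add: add_divide_distrib)
    also have "exp \<dots> = q ^ nat \<bar>m\<bar> * q ^ nat \<bar>n\<bar>"
      unfolding exp_add exp_of_nat_mult q_def ..
    finally show ?thesis by (simp add: p e_def)
  qed
  have "(\<lambda>p. exp (1 / s) * (case p of (m, n) \<Rightarrow> q ^ nat \<bar>m\<bar> * q ^ nat \<bar>n\<bar>)) summable_on UNIV"
    by (intro summable_on_cmult_right summable_on_int2_power_abs q)
  then have "(\<lambda>p. norm (gterm \<tau> (e p))) summable_on UNIV"
    by (rule Infinite_Sum.abs_summable_on_comparison_test') (rule bound)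
  then have "(\<lambda>p. gterm \<tau> (e p)) summable_on UNIV" by (rule abs_summable_summable)
  moreover have "inj e"
  proof (rule injI)
    fix p p' assume "e p = e p'"
    then have "fst p = fst p' \<and> snd p = snd p'"
      unfolding e_def by (rule lat2_coords_unique_int[OF latt_ind])
    then show "p = p'" by (simp add: prod_eq_iff)
  qed
  ultimately have "gterm \<tau> summable_on range e" by (subst summable_on_reindex) (auto simp: o_def)
  then show ?thesis unfolding latt_lat2 lat2_range e_def .
qed

end


section \<open>Hecke characters\<close>

text \<open>Two powers with different exponents coincide. Exponents start at 1, so that the lemma
  can be applied without evaluating anything at a neutral element.\<close>

lemma powers_in_finite_set:
  fixes x :: real assumes "finite S" "x > 0" "\<And>n. x ^ Suc n \<in> S" shows "x = 1"
proof -
  have "finite (range (\<lambda>n. x ^ Suc n))" by (rule finite_subset[OF _ assms(1)]) (use assms(3) in auto)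
  then have "\<not> inj (\<lambda>n. x ^ Suc n)" using finite_imageD infinite_UNIV_nat by blast
  then obtain m n where mn: "m < n" "x ^ Suc m = x ^ Suc n"
    unfolding inj_def by (metis linorder_neqE_nat)
  have "x ^ Suc n = x ^ Suc m * x ^ (n - m)" using mn(1) by (simp flip: power_add)
  then have "x ^ (n - m) = 1 ^ (n - m)" using mn(2) assms(2) by simp
  then show ?thesis by (rule power_eq_imp_eq_base) (use mn(1) assms(2) in auto)
qed

context quad_order begin

lemma princ_mult: "idl_mult (princ D a) (princ D b) = princ D (a * b)"
proof
  show "idl_mult (princ D a) (princ D b) \<subseteq> princ D (a * b)"
  proof (rule idl_mult_least)
    show "0 \<in> princ D (a * b)" unfolding princ_def by (rule image_eqI[of _ _ 0]) auto
    show "x + y \<in> princ D (a * b)" if "x \<in> princ D (a * b)" "y \<in> princ D (a * b)" for x y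
      using that OK_add unfolding princ_def image_iff by (metis distrib_left)
    fix x y assume "x \<in> princ D a" "y \<in> princ D b"
    then obtain r s where rs: "r \<in> OK D" "s \<in> OK D" "x = a * r" "y = b * s" by (auto simp: princ_def)
    then have "x * y = a * b * (r * s)" by simp
    then show "x * y \<in> princ D (a * b)" using OK_mult[OF rs(1,2)] unfolding princ_def by blast
  qed
  show "princ D (a * b) \<subseteq> idl_mult (princ D a) (princ D b)"
  proof
    fix w assume "w \<in> princ D (a * b)"
    then obtain r where r: "r \<in> OK D" "w = a * b * r" by (auto simp: princ_def)
    have "a * 1 \<in> princ D a" "b * r \<in> princ D b" using r(1) unfolding princ_def by (auto intro: imageI)
    then have "(a * 1) * (b * r) \<in> idl_mult (princ D a) (princ D b)" by (rule idl_mult_prod)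
    then show "w \<in> idl_mult (princ D a) (princ D b)" by (simp add: r mult.assoc)
  qed
qed

lemma princ_eq_cmod:
  assumes "princ D a = princ D b" "b \<noteq> 0" shows "cmod a = cmod b"
proof -
  have mem: "c \<in> princ D c" for c unfolding princ_def by (rule image_eqI[of _ _ 1]) auto
  have "a \<in> princ D b" "b \<in> princ D a" using mem[of a] mem[of b] assms(1) by auto
  then obtain r s where rs: "r \<in> OK D" "s \<in> OK D" "a = b * r" "b = a * s" unfolding princ_def by blast
  then have "b * (r * s) = b * 1" by (metis mult.assoc mult.right_neutral)
  then have "r * s = 1" using assms(2) by (metis mult_left_cancel)
  then have "r \<in> units_OK D" using rs by (auto simp: units_OK_def)
  then show ?thesis using rs(3) unit_cmod by (simp add: norm_mult)
qed

lemma ideal_pos_int: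
  assumes "int_ideal D I" obtains u :: int where "u > 0" "of_int u \<in> I"
  using ideal_basis[OF assms] lat2_basis(1) by metis

text \<open>The powers of \<open>a\<close> meet only finitely many residue classes modulo
  \<open>m\<close>, so the powers of \<open>cmod (ch a)\<close> form a finite set.\<close>

lemma char_mod_unimodular:
  assumes m: "int_ideal D m" and ch: "char_mod D m ch" and a: "a \<in> OK D" "coprime_elt D a m"
  shows "cmod (ch a) = 1"
proof -
  have I: "is_ideal D m" using m by (simp add: int_ideal_def)
  obtain u :: int where u: "u > 0" "of_int u \<in> m" by (rule ideal_pos_int[OF m])
  \<comment> \<open>The positive integer \<open>u\<close> lies in \<open>m\<close>, so both
    coordinates can be reduced modulo \<open>u\<close> without leaving the residue class.\<close>
  let ?R = "(\<lambda>(i, j). of_int i + of_int j * omegaK D) ` ({0..<u} \<times> {0..<u})"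
  \<comment> \<open>The exponent 0 is left out of the last clause because \<open>char_mod\<close>
    does not state that \<open>ch 1 = 1\<close>.\<close>
  have pw: "a ^ n \<in> OK D \<and> coprime_elt D (a ^ n) m \<and> (n > 0 \<longrightarrow> ch (a ^ n) = ch a ^ n)" for n
  proof (induction n)
    case 0
    then show ?case by (simp add: coprime_elt_1[OF I])
  next
    case (Suc n)
    have "ch (a * a ^ n) = ch a * ch (a ^ n)" using ch a Suc unfolding char_mod_def by blast
    then show ?case
      using Suc a coprime_elt_mult_iff[OF I a(1), of "a ^ n"] OK_mult[OF a(1), of "a ^ n"]
      by (cases n) auto
  qed
  have "cmod (ch a) ^ Suc n \<in> (\<lambda>r. cmod (ch r)) ` ?R" for n
  proof -
    obtain i j where ij: "a ^ Suc n = of_int i + of_int j * omegaK D" using pw[of "Suc n"] by (auto simp: OK_def)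
    let ?r = "of_int (i mod u) + of_int (j mod u) * omegaK D"
    have "of_int i - of_int (i mod u) = (of_int (i div u) * of_int u :: complex)"
      "of_int j - of_int (j mod u) = (of_int (j div u) * of_int u :: complex)"
      by (simp_all flip: of_int_diff of_int_mult add: minus_mod_eq_div_mult)
    then have "a ^ Suc n - ?r = (of_int (i div u) + of_int (j div u) * omegaK D) * of_int u"
      unfolding ij by (simp add: algebra_simps)
    also have "\<dots> \<in> m" by (intro is_ideal_mult[OF I] u OK_I)
    finally have d: "a ^ Suc n - ?r \<in> m" .
    have r: "?r \<in> OK D" by (rule OK_I)
    have "coprime_elt D ?r m" using coprime_elt_cong[OF I _ r d] pw by blast
    then have "ch (a ^ Suc n) = ch ?r" using ch pw[of "Suc n"] r d unfolding char_mod_def by blast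
    then have "cmod (ch a) ^ Suc n = cmod (ch ?r)" using pw[of "Suc n"] by (simp add: norm_power[symmetric] del: power_Suc)
    moreover have "?r \<in> ?R" using u by (auto intro!: image_eqI[of _ _ "(i mod u, j mod u)"])
    ultimately show ?thesis by blast
  qed
  moreover have "cmod (ch a) > 0" using ch a unfolding char_mod_def by auto
  moreover have "finite ((\<lambda>r. cmod (ch r)) ` ?R)" by simp
  ultimately show ?thesis using powers_in_finite_set by blast
qed

lemma coprime_ideals_mono: "coprime_ideals I m \<Longrightarrow> I \<subseteq> J \<Longrightarrow> m \<subseteq> n \<Longrightarrow> coprime_ideals J n"
  unfolding coprime_ideals_def by blast

end

context cm_form begin

text \<open>The conjugate ideal is \<open>y b\<close> with \<open>y = A * cnj x\<close>, so this is
  an instance of the product formula. It is the source of multiplicativity of the ideal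
  norm.\<close>

lemma inv_ideal_norm_princ:
  "idl_mult (inv_ideal A z x) (cnj ` inv_ideal A z x) = princ D (of_real (of_int A * (cmod x)\<^sup>2))"
proof -
  have "cnj ` inv_ideal A z x = (\<lambda>t. (of_int A * cnj x) * t) ` latt z"
    unfolding inv_ideal_def image_image by (simp add: mult.commute)
  moreover have "x * (of_int A * cnj x) = of_real (of_int A * (cmod x)\<^sup>2)"
    using complex_norm_square[of x] by (simp add: mult.commute mult.left_commute)
  ultimately show ?thesis using inv_ideal_mult_scaled[of x "of_int A * cnj x"] by (simp only:)
qed

end


section \<open>Ideal classes, base points and the values of the Hecke character\<close>

locale hecke_theta_setup =
  fixes D :: int and f h :: nat and z :: "nat \<Rightarrow> complex" and A B C :: "nat \<Rightarrow> int"
    and ch ch' :: "complex \<Rightarrow> complex" and \<phi> :: "complex set \<Rightarrow> complex" and cf :: "complex set"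
  assumes K: "fundamental_disc D" "D < 0"
    and f_pos: "f > 0"
    and reps_CM: "\<forall>a\<in>{1..h}. Im (z a) > 0 \<and> has_CM_OK D (latt (z a))"
    and reps_distinct: "\<forall>a\<in>{1..h}. \<forall>b\<in>{1..h}. a \<noteq> b \<longrightarrow> \<not> homothetic (latt (z a)) (latt (z b))"
    and reps_all: "\<forall>w. Im w > 0 \<longrightarrow> has_CM_OK D (latt w) \<longrightarrow>
                      (\<exists>a\<in>{1..h}. homothetic (latt w) (latt (z a)))"
    and forms: "\<forall>a\<in>{1..h}. A a > 0 \<and> gcd (gcd (A a) (B a)) (C a) = 1 \<and>
                  of_int (A a) * (z a)\<^sup>2 + of_int (B a) * z a + of_int (C a) = 0"
    and chi_char: "char_mod D (cideal D f) ch"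
    and cf_ideal: "int_ideal D cf" "ideal_dvd D cf (cideal D f)"
    and phi_mult: "\<forall>I J. int_ideal D I \<longrightarrow> int_ideal D J \<longrightarrow> coprime_ideals I cf \<longrightarrow>
                     coprime_ideals J cf \<longrightarrow> \<phi> (idl_mult I J) = \<phi> I * \<phi> J"
    and phi_nonzero: "\<forall>I. int_ideal D I \<longrightarrow> coprime_ideals I cf \<longrightarrow> \<phi> I \<noteq> 0"
    and chi'_char: "char_mod D cf ch'"
    and phi_princ: "\<forall>\<alpha>\<in>OK D. coprime_elt D \<alpha> cf \<longrightarrow> \<phi> (princ D \<alpha>) = \<alpha> * ch' \<alpha>"
    and pullback: "\<forall>\<alpha>\<in>OK D. coprime_elt D \<alpha> (cideal D f) \<longrightarrow> ch' \<alpha> = inverse (ch \<alpha>)"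
begin

sublocale quad_order D
  by (rule fundamental_disc_quad_order[OF K])

lemma cm_lattice_rep:
  assumes "a \<in> {1..h}" shows "cm_lattice D (A a) (B a) (C a) (z a) f"
proof -
  have "cm_form D (A a) (B a) (C a) (z a)"
    by (rule cm_form_of_CM) (use assms forms reps_CM quad_order_axioms in blast)+
  then show ?thesis using f_pos by (simp only: cm_lattice_def cm_lattice_axioms_def)
qed

abbreviation "cls_ideal a \<equiv> inv_ideal (A a) (z a)"

lemma cf_is_ideal: "is_ideal D cf"
  using cf_ideal(1) by (simp add: int_ideal_def)

lemma cideal_sub_cf: "cideal D f \<subseteq> cf"
  using cf_ideal(2) idl_mult_subset[OF cf_is_ideal] by (auto simp: ideal_dvd_def int_ideal_def)

text \<open>The ideals \<open>cls_ideal a x\<close> are multiples of conjugate lattices; hence the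
  conjugate of \<open>I\<close> is written as a scaled lattice and compared with the
  representatives.\<close>

lemma ideal_classify:
  assumes "int_ideal D I"
  shows "\<exists>a x. a \<in> {1..h} \<and> x \<in> latt (z a) \<and> x \<noteq> 0 \<and> I = cls_ideal a x"
proof -
  obtain t w where tw: "t \<noteq> 0" "Im w > 0" "has_CM_OK D (latt w)" "cnj ` I = (\<lambda>x. t * x) ` latt w"
    using ideal_CM[OF K(1) cnj_int_ideal[OF assms]] by blast
  obtain a s where a: "a \<in> {1..h}" and s: "s \<noteq> 0" "latt (z a) = (\<lambda>x. s * x) ` latt w"
    using reps_all tw by (auto simp: homothetic_def)
  interpret cm_lattice D "A a" "B a" "C a" "z a" f by (rule cm_lattice_rep[OF a])
  \<comment> \<open>Solves \<open>x * A * cnj (s * r) = cnj (t * r)\<close> for all \<open>r\<close>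
    in \<open>latt w\<close>.\<close>
  define x where "x = cnj (t / s) / of_int (A a)"
  have xA: "x * of_int (A a) = cnj (t / s)" using A_pos by (simp add: x_def)
  have "cls_ideal a x = (\<lambda>r. cnj (t / s) * cnj (s * r)) ` latt w"
    unfolding inv_ideal_def xA s(2) image_image ..
  also have "\<dots> = cnj ` (\<lambda>r. t * r) ` latt w" unfolding image_image using s(1) by simp
  also have "\<dots> = I" unfolding tw(4)[symmetric] by (simp add: image_image)
  finally have I: "cls_ideal a x = I" .
  have "x \<in> latt (z a)"
  proof (rule mem_latt_of_inv)
    fix r assume "r \<in> latt (z a)"
    then have "x * of_int (A a) * cnj r \<in> I" unfolding I[symmetric] inv_ideal_def by blast
    then show "x * of_int (A a) * cnj r \<in> OK D" using assms by (auto simp: int_ideal_def is_ideal_def)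
  qed
  moreover have "x \<noteq> 0" using tw(1) s(1) A_pos by (simp add: x_def)
  ultimately show ?thesis using a I by blast
qed

lemma cls_ideal_class_unique:
  assumes ab: "a \<in> {1..h}" "b \<in> {1..h}" and nz: "x \<noteq> 0" "y \<noteq> 0"
    and eq: "cls_ideal a x = cls_ideal b y"
  shows "a = b"
proof (rule ccontr)
  assume ne: "a \<noteq> b"
  have pos: "A a > 0" "A b > 0" using forms ab by auto
  define t where "t = cnj (x * of_int (A a) / (y * of_int (A b)))"
  have t0: "t \<noteq> 0" using nz pos by (simp add: t_def)
  have "latt (z b) = (\<lambda>w. cnj (w / (y * of_int (A b)))) ` cls_ideal b y"
    unfolding inv_ideal_def image_image using nz pos by simp
  also have "\<dots> = (\<lambda>x. t * x) ` latt (z a)"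
    unfolding eq[symmetric] unfolding inv_ideal_def image_image t_def by simp
  finally have "homothetic (latt (z a)) (latt (z b))" using t0 by (auto simp: homothetic_def)
  then show False using reps_distinct ab ne by blast
qed

lemma cls_ideal_int_ideal: "a \<in> {1..h} \<Longrightarrow> x \<in> latt (z a) \<Longrightarrow> x \<noteq> 0 \<Longrightarrow> int_ideal D (cls_ideal a x)"
  using cm_form.inv_ideal_int_ideal cm_lattice_rep cm_lattice_def by blast

lemma cls_ideal_norm: "a \<in> {1..h} \<Longrightarrow> x \<in> latt (z a) \<Longrightarrow> x \<noteq> 0 \<Longrightarrow>
    real (ideal_norm D (cls_ideal a x)) = of_int (A a) * (cmod x)\<^sup>2"
  using cm_form.ideal_norm_inv_ideal cm_lattice_rep cm_lattice_def by blast

lemma ideal_norm_princ: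
  assumes "int_ideal D I"
  shows "idl_mult I (cnj ` I) = princ D (of_real (real (ideal_norm D I)))" "ideal_norm D I > 0"
proof -
  obtain a x where ax: "a \<in> {1..h}" "x \<in> latt (z a)" "x \<noteq> 0" "I = cls_ideal a x"
    using ideal_classify[OF assms] by blast
  interpret cm_lattice D "A a" "B a" "C a" "z a" f by (rule cm_lattice_rep[OF ax(1)])
  show "idl_mult I (cnj ` I) = princ D (of_real (real (ideal_norm D I)))"
    unfolding cls_ideal_norm[OF ax(1-3)] ax(4) by (rule inv_ideal_norm_princ)
  have "real (ideal_norm D I) > 0" unfolding ax(4) cls_ideal_norm[OF ax(1-3)] using A_pos ax(3) by simp
  then show "ideal_norm D I > 0" by simp
qed

text \<open>Multiplying by conjugates, both sides generate the same principal ideal. Generators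
  differ by a unit, whose modulus is 1, and norms are positive.\<close>

lemma ideal_norm_mult:
  assumes "int_ideal D I" "int_ideal D J"
  shows "ideal_norm D (idl_mult I J) = ideal_norm D I * ideal_norm D J"
proof -
  note IJ = int_ideal_idl_mult[OF assms]
  have "princ D (of_real (real (ideal_norm D (idl_mult I J)))) = idl_mult (idl_mult I J) (idl_mult (cnj ` I) (cnj ` J))"
    unfolding ideal_norm_princ(1)[OF IJ, symmetric] cnj_idl_mult ..
  also have "\<dots> = idl_mult (idl_mult I (cnj ` I)) (idl_mult J (cnj ` J))"
    by (metis idl_mult_assoc idl_mult_commute)
  also have "\<dots> = princ D (of_real (real (ideal_norm D I)) * of_real (real (ideal_norm D J)))"
    unfolding ideal_norm_princ(1)[OF assms(1)] ideal_norm_princ(1)[OF assms(2)] by (rule princ_mult)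
  finally have "cmod (of_real (real (ideal_norm D (idl_mult I J))))
      = cmod (of_real (real (ideal_norm D I)) * of_real (real (ideal_norm D J)))"
    by (rule princ_eq_cmod) (use ideal_norm_princ(2)[OF assms(1)] ideal_norm_princ(2)[OF assms(2)] in simp)
  then have "real (ideal_norm D (idl_mult I J)) = real (ideal_norm D I * ideal_norm D J)"
    by (simp add: norm_mult)
  then show ?thesis by (simp only: of_nat_eq_iff)
qed

text \<open>A value \<open>q\<close> of the norm form prime to \<open>f |D|\<close> lies both in
  \<open>x b^-1\<close> and in its conjugate, so one \<open>x\<close> makes both of them prime to
  \<open>cf\<close>.\<close>

lemma coprime_base_point:
  assumes a: "a \<in> {1..h}"
  obtains x where "x \<in> latt (z a)" "x \<noteq> 0" "coprime_ideals (cls_ideal a x) cf"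
    "int_ideal D ((\<lambda>t. of_int (A a) * cnj x * t) ` latt (z a))"
    "coprime_ideals ((\<lambda>t. of_int (A a) * cnj x * t) ` latt (z a)) cf"
proof -
  interpret cm_lattice D "A a" "B a" "C a" "z a" f by (rule cm_lattice_rep[OF a])
  \<comment> \<open>This integer is \<open>f * sqrtD D\<close> times \<open>- sqrtD D\<close>, hence
    an element of \<open>cideal D f\<close> and so of \<open>cf\<close>.\<close>
  define M where "M = int f * - D"
  have "M > 0" unfolding M_def using f_pos D_neg by (intro mult_pos_pos) auto
  \<comment> \<open>The factor 2 makes the modulus a nonunit, so that coprimality excludes
    \<open>q = 0\<close>.\<close>
  then have "2 * M \<noteq> 0" by simp
  then obtain x q where x: "x \<in> latt (z a)" "of_int (A a) * cnj x * x = of_int q" and cop: "coprime q (2 * M)"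
    by (rule exists_coprime_scaled)
  have "q \<noteq> 0"
  proof
    assume "q = 0"
    then have "is_unit (2 * M)" using cop by simp
    then show False using \<open>M > 0\<close> by auto
  qed
  then have x0: "x \<noteq> 0" using x(2) by auto
  let ?P = "(\<lambda>t. of_int (A a) * cnj x * t) ` latt (z a)"
  obtain u v where uv: "u * q + v * (2 * M) = 1" using bezout_int[of q "2 * M"] cop by auto
  have 1: "of_int u * of_int q + of_int (v * 2) * of_int M = (1 :: complex)"
    using arg_cong[OF uv, of "of_int :: int \<Rightarrow> complex"] by (simp add: mult.assoc)
  have "of_int M = of_nat f * sqrtD D * (- sqrtD D)"
    using sqrtD_square[OF D_neg] by (simp add: M_def algebra_simps)
  moreover have "- sqrtD D \<in> OK D" by (intro OK_uminus sqrtD_OK)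
  ultimately have "of_int M \<in> cideal D f" unfolding cideal_def princ_def by (rule image_eqI)
  then have Mcf: "of_int (v * 2) * of_int M \<in> cf"
    using cideal_sub_cf by (intro is_ideal_mult[OF cf_is_ideal] OK_of_int) auto
  have cop': "coprime_ideals I cf" if "int_ideal D I" "of_int q \<in> I" for I
  proof -
    have "of_int u * of_int q \<in> I" using that by (intro is_ideal_mult OK_of_int) (auto simp: int_ideal_def)
    then show ?thesis using Mcf 1 unfolding coprime_ideals_def by blast
  qed
  have P: "int_ideal D ?P" by (rule scaled_latt_int_ideal[OF x(1) x0])
  have "of_int q \<in> ?P" unfolding x(2)[symmetric] using x(1) by blast
  then have "coprime_ideals ?P cf" by (rule cop'[OF P])
  moreover have "of_int q \<in> cls_ideal a x"
    unfolding inv_ideal_def by (rule image_eqI[OF _ x(1)]) (simp add: x(2)[symmetric] mult.commute mult.left_commute)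
  then have "coprime_ideals (cls_ideal a x) cf" by (rule cop'[OF inv_ideal_int_ideal[OF x(1) x0]])
  ultimately show ?thesis using that x(1) x0 P by blast
qed

text \<open>The point has two tasks: it defines the integral multiple \<open>y b\<close>, and
  \<open>cls_ideal a (base a)\<close> is the sample ideal on which \<open>norm_Kc\<close> evaluates
  the modulus of \<open>Kc a\<close>.\<close>

definition base :: "nat \<Rightarrow> complex" where
  "base a = (SOME x. x \<in> latt (z a) \<and> x \<noteq> 0 \<and> coprime_ideals (cls_ideal a x) cf \<and>
    int_ideal D ((\<lambda>t. of_int (A a) * cnj x * t) ` latt (z a)) \<and>
    coprime_ideals ((\<lambda>t. of_int (A a) * cnj x * t) ` latt (z a)) cf)"

text \<open>The ideal \<open>y_ideal a = y b\<close> is in the class inverse to that of \<open>cls_ideal a\<close> and prime to the conductor.\<close>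
definition y_pt :: "nat \<Rightarrow> complex" where "y_pt a = of_int (A a) * cnj (base a)"

definition y_ideal :: "nat \<Rightarrow> complex set" where "y_ideal a = (\<lambda>t. y_pt a * t) ` latt (z a)"

lemma base:
  assumes "a \<in> {1..h}"
  shows "base a \<in> latt (z a)" "base a \<noteq> 0" "coprime_ideals (cls_ideal a (base a)) cf"
    "int_ideal D (y_ideal a)" "coprime_ideals (y_ideal a) cf" "y_pt a \<noteq> 0"
proof -
  let ?P = "\<lambda>x. x \<in> latt (z a) \<and> x \<noteq> 0 \<and> coprime_ideals (cls_ideal a x) cf \<and>
    int_ideal D ((\<lambda>t. of_int (A a) * cnj x * t) ` latt (z a)) \<and>
    coprime_ideals ((\<lambda>t. of_int (A a) * cnj x * t) ` latt (z a)) cf"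
  have "\<exists>x. ?P x" using coprime_base_point[OF assms] by blast
  then have P: "?P (base a)" unfolding base_def by (rule someI_ex)
  then show "base a \<in> latt (z a)" "base a \<noteq> 0" "coprime_ideals (cls_ideal a (base a)) cf"
    "int_ideal D (y_ideal a)" "coprime_ideals (y_ideal a) cf"
    by (simp_all add: y_ideal_def y_pt_def)
  have "A a > 0" using forms assms by blast
  then show "y_pt a \<noteq> 0" using P by (simp add: y_pt_def)
qed

text \<open>Extension by zero, so that ideals not prime to the conductor drop out of the theta
  series by themselves.\<close>

definition psi :: "complex \<Rightarrow> complex" where
  "psi \<alpha> = (if coprime_elt D \<alpha> cf then ch' \<alpha> else 0)"

text \<open>Formally the value of \<open>\<phi>\<close> at \<open>b^-1\<close>, expressed through
  the integral ideal \<open>y b\<close>.\<close>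

definition Kc :: "nat \<Rightarrow> complex" where "Kc a = y_pt a / \<phi> (y_ideal a)"

lemma y_mult_OK: "a \<in> {1..h} \<Longrightarrow> x \<in> latt (z a) \<Longrightarrow> x * y_pt a \<in> OK D"
  using base(4)[of a] by (auto simp: int_ideal_def is_ideal_def y_ideal_def mult.commute)

lemma psi_mult:
  assumes "\<alpha> \<in> OK D" "\<beta> \<in> OK D" shows "psi (\<alpha> * \<beta>) = psi \<alpha> * psi \<beta>"
  using chi'_char assms unfolding psi_def char_mod_def by (auto simp: coprime_elt_mult_iff[OF cf_is_ideal])

lemma psi_cong:
  assumes "\<alpha> \<in> OK D" "\<beta> \<in> OK D" "\<alpha> - \<beta> \<in> cf" shows "psi \<alpha> = psi \<beta>"
  using chi'_char assms coprime_elt_cong[OF cf_is_ideal assms] unfolding psi_def char_mod_def by auto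

lemma psi_norm: "\<alpha> \<in> OK D \<Longrightarrow> psi \<alpha> \<noteq> 0 \<Longrightarrow> cmod (psi \<alpha>) = 1"
  using char_mod_unimodular[OF cf_ideal(1) chi'_char] by (auto simp: psi_def split: if_splits)

lemma cls_ideal_y:
  assumes "a \<in> {1..h}" shows "idl_mult (cls_ideal a x) (y_ideal a) = princ D (x * y_pt a)"
proof -
  interpret cm_lattice D "A a" "B a" "C a" "z a" f by (rule cm_lattice_rep[OF assms])
  show ?thesis unfolding y_ideal_def by (rule inv_ideal_mult_scaled)
qed

text \<open>Multiplication by \<open>y b\<close>, which is prime to \<open>cf\<close>, preserves
  coprimality; conversely, the product \<open>(x y)\<close> is contained in
  \<open>x b^-1\<close>.\<close>

lemma coprime_cls_ideal_iff:
  assumes a: "a \<in> {1..h}" and x: "x \<in> latt (z a)" "x \<noteq> 0"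
  shows "coprime_ideals (cls_ideal a x) cf \<longleftrightarrow> coprime_elt D (x * y_pt a) cf"
proof -
  have I: "is_ideal D (cls_ideal a x)" "is_ideal D (y_ideal a)"
    using cls_ideal_int_ideal[OF a x] base(4)[OF a] by (auto simp: int_ideal_def)
  show ?thesis
  proof
    assume "coprime_ideals (cls_ideal a x) cf"
    then show "coprime_elt D (x * y_pt a) cf"
      unfolding coprime_elt_def cls_ideal_y[OF a, symmetric]
      using I base(5)[OF a] by (intro coprime_idl_mult cf_is_ideal) (auto simp: is_ideal_def)
  next
    assume "coprime_elt D (x * y_pt a) cf"
    then show "coprime_ideals (cls_ideal a x) cf"
      unfolding coprime_elt_def cls_ideal_y[OF a, symmetric]
      using idl_mult_subset[OF I] by (rule coprime_ideals_mono) simp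
  qed
qed

lemma phi_cls_ideal:
  assumes a: "a \<in> {1..h}" and x: "x \<in> latt (z a)" "x \<noteq> 0"
  shows "(if coprime_ideals (cls_ideal a x) cf then \<phi> (cls_ideal a x) else 0) = Kc a * (psi (x * y_pt a) * x)"
proof (cases "coprime_ideals (cls_ideal a x) cf")
  case True
  then have cop: "coprime_elt D (x * y_pt a) cf" using coprime_cls_ideal_iff[OF a x] by simp
  have "\<phi> (cls_ideal a x) * \<phi> (y_ideal a) = \<phi> (princ D (x * y_pt a))"
    unfolding cls_ideal_y[OF a, symmetric]
    using phi_mult cls_ideal_int_ideal[OF a x] base(4,5)[OF a] True by simp
  also have "\<dots> = x * y_pt a * ch' (x * y_pt a)" using phi_princ cop y_mult_OK[OF a x(1)] by blast
  finally have "\<phi> (cls_ideal a x) * \<phi> (y_ideal a) = x * y_pt a * psi (x * y_pt a)" using cop by (simp add: psi_def)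
  moreover have "\<phi> (y_ideal a) \<noteq> 0" using phi_nonzero base(4,5)[OF a] by blast
  ultimately show ?thesis using True by (simp add: Kc_def field_simps)
next
  case False
  then show ?thesis using coprime_cls_ideal_iff[OF a x] by (simp add: psi_def)
qed

definition ratio :: "complex set \<Rightarrow> real" where
  "ratio I = (cmod (\<phi> I))\<^sup>2 / real (ideal_norm D I)"

text \<open>\<open>psi\<close> has modulus 1 here, so \<open>|x|^2\<close> occurs in numerator and
  denominator and cancels; only the class is left.\<close>

lemma ratio_cls_ideal:
  assumes a: "a \<in> {1..h}" and x: "x \<in> latt (z a)" "x \<noteq> 0" and cop: "coprime_ideals (cls_ideal a x) cf"
  shows "ratio (cls_ideal a x) = (cmod (Kc a))\<^sup>2 / of_int (A a)"
proof -
  have "psi (x * y_pt a) \<noteq> 0"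
    using coprime_cls_ideal_iff[OF a x] cop chi'_char y_mult_OK[OF a x(1)] by (auto simp: psi_def char_mod_def)
  then have "cmod (psi (x * y_pt a)) = 1" by (rule psi_norm[OF y_mult_OK[OF a x(1)]])
  then have "cmod (\<phi> (cls_ideal a x)) = cmod (Kc a) * cmod x"
    using phi_cls_ideal[OF a x] cop by (simp add: norm_mult)
  then show ?thesis unfolding ratio_def cls_ideal_norm[OF a x] using x(2) by (simp add: power_mult_distrib)
qed

lemma ratio_eq_1:
  assumes I: "int_ideal D I" "coprime_ideals I cf" shows "ratio I = 1"
proof -
  \<comment> \<open>\<open>J n\<close> is the power of \<open>I\<close> with exponent
    \<open>n + 1\<close>; starting at \<open>I\<close> avoids the unit ideal.\<close>
  define J where "J = rec_nat I (\<lambda>_ L. idl_mult I L)"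
  have J0: "J 0 = I" and JS: "\<And>n. J (Suc n) = idl_mult I (J n)" by (simp_all add: J_def)
  have J: "int_ideal D (J n) \<and> coprime_ideals (J n) cf \<and> ratio (J n) = ratio I ^ Suc n" for n
  proof (induction n)
    case 0
    then show ?case using I by (simp add: J0)
  next
    case (Suc n)
    have "coprime_ideals (idl_mult I (J n)) cf"
      using I Suc by (intro coprime_idl_mult cf_is_ideal) (auto simp: int_ideal_def is_ideal_def)
    moreover have "ratio (idl_mult I (J n)) = ratio I * ratio (J n)"
    proof -
      have "\<phi> (idl_mult I (J n)) = \<phi> I * \<phi> (J n)" using phi_mult I Suc by blast
      moreover have "ideal_norm D (idl_mult I (J n)) = ideal_norm D I * ideal_norm D (J n)"
        using ideal_norm_mult I Suc by blast
      ultimately show ?thesis by (simp add: ratio_def norm_mult power_mult_distrib)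
    qed
    ultimately show ?case using int_ideal_idl_mult[OF I(1), of "J n"] Suc by (simp add: JS)
  qed
  have "ratio I ^ Suc n \<in> (\<lambda>a. (cmod (Kc a))\<^sup>2 / of_int (A a)) ` {1..h}" for n
  proof -
    obtain a x where ax: "a \<in> {1..h}" "x \<in> latt (z a)" "x \<noteq> 0" "J n = cls_ideal a x"
      using ideal_classify J by blast
    then have "ratio (J n) = (cmod (Kc a))\<^sup>2 / of_int (A a)" using ratio_cls_ideal J[of n] by metis
    then show ?thesis using J[of n] ax(1) by auto
  qed
  moreover have "ratio I > 0" using phi_nonzero I ideal_norm_princ(2)[OF I(1)] by (simp add: ratio_def)
  ultimately show ?thesis
    by (intro powers_in_finite_set[of "(\<lambda>a. (cmod (Kc a))\<^sup>2 / of_int (A a)) ` {1..h}"]) auto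
qed

lemma norm_Kc: "a \<in> {1..h} \<Longrightarrow> cmod (Kc a) = sqrt (of_int (A a))"
proof -
  assume a: "a \<in> {1..h}"
  have "(cmod (Kc a))\<^sup>2 / of_int (A a) = 1"
    using ratio_cls_ideal[OF a base(1-3)[OF a]] ratio_eq_1[OF cls_ideal_int_ideal[OF a base(1,2)[OF a]] base(3)[OF a]]
    by (simp only:)
  moreover have "A a > 0" using forms a by blast
  ultimately have "(cmod (Kc a))\<^sup>2 = of_int (A a)" by simp
  then show ?thesis by (metis abs_norm_cancel real_sqrt_abs)
qed

end


context hecke_theta_setup begin

section \<open>Decomposition of the Hecke theta function\<close>

definition coef_fun :: "nat \<Rightarrow> complex \<Rightarrow> complex" where
  "coef_fun a x = psi (x * y_pt a)"

text \<open>A difference in \<open>c b\<close> becomes an element of \<open>c * (y b)\<close>, which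
  lies in \<open>c\<close> because \<open>y b\<close> is integral, and hence in
  \<open>cf\<close>.\<close>

lemma coef_fun_periodic:
  assumes a: "a \<in> {1..h}"
  shows "cm_lattice.periodic D (z a) f (coef_fun a)"
proof -
  interpret cm_lattice D "A a" "B a" "C a" "z a" f by (rule cm_lattice_rep[OF a])
  show ?thesis
    unfolding periodic_def coef_fun_def
  proof (intro ballI impI)
    fix x x' assume x: "x \<in> latt (z a)" "x' \<in> latt (z a)" "x - x' \<in> cL"
    obtain t where t: "t \<in> latt (z a)" "x - x' = of_nat f * sqrtD D * t" using x(3) by (auto simp: cL_def)
    have "x * y_pt a - x' * y_pt a = (x - x') * y_pt a" by (simp add: algebra_simps)
    also have "\<dots> = of_nat f * sqrtD D * (t * y_pt a)" by (simp add: t)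
    also have "\<dots> \<in> cideal D f" unfolding cideal_def princ_def by (intro imageI y_mult_OK[OF a t(1)])
    finally show "psi (x * y_pt a) = psi (x' * y_pt a)"
      using cideal_sub_cf x y_mult_OK[OF a] by (intro psi_cong) auto
  qed
qed

text \<open>\<open>psi\<close> is multiplicative and restricts to the inverse of \<open>ch\<close>
  on elements prime to \<open>cideal D f\<close>.\<close>

lemma coef_fun_eigen:
  assumes a: "a \<in> {1..h}" and \<alpha>: "\<alpha> \<in> OK D" "coprime_elt D \<alpha> (cideal D f)" and x: "x \<in> latt (z a)"
  shows "ch \<alpha> * coef_fun a (\<alpha> * x) = coef_fun a x"
proof -
  have "coef_fun a (\<alpha> * x) = psi \<alpha> * coef_fun a x"
    unfolding coef_fun_def mult.assoc by (rule psi_mult[OF \<alpha>(1) y_mult_OK[OF a x]])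
  moreover have "coprime_elt D \<alpha> cf"
    using \<alpha>(2) coprime_ideals_mono[OF _ subset_refl cideal_sub_cf] unfolding coprime_elt_def by blast
  then have "psi \<alpha> = inverse (ch \<alpha>)" using pullback \<alpha> by (simp add: psi_def)
  moreover have "ch \<alpha> \<noteq> 0" using chi_char \<alpha> unfolding char_mod_def by blast
  ultimately show ?thesis by simp
qed

lemma norm_cls_val:
  assumes a: "a \<in> {1..h}" and b: "\<beta> \<in> disc_grp f (A a) (B a) (C a)"
    and nz: "cm_lattice.cls_val D (z a) f (coef_fun a) \<beta> \<noteq> 0"
  shows "cmod (cm_lattice.cls_val D (z a) f (coef_fun a) \<beta>) = 1"
proof -
  interpret cm_lattice D "A a" "B a" "C a" "z a" f by (rule cm_lattice_rep[OF a])
  obtain y where y: "y \<in> dual" "\<beta> = coset y" using b by (auto simp: disc_grp_def)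
  have v: "cls_val (coef_fun a) \<beta> = psi (om y * y_pt a)"
    using cls_val_coset[OF coef_fun_periodic[OF a] y(1)] by (simp add: y(2) coef_fun_def)
  show ?thesis using nz unfolding v by (intro psi_norm y_mult_OK[OF a]) (simp add: om_mem_iff y)
qed

text \<open>The number of units corrects for counting each ideal once per generator
  \<open>x\<close>, and \<open>kappa\<close> for the normalization of
  \<open>theta_fa\<close>.\<close>

definition weight :: "nat \<Rightarrow> complex" where
  "weight a = Kc a / (of_nat (card (units_OK D)) * cm_lattice.kappa D (A a) f)"

text \<open>The moduli of \<open>Kc a\<close> and \<open>kappa\<close> both contain
  \<open>sqrt (A a)\<close>. It cancels, which leaves a value independent of
  \<open>a\<close>.\<close>

lemma norm_weight:
  assumes a: "a \<in> {1..h}"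
  shows "cmod (weight a) = sqrt (real f) * sqrt (of_int (- D)) / (sqrt 2 * real (card (units_OK D)))"
proof -
  interpret cm_lattice D "A a" "B a" "C a" "z a" f by (rule cm_lattice_rep[OF a])
  have "cmod (sqrtD D) = sqrt (of_int (- D))" using D_neg by (simp add: sqrtD_def norm_mult)
  then have "cmod kappa = sqrt 2 * sqrt (of_int (A a)) * sqrt (real f) / (real f * sqrt (of_int (- D)))"
    unfolding kappa_def using A_pos by (simp add: norm_divide norm_mult real_sqrt_mult)
  also have "\<dots> = sqrt 2 * sqrt (of_int (A a)) / (sqrt (real f) * sqrt (of_int (- D)))"
  proof -
    have "u * s / (s * s * d) = u / (s * d)" if "s \<noteq> 0" for u s d :: real using that by simp
    from this[of "sqrt (real f)" "sqrt 2 * sqrt (of_int (A a))" "sqrt (of_int (- D))"]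
    show ?thesis using f_pos by simp
  qed
  finally have "cmod kappa = sqrt 2 * sqrt (of_int (A a)) / (sqrt (real f) * sqrt (of_int (- D)))" .
  note kap = this
  have "s / (w * (t * s / p)) = p / (t * w)" if "s \<noteq> 0" for s w t p :: real using that by simp
  then show ?thesis
    unfolding weight_def norm_divide norm_mult norm_Kc[OF a] kap norm_of_nat using A_pos by simp
qed

text \<open>Pairing a chosen generator of each ideal with all units lists every nonzero lattice
  vector exactly once.\<close>

lemma ideals_units_bij:
  obtains \<Psi> :: "complex set \<times> complex \<Rightarrow> nat \<times> complex" where
    "bij_betw \<Psi> ({I. int_ideal D I} \<times> units_OK D) (SIGMA a:{1..h}. latt (z a) - {0})"
    "\<And>I u. int_ideal D I \<Longrightarrow> u \<in> units_OK D \<Longrightarrow> (case \<Psi> (I, u) of (a, x) \<Rightarrow> cls_ideal a x) = I"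
proof -
  let ?X = "SIGMA a:{1..h}. latt (z a) - {0}" and ?Y = "{I. int_ideal D I} \<times> units_OK D"
  define sel where "sel I = (SOME p. fst p \<in> {1..h} \<and> snd p \<in> latt (z (fst p)) \<and> snd p \<noteq> 0 \<and> I = cls_ideal (fst p) (snd p))" for I
  define aI where "aI I = fst (sel I)" for I
  define xI where "xI I = snd (sel I)" for I
  have ax: "aI I \<in> {1..h} \<and> xI I \<in> latt (z (aI I)) \<and> xI I \<noteq> 0 \<and> I = cls_ideal (aI I) (xI I)"
    if I: "int_ideal D I" for I
  proof -
    obtain a x where "a \<in> {1..h} \<and> x \<in> latt (z a) \<and> x \<noteq> 0 \<and> I = cls_ideal a x"
      using ideal_classify[OF I] by blast
    then have "\<exists>p. fst p \<in> {1..h} \<and> snd p \<in> latt (z (fst p)) \<and> snd p \<noteq> 0 \<and> I = cls_ideal (fst p) (snd p)"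
      by (intro exI[of _ "(a, x)"]) simp
    then show ?thesis unfolding aI_def xI_def sel_def by (rule someI_ex)
  qed
  define \<Psi> where "\<Psi> = (\<lambda>(I, u). (aI I, u * xI I))"
  have id: "cls_ideal (aI I) (u * xI I) = I" if "int_ideal D I" "u \<in> units_OK D" for I u
  proof -
    interpret cm_lattice D "A (aI I)" "B (aI I)" "C (aI I)" "z (aI I)" f
      by (rule cm_lattice_rep) (use ax that in blast)
    show ?thesis using inv_ideal_unit[OF that(2)] ax[OF that(1)] by metis
  qed
  have unz: "u \<noteq> 0" if "u \<in> units_OK D" for u using unit_cmod[OF that] by auto
  have "bij_betw \<Psi> ?Y ?X"
    unfolding bij_betw_def
  proof
    show "inj_on \<Psi> ?Y"
    proof (rule inj_onI)
      fix p q assume pq: "p \<in> ?Y" "q \<in> ?Y" "\<Psi> p = \<Psi> q"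
      obtain I u J v where p: "p = (I, u)" and q: "q = (J, v)" by (metis surj_pair)
      have I: "int_ideal D I" "u \<in> units_OK D" and J: "int_ideal D J" "v \<in> units_OK D" using pq p q by auto
      have eq: "aI I = aI J" "u * xI I = v * xI J" using pq(3) by (simp_all add: \<Psi>_def p q)
      have "cls_ideal (aI I) (u * xI I) = cls_ideal (aI J) (v * xI J)" by (simp only: eq)
      then have IJ: "I = J" unfolding id[OF I] id[OF J] .
      have "xI I \<noteq> 0" using ax[OF I(1)] by blast
      then have "u = v" using eq(2) IJ by (metis mult_right_cancel)
      then show "p = q" using p q IJ by blast
    qed
    show "\<Psi> ` ?Y = ?X"
    proof (intro equalityI subsetI)
      fix p assume "p \<in> \<Psi> ` ?Y"
      then obtain I u where I: "int_ideal D I" "u \<in> units_OK D" "p = (aI I, u * xI I)" by (auto simp: \<Psi>_def)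
      interpret cm_lattice D "A (aI I)" "B (aI I)" "C (aI I)" "z (aI I)" f
        by (rule cm_lattice_rep) (use ax I in blast)
      have "u \<in> OK D" using I(2) by (simp add: units_OK_def)
      then have "u * xI I \<in> latt (z (aI I))" using latt_OK_mult ax[OF I(1)] by blast
      moreover have "aI I \<in> {1..h}" "xI I \<noteq> 0" using ax[OF I(1)] by blast+
      ultimately show "p \<in> ?X" using unz[OF I(2)] unfolding I(3) by simp
    next
      fix p assume "p \<in> ?X"
      then obtain a x where p: "p = (a, x)" "a \<in> {1..h}" "x \<in> latt (z a)" "x \<noteq> 0"
        unfolding Sigma_def by blast
      let ?I = "cls_ideal a x"
      have I: "int_ideal D ?I" by (rule cls_ideal_int_ideal[OF p(2-4)])
      have axI: "aI ?I \<in> {1..h}" "xI ?I \<noteq> 0" "cls_ideal (aI ?I) (xI ?I) = ?I" using ax[OF I] by blast+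
      have ai: "aI ?I = a" by (rule cls_ideal_class_unique[OF axI(1) p(2) axI(2) p(4) axI(3)])
      interpret cm_lattice D "A a" "B a" "C a" "z a" f by (rule cm_lattice_rep[OF p(2)])
      have "x / xI ?I \<in> units_OK D"
        by (rule inv_ideal_eqD[OF axI(3)[unfolded ai] axI(2) p(4)])
      moreover have "\<Psi> (?I, x / xI ?I) = p" using axI(2) ai p(1) by (simp add: \<Psi>_def)
      ultimately show "p \<in> \<Psi> ` ?Y" using I by (intro image_eqI[of _ _ "(?I, x / xI ?I)"]) auto
    qed
  qed
  moreover have "(case \<Psi> (I, u) of (a, x) \<Rightarrow> cls_ideal a x) = I" if "int_ideal D I" "u \<in> units_OK D" for I u
    using id[OF that] by (simp add: \<Psi>_def)
  ultimately show ?thesis using that by blast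
qed

lemma hecke_theta_lattice_sum:
  assumes \<tau>: "Im \<tau> > 0"
  shows "hecke_theta D \<phi> cf \<tau>
    = (\<Sum>a\<in>{1..h}. Kc a / of_nat (card (units_OK D)) * infsum (\<lambda>x. coef_fun a x * cm_lattice.gterm (A a) \<tau> x) (latt (z a)))"
proof -
  define F where "F = (\<lambda>I. (if coprime_ideals I cf then \<phi> I else 0) * exp (2 * pi * \<i> * \<tau> * of_nat (ideal_norm D I)))"
  define S where "S = (\<lambda>a. Kc a * infsum (\<lambda>x. coef_fun a x * cm_lattice.gterm (A a) \<tau> x) (latt (z a)))"
  let ?X = "SIGMA a:{1..h}. latt (z a) - {0}" and ?Y = "{I. int_ideal D I} \<times> units_OK D"
  let ?G = "\<lambda>(a, x). F (cls_ideal a x)"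
  have part: "(?G has_sum S a) (Pair a ` (latt (z a) - {0}))" if a: "a \<in> {1..h}" for a
  proof -
    interpret cm_lattice D "A a" "B a" "C a" "z a" f by (rule cm_lattice_rep[OF a])
    have "((\<lambda>x. coef_fun a x * gterm \<tau> x) has_sum infsum (\<lambda>x. coef_fun a x * gterm \<tau> x) (latt (z a))) (latt (z a))"
      by (intro has_sum_infsum theta_fa_sum(2) coef_fun_periodic[OF a] gterm_summable[OF \<tau>])
    \<comment> \<open>The lattice point 0 corresponds to no nonzero ideal; it may be dropped because
      \<open>gterm\<close> contains the factor \<open>x\<close>.\<close>
    then have "((\<lambda>x. coef_fun a x * gterm \<tau> x) has_sum infsum (\<lambda>x. coef_fun a x * gterm \<tau> x) (latt (z a))) (latt (z a) - {0})"
      by (rule has_sum_cong_neutral[THEN iffD1, rotated -1]) (auto simp: gterm_def)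
    then have "((\<lambda>x. Kc a * (coef_fun a x * gterm \<tau> x)) has_sum S a) (latt (z a) - {0})"
      unfolding S_def by (rule has_sum_cmult_right)
    moreover have "F (cls_ideal a x) = Kc a * (coef_fun a x * gterm \<tau> x)" if x: "x \<in> latt (z a) - {0}" for x
    proof -
      have x': "x \<in> latt (z a)" "x \<noteq> 0" using x by auto
      have "(of_nat (ideal_norm D (cls_ideal a x)) :: complex) = of_real (real (ideal_norm D (cls_ideal a x)))" by simp
      also have "\<dots> = of_real (of_int (A a) * (cmod x)\<^sup>2)" unfolding cls_ideal_norm[OF a x'] ..
      finally show ?thesis
        unfolding F_def phi_cls_ideal[OF a x'] coef_fun_def gterm_def by (simp only: mult.assoc)
    qed
    ultimately have "((\<lambda>x. F (cls_ideal a x)) has_sum S a) (latt (z a) - {0})"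
      by (subst has_sum_cong) auto
    then show ?thesis by (subst has_sum_reindex) (auto simp: inj_on_def o_def)
  qed
  have "(?G has_sum sum S {1..h}) (\<Union>a\<in>{1..h}. Pair a ` (latt (z a) - {0}))"
    by (intro sum_has_sum part) auto
  moreover have "(\<Union>a\<in>{1..h}. Pair a ` (latt (z a) - {0})) = ?X" by auto
  ultimately have X: "(?G has_sum sum S {1..h}) ?X" by simp
  obtain \<Psi> :: "complex set \<times> complex \<Rightarrow> nat \<times> complex" where bij: "bij_betw \<Psi> ?Y ?X"
    and id: "\<And>I u. int_ideal D I \<Longrightarrow> u \<in> units_OK D \<Longrightarrow> (case \<Psi> (I, u) of (a, x) \<Rightarrow> cls_ideal a x) = I"
    by (rule ideals_units_bij) blast
  have "((\<lambda>p. ?G (\<Psi> p)) has_sum sum S {1..h}) ?Y" using X has_sum_reindex_bij_betw[OF bij, of ?G] by simp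
  moreover have "?G (\<Psi> p) = F (fst p)" if "p \<in> ?Y" for p
  proof -
    obtain I u where p: "p = (I, u)" "int_ideal D I" "u \<in> units_OK D" using \<open>p \<in> ?Y\<close> by auto
    obtain a x where ax: "\<Psi> p = (a, x)" by fastforce
    show ?thesis using id[OF p(2,3)] ax p(1) by simp
  qed
  ultimately have "((\<lambda>p. F (fst p)) has_sum sum S {1..h}) ?Y" by (subst (asm) has_sum_cong) auto
  \<comment> \<open>The summand does not depend on the unit, so each finite fibre contributes the
    number of units times \<open>F I\<close>.\<close>
  then have "((\<lambda>I. of_nat (card (units_OK D)) * F I) has_sum sum S {1..h}) {I. int_ideal D I}"
    by (rule has_sum_SigmaD) (simp add: has_sum_finite_iff[OF finite_units])
  then have "infsum (\<lambda>I. of_nat (card (units_OK D)) * F I) {I. int_ideal D I} = sum S {1..h}" by (rule infsumI)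
  then have "of_nat (card (units_OK D)) * hecke_theta D \<phi> cf \<tau> = sum S {1..h}"
    unfolding hecke_theta_def F_def infsum_cmult_right' .
  then have "hecke_theta D \<phi> cf \<tau> = sum S {1..h} / of_nat (card (units_OK D))"
    using card_units_pos by (simp add: field_simps)
  then show ?thesis by (simp add: S_def sum_divide_distrib)
qed

lemma hecke_theta_theta_fa:
  assumes \<tau>: "Im \<tau> > 0"
  shows "hecke_theta D \<phi> cf \<tau> = (\<Sum>a\<in>{1..h}. \<Sum>\<beta>\<in>disc_grp f (A a) (B a) (C a).
     weight a * cm_lattice.cls_val D (z a) f (coef_fun a) \<beta> * theta_fa D f (A a) (B a) (C a) (z a) \<tau> \<beta>)"
  unfolding hecke_theta_lattice_sum[OF \<tau>]
proof (rule sum.cong[OF refl])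
  fix a assume a: "a \<in> {1..h}"
  interpret cm_lattice D "A a" "B a" "C a" "z a" f by (rule cm_lattice_rep[OF a])
  show "Kc a / of_nat (card (units_OK D)) * infsum (\<lambda>x. coef_fun a x * gterm \<tau> x) (latt (z a))
     = (\<Sum>\<beta>\<in>disc_group. weight a * cls_val (coef_fun a) \<beta> * theta_fa D f (A a) (B a) (C a) (z a) \<tau> \<beta>)"
    unfolding theta_fa_sum(1)[OF coef_fun_periodic[OF a] gterm_summable[OF \<tau>]] sum_distrib_left
    by (simp add: weight_def mult.assoc)
qed

text \<open>Averaging multiplied the coset sum by the order of the CM group; the coefficients are
  divided by that order.\<close>

lemma hecke_theta_twisted:
  assumes \<tau>: "Im \<tau> > 0"
  shows "hecke_theta D \<phi> cf \<tau> = (\<Sum>a\<in>{1..h}. \<Sum>\<beta>\<in>disc_grp f (A a) (B a) (C a).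
     weight a / of_nat (card (cm_group D (cideal D f))) * cm_lattice.cls_val D (z a) f (coef_fun a) \<beta>
       * twisted D f (A a) (B a) (C a) (z a) ch \<tau> \<beta>)"
  unfolding hecke_theta_theta_fa[OF \<tau>]
proof (rule sum.cong[OF refl])
  fix a assume a: "a \<in> {1..h}"
  interpret cm_lattice D "A a" "B a" "C a" "z a" f by (rule cm_lattice_rep[OF a])
  have tw: "(\<Sum>\<beta>\<in>disc_group. cls_val (coef_fun a) \<beta> * twisted D f (A a) (B a) (C a) (z a) ch \<tau> \<beta>)
     = of_nat (card (cm_group D (cideal D f))) *
       (\<Sum>\<beta>\<in>disc_group. cls_val (coef_fun a) \<beta> * theta_fa D f (A a) (B a) (C a) (z a) \<tau> \<beta>)"
    by (rule twisted_sum[OF coef_fun_periodic[OF a]]) (rule coef_fun_eigen[OF a])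
  have "(\<Sum>\<beta>\<in>disc_group. weight a / of_nat (card (cm_group D (cideal D f))) * cls_val (coef_fun a) \<beta>
       * twisted D f (A a) (B a) (C a) (z a) ch \<tau> \<beta>)
     = weight a / of_nat (card (cm_group D (cideal D f))) *
       (\<Sum>\<beta>\<in>disc_group. cls_val (coef_fun a) \<beta> * twisted D f (A a) (B a) (C a) (z a) ch \<tau> \<beta>)"
    by (simp only: sum_distrib_left mult.assoc)
  also have "\<dots> = weight a * (\<Sum>\<beta>\<in>disc_group. cls_val (coef_fun a) \<beta> * theta_fa D f (A a) (B a) (C a) (z a) \<tau> \<beta>)"
    unfolding tw using card_cm_group_pos by simp
  finally show "(\<Sum>\<beta>\<in>disc_group. weight a * cls_val (coef_fun a) \<beta> * theta_fa D f (A a) (B a) (C a) (z a) \<tau> \<beta>)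
     = (\<Sum>\<beta>\<in>disc_group. weight a / of_nat (card (cm_group D (cideal D f))) * cls_val (coef_fun a) \<beta>
       * twisted D f (A a) (B a) (C a) (z a) ch \<tau> \<beta>)"
    by (simp only: sum_distrib_left mult.assoc)
qed

end

theorem theorem3p3p4:
  fixes D :: int and f h :: nat and z :: "nat \<Rightarrow> complex" and A B C :: "nat \<Rightarrow> int"
    and ch ch' :: "complex \<Rightarrow> complex" and \<phi> :: "complex set \<Rightarrow> complex" and cf :: "complex set"
  assumes K: "fundamental_disc D" "D < 0"
    and f_pos: "f > 0"
    and reps_CM: "\<forall>a\<in>{1..h}. Im (z a) > 0 \<and> has_CM_OK D (latt (z a))"
    and reps_distinct: "\<forall>a\<in>{1..h}. \<forall>b\<in>{1..h}. a \<noteq> b \<longrightarrow> \<not> homothetic (latt (z a)) (latt (z b))"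
    and reps_all: "\<forall>w. Im w > 0 \<longrightarrow> has_CM_OK D (latt w) \<longrightarrow>
                      (\<exists>a\<in>{1..h}. homothetic (latt w) (latt (z a)))"
    and forms: "\<forall>a\<in>{1..h}. A a > 0 \<and> gcd (gcd (A a) (B a)) (C a) = 1 \<and>
                  of_int (A a) * (z a)\<^sup>2 + of_int (B a) * z a + of_int (C a) = 0"
    and chi_char: "char_mod D (cideal D f) ch"
    and chi_units: "\<forall>u\<in>units_OK D. ch u = u"
    and cf_ideal: "int_ideal D cf" "ideal_dvd D cf (cideal D f)"
    and phi_mult: "\<forall>I J. int_ideal D I \<longrightarrow> int_ideal D J \<longrightarrow> coprime_ideals I cf \<longrightarrow>
                     coprime_ideals J cf \<longrightarrow> \<phi> (idl_mult I J) = \<phi> I * \<phi> J"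
    and phi_nonzero: "\<forall>I. int_ideal D I \<longrightarrow> coprime_ideals I cf \<longrightarrow> \<phi> I \<noteq> 0"
    and chi'_char: "char_mod D cf ch'"
    and phi_princ: "\<forall>\<alpha>\<in>OK D. coprime_elt D \<alpha> cf \<longrightarrow> \<phi> (princ D \<alpha>) = \<alpha> * ch' \<alpha>"
    and conductor: "\<forall>m. int_ideal D m \<longrightarrow> ideal_dvd D m cf \<longrightarrow>
                      (\<forall>\<alpha>\<in>OK D. coprime_elt D \<alpha> cf \<longrightarrow> \<alpha> - 1 \<in> m \<longrightarrow> ch' \<alpha> = 1) \<longrightarrow> m = cf"
    and pullback: "\<forall>\<alpha>\<in>OK D. coprime_elt D \<alpha> (cideal D f) \<longrightarrow> ch' \<alpha> = inverse (ch \<alpha>)"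
  shows "(\<exists>d :: nat \<Rightarrow> (rat \<times> rat) set \<Rightarrow> complex. \<forall>\<tau>. Im \<tau> > 0 \<longrightarrow>
            hecke_theta D \<phi> cf \<tau> =
              (\<Sum>a\<in>{1..h}. \<Sum>\<beta>0\<in>disc_grp f (A a) (B a) (C a).
                 d a \<beta>0 * twisted D f (A a) (B a) (C a) (z a) ch \<tau> \<beta>0))
       \<and> (\<exists>c :: nat \<Rightarrow> (rat \<times> rat) set \<Rightarrow> complex.
            (\<forall>\<tau>. Im \<tau> > 0 \<longrightarrow>
              hecke_theta D \<phi> cf \<tau> =
                (\<Sum>a\<in>{1..h}. \<Sum>\<beta>\<in>disc_grp f (A a) (B a) (C a).
                   c a \<beta> * theta_fa D f (A a) (B a) (C a) (z a) \<tau> \<beta>))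
          \<and> (\<exists>r. \<forall>a\<in>{1..h}. \<forall>\<beta>\<in>disc_grp f (A a) (B a) (C a). c a \<beta> \<noteq> 0 \<longrightarrow> cmod (c a \<beta>) = r))"
proof -
  interpret S: hecke_theta_setup D f h z A B C ch ch' \<phi> cf
    by unfold_locales (fact assms)+
  let ?c = "\<lambda>a \<beta>. S.weight a * cm_lattice.cls_val D (z a) f (S.coef_fun a) \<beta>"
  have "cmod (?c a \<beta>) = sqrt (real f) * sqrt (of_int (- D)) / (sqrt 2 * real (card (units_OK D)))"
    if "a \<in> {1..h}" "\<beta> \<in> disc_grp f (A a) (B a) (C a)" "?c a \<beta> \<noteq> 0" for a \<beta>
  proof -
    \<comment> \<open>A nonzero product has a nonzero second factor, which is then a value of
      \<open>psi\<close> of modulus 1.\<close>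
    have "cmod (cm_lattice.cls_val D (z a) f (S.coef_fun a) \<beta>) = 1"
      using that by (intro S.norm_cls_val) auto
    then show ?thesis using S.norm_weight[OF that(1)] by (simp add: norm_mult)
  qed
  then have "\<exists>r. \<forall>a\<in>{1..h}. \<forall>\<beta>\<in>disc_grp f (A a) (B a) (C a). ?c a \<beta> \<noteq> 0 \<longrightarrow> cmod (?c a \<beta>) = r"
    by blast
  then show ?thesis
    using S.hecke_theta_twisted S.hecke_theta_theta_fa
    by (intro conjI exI[of _ ?c]
        exI[of _ "\<lambda>a \<beta>. S.weight a / of_nat (card (cm_group D (cideal D f))) * cm_lattice.cls_val D (z a) f (S.coef_fun a) \<beta>"]) blast+
qed

end
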